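(* Let $\Omega$, $\tau_0>0$, $Y$, $a$ and a (possibly unsteady) background flow $(u_0,p_0,\rho_0,\varphi_0,c_0)$ be as described in the context. Assume that $w$ is a sufficiently regular solution to the initial--boundary value problem for Galbrun's equation $$\rho_0D_0\big(D_0w-(w\cdot\nabla)u_0\big)-\nabla\big(c_0^2\nabla\cdot(\rho_0w)\big)+\rho_0\big((D_0w-(w\cdot\nabla)u_0)\cdot\nabla\big)u_0+\frac{\nabla p_0}{\rho_0}\nabla\cdot(\rho_0w)=\rho_0\,\delta\varphi\quad\text{in }\Omega\text{ for all }t\in(0,\tau),$$ $$w=w_{\mathrm I}\ \text{ and }\ \partial_tw=z_{\mathrm I}\quad\text{in }\Omega\text{ at }t=0,$$ $$-Yc_0\rho_0^{-1}\nabla\cdot(\rho_0w)-n\cdot\big((\partial_t+\mathcal L_{u_0})w\big)=g\quad\text{on }\partial\Omega\text{ for all }t\in(0,\tau),$$ for sufficiently regular data $w_{\mathrm I},z_{\mathrm I},\delta\varphi,g$ and a sufficiently regular background flow that is everywhere tangential to the boundary, that is, $n\cdot u_0=0$ on $\partial\Omega$. Then, for any finite time $\tau>0$, there exist $C,\nu>0$ that are independent of $w$ such that for any $0<t<\tau$ $$\tau_0^{-2}\|w(t)\|^2+\|c_0\rho_0^{-1}\nabla\cdot(\rho_0w)(t)\|^2+\|(\partial_t+\mathcal L_{u_0})w(t)\|^2$$ $$\le Ce^{\nu t}\Big(\tau_0^{-2}\|w_{\mathrm I}\|^2+\|c_0(0)\rho_0(0)^{-1}\nabla\cdot(\rho_0(0)w_{\mathrm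 I})\|^2+\|z_{\mathrm I}+\mathcal L_{u_0(0)}w_{\mathrm I}\|^2+\int_0^t\big(\tau_0\|\delta\varphi(s)\|^2+a^{-1}\overline{c_0}\,\|g(s)\|_{\partial\Omega}^2\big)\,\mathrm ds\Big).$$
   Context: $\Omega\subset\mathbb R^d$ is open, bounded, connected, lying locally on one side of its Lipschitz boundary $\partial\Omega$, with outward unit normal $n$. $\|\cdot\|$ and $\|\cdot\|_{\partial\Omega}$ are the standard $L^2(\Omega)^k$ and $L^2(\partial\Omega)^k$ norms. $Y:\partial\Omega\to[0,\infty)$ is a Lipschitz continuous admittance function with $Y\ge a$ for a constant $a>0$. $\tau_0>0$ is an arbitrary constant (time scale), and $0<\tau<\infty$. $D_0=\partial_t+u_0\cdot\nabla$ is the material derivative and $\mathcal L_{u_0}w=(u_0\cdot\nabla)w-(w\cdot\nabla)u_0$ the Lie derivative, so $(\partial_t+\mathcal L_{u_0})w=D_0w-(w\cdot\nabla)u_0$. The unknown $w$ is $\mathbb R^d$-valued (the Lagrangian displacement). The background flow consists of (time-dependent) velocity $u_0$ ($\mathbb R^d$-valued), pressure $p_0$, density $\rho_0$, volume force density $\varphi_0$, and speed of sound $c_0=\sqrt{\Sigma'(\rho_0)}$, satisfying Euler's equations in $\Omega\times(0,\tau)$: $\rho_0D_0u_0+\nabla p_0=\rho_0\varphi_0$, $D_0\rho_0+\rho_0\nabla\cdot u_0=0$, $p_0=\Sigma(\rho_0)$, where $\Sigma$ is the equation of state. It is assumed that $0<\underline{\rho_0}:=\inf_{\bar\Omega\times[0,\tau]}\rho_0\le\sup_{\bar\Omega\times[0,\tau]}\rho_0=:\overline{\rho_0}<\infty$,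 $0<\underline{c_0}:=\inf_{\bar\Omega\times[0,\tau]}c_0\le\sup_{\bar\Omega\times[0,\tau]}c_0=:\overline{c_0}<\infty$, $\sup_{t\in[0,\tau]}\|\nabla u_0(t)\|_{L^\infty(\Omega)^{d\times d}}<\infty$, and $\sup_{t\in[0,\tau]}\|(c_0^{-1}D_0c_0)(t)\|_{L^\infty(\Omega)}<\infty$. "Sufficiently regular" is used without specifying function classes: this is an a priori estimate in which enough regularity of the solution, the data and the background flow is assumed. *)

theory Defs
  imports "HOL-Analysis.Analysis"
begin

section \<open>Regularity\<close>

primrec Ck_on :: "nat \<Rightarrow> 'a set \<Rightarrow> ('a::real_normed_vector \<Rightarrow> 'b::real_normed_vector) \<Rightarrow> bool" where
  "Ck_on 0 U f \<longleftrightarrow> continuous_on U f"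
| "Ck_on (Suc k) U f \<longleftrightarrow> (\<forall>x\<in>U. f differentiable (at x)) \<and>
     (\<forall>v. Ck_on k U (\<lambda>x. frechet_derivative f (at x) v))"

text \<open>Regularity up to the boundary: the restriction to \<open>K\<close> of a function that is \<open>C\<^sup>k\<close> on an open
  neighbourhood of \<open>K\<close>. Values and derivatives of order at most \<open>k\<close> on a set \<open>K\<close> that is the closure of
  its interior depend on the values in the interior only, so that two-sided derivatives can be used
  at boundary points and at the end points of the time interval.\<close>

definition Ck_up_to :: "nat \<Rightarrow> 'a set \<Rightarrow> ('a::real_normed_vector \<Rightarrow> 'b::real_normed_vector) \<Rightarrow> bool" where
  "Ck_up_to k K f \<longleftrightarrow> (\<exists>U. open U \<and> K \<subseteq> U \<and> Ck_on k U f)"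

section \<open>Differential operators\<close>

text \<open>Time-dependent fields are functions of \<open>t\<close> and \<open>x\<close>, in this order. The directional derivative
  \<open>(v \<cdot> \<nabla>) f\<close> at \<open>x\<close> is \<open>frechet_derivative f (at x) v\<close>.\<close>

definition grad :: "('a::euclidean_space \<Rightarrow> real) \<Rightarrow> 'a \<Rightarrow> 'a" where
  "grad f x = (\<Sum>b\<in>Basis. frechet_derivative f (at x) b *\<^sub>R b)"

definition divg :: "('a::euclidean_space \<Rightarrow> 'a) \<Rightarrow> 'a \<Rightarrow> real" where
  "divg f x = (\<Sum>b\<in>Basis. frechet_derivative f (at x) b \<bullet> b)"

definition dt :: "(real \<Rightarrow> 'a \<Rightarrow> 'b::real_normed_vector) \<Rightarrow> real \<Rightarrow> 'a \<Rightarrow> 'b" where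
  "dt f t x = vector_derivative (\<lambda>s. f s x) (at t)"

definition material ::
    "(real \<Rightarrow> 'a \<Rightarrow> 'a) \<Rightarrow> (real \<Rightarrow> 'a::euclidean_space \<Rightarrow> 'b::real_normed_vector) \<Rightarrow> real \<Rightarrow> 'a \<Rightarrow> 'b" where
  "material u f t x = dt f t x + frechet_derivative (f t) (at x) (u t x)"

definition Lie :: "('a \<Rightarrow> 'a) \<Rightarrow> ('a::euclidean_space \<Rightarrow> 'a) \<Rightarrow> 'a \<Rightarrow> 'a" where
  "Lie u w x = frechet_derivative w (at x) (u x) - frechet_derivative u (at x) (w x)"

definition dt_Lie ::
    "(real \<Rightarrow> 'a \<Rightarrow> 'a) \<Rightarrow> (real \<Rightarrow> 'a::euclidean_space \<Rightarrow> 'a) \<Rightarrow> real \<Rightarrow> 'a \<Rightarrow> 'a" where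
  "dt_Lie u w t x = dt w t x + Lie (u t) (w t) x"

definition L2_norm :: "'c measure \<Rightarrow> ('c \<Rightarrow> 'b::real_normed_vector) \<Rightarrow> real" where
  "L2_norm M f = sqrt (LINT x|M. (norm (f x))\<^sup>2)"

section \<open>Lipschitz domains, surface measure and outward unit normal\<close>

text \<open>Inside \<open>U\<close>, the set \<open>\<Omega>\<close> is the part below the graph of a Lipschitz function over the hyperplane
  orthogonal to the unit vector \<open>e\<close>. A function on the hyperplane is represented by
  its extension to the whole space that is constant in direction \<open>e\<close>.\<close>

definition local_graph ::
    "'a::euclidean_space set \<Rightarrow> 'a \<Rightarrow> ('a \<Rightarrow> real) \<Rightarrow> 'a set \<Rightarrow> bool" where
  "local_graph \<Omega> e h U \<longleftrightarrow>
     norm e = 1 \<and> (\<exists>L. L-lipschitz_on UNIV h) \<and> (\<forall>x s. h (x + s *\<^sub>R e) = h x) \<and>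
     open U \<and> \<Omega> \<inter> U = {x \<in> U. x \<bullet> e < h x}"

definition lipschitz_domain :: "'a::euclidean_space set \<Rightarrow> bool" where
  "lipschitz_domain \<Omega> \<longleftrightarrow> open \<Omega> \<and> bounded \<Omega> \<and> connected \<Omega> \<and>
     (\<forall>x\<in>frontier \<Omega>. \<exists>e h U. local_graph \<Omega> e h U \<and> x \<in> U)"

text \<open>The surface measure is determined by its form \<open>sqrt (1 + |\<nabla>h|\<^sup>2) dx'\<close> in local graph
  coordinates (independent of the chosen graph by the area formula). Integration \<open>dx'\<close> over the
  hyperplane orthogonal to \<open>e\<close> is integration over the slab \<open>0 \<le> x \<bullet> e < 1\<close> of functions that are constant
  in direction \<open>e\<close>. The point of the graph on the line through \<open>x\<close> in direction \<open>e\<close> is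
  \<open>x + (h x - x \<bullet> e) e\<close>. In dimension one this is the counting measure of the end points.\<close>

definition is_surface_measure :: "'a::euclidean_space set \<Rightarrow> 'a measure \<Rightarrow> bool" where
  "is_surface_measure \<Omega> \<sigma> \<longleftrightarrow>
     sets \<sigma> = sets borel \<and> emeasure \<sigma> (- frontier \<Omega>) = 0 \<and>
     (\<forall>e h U A. local_graph \<Omega> e h U \<longrightarrow> A \<in> sets borel \<longrightarrow> A \<subseteq> frontier \<Omega> \<inter> U \<longrightarrow>
        emeasure \<sigma> A =
          (\<integral>\<^sup>+x\<in>{x. 0 \<le> x \<bullet> e \<and> x \<bullet> e < 1}.
             indicator A (x + (h x - x \<bullet> e) *\<^sub>R e) * ennreal (sqrt (1 + (norm (grad h x))\<^sup>2)) \<partial>lborel))"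

text \<open>Since \<open>grad h x\<close> is orthogonal to \<open>e\<close>, the vector \<open>e - grad h x\<close> is \<open>(-\<nabla>h, 1)\<close> in graph coordinates.
  By Rademacher's theorem a Lipschitz domain has an outward unit normal at almost every boundary point.\<close>

definition is_outward_unit_normal :: "'a::euclidean_space set \<Rightarrow> 'a \<Rightarrow> 'a \<Rightarrow> bool" where
  "is_outward_unit_normal \<Omega> x \<nu> \<longleftrightarrow>
     (\<exists>e h U. local_graph \<Omega> e h U \<and> x \<in> frontier \<Omega> \<inter> U \<and> h differentiable (at x) \<and>
        \<nu> = (1 / sqrt (1 + (norm (grad h x))\<^sup>2)) *\<^sub>R (e - grad h x))"

section \<open>Background flow and Galbrun's equation\<close>

definition background_flow ::
    "'a::euclidean_space set \<Rightarrow> real \<Rightarrow> (real \<Rightarrow> real) \<Rightarrow> (real \<Rightarrow> 'a \<Rightarrow> 'a) \<Rightarrow> (real \<Rightarrow> 'a \<Rightarrow> real) \<Rightarrow>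
     (real \<Rightarrow> 'a \<Rightarrow> real) \<Rightarrow> (real \<Rightarrow> 'a \<Rightarrow> 'a) \<Rightarrow> (real \<Rightarrow> 'a \<Rightarrow> real) \<Rightarrow> bool" where
  "background_flow \<Omega> \<tau> eos u\<^sub>0 p\<^sub>0 \<rho>\<^sub>0 \<phi>\<^sub>0 c\<^sub>0 \<longleftrightarrow>
    (let Q = {0..\<tau>} \<times> closure \<Omega> in
     \<comment> \<open>regularity\<close>
     Ck_up_to 2 Q (\<lambda>(t, x). u\<^sub>0 t x) \<and> Ck_up_to 2 Q (\<lambda>(t, x). \<rho>\<^sub>0 t x) \<and>
     Ck_up_to 1 Q (\<lambda>(t, x). p\<^sub>0 t x) \<and> Ck_up_to 1 Q (\<lambda>(t, x). c\<^sub>0 t x) \<and>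
     Ck_up_to 0 Q (\<lambda>(t, x). \<phi>\<^sub>0 t x) \<and> Ck_up_to 1 ((\<lambda>(t, x). \<rho>\<^sub>0 t x) ` Q) eos \<and>
     \<comment> \<open>Euler's equations, equation of state, speed of sound\<close>
     (\<forall>t\<in>{0<..<\<tau>}. \<forall>x\<in>\<Omega>.
        \<rho>\<^sub>0 t x *\<^sub>R material u\<^sub>0 u\<^sub>0 t x + grad (p\<^sub>0 t) x = \<rho>\<^sub>0 t x *\<^sub>R \<phi>\<^sub>0 t x \<and>
        material u\<^sub>0 \<rho>\<^sub>0 t x + \<rho>\<^sub>0 t x * divg (u\<^sub>0 t) x = 0) \<and>
     (\<forall>(t, x)\<in>Q. p\<^sub>0 t x = eos (\<rho>\<^sub>0 t x) \<and> c\<^sub>0 t x = sqrt (deriv eos (\<rho>\<^sub>0 t x))) \<and>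
     \<comment> \<open>bounds\<close>
     0 < (INF (t, x)\<in>Q. \<rho>\<^sub>0 t x) \<and> bdd_above ((\<lambda>(t, x). \<rho>\<^sub>0 t x) ` Q) \<and>
     0 < (INF (t, x)\<in>Q. c\<^sub>0 t x) \<and> bdd_above ((\<lambda>(t, x). c\<^sub>0 t x) ` Q) \<and>
     (\<exists>M. \<forall>t\<in>{0..\<tau>}. AE x in lebesgue_on \<Omega>. onorm (frechet_derivative (u\<^sub>0 t) (at x)) \<le> M) \<and>
     (\<exists>M. \<forall>t\<in>{0..\<tau>}. AE x in lebesgue_on \<Omega>. \<bar>material u\<^sub>0 c\<^sub>0 t x / c\<^sub>0 t x\<bar> \<le> M))"

definition galbrun_regular ::
    "'a::euclidean_space set \<Rightarrow> 'a measure \<Rightarrow> real \<Rightarrow> (real \<Rightarrow> 'a \<Rightarrow> 'a) \<Rightarrow> ('a \<Rightarrow> 'a) \<Rightarrow> ('a \<Rightarrow> 'a) \<Rightarrow>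
     (real \<Rightarrow> 'a \<Rightarrow> 'a) \<Rightarrow> (real \<Rightarrow> 'a \<Rightarrow> real) \<Rightarrow> bool" where
  "galbrun_regular \<Omega> \<sigma> \<tau> w w\<^sub>I z\<^sub>I \<delta>\<phi> g \<longleftrightarrow>
     Ck_up_to 2 ({0..\<tau>} \<times> closure \<Omega>) (\<lambda>(t, x). w t x) \<and>
     Ck_up_to 1 (closure \<Omega>) w\<^sub>I \<and> Ck_up_to 0 (closure \<Omega>) z\<^sub>I \<and>
     Ck_up_to 0 ({0..\<tau>} \<times> closure \<Omega>) (\<lambda>(t, x). \<delta>\<phi> t x) \<and>
     \<comment> \<open>\<open>g\<close> involves the normal, which need not be continuous\<close>
     (\<lambda>(t, x). g t x) \<in> borel_measurable (restrict_space lborel {0<..<\<tau>} \<Otimes>\<^sub>M \<sigma>) \<and>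
     integrable (restrict_space lborel {0<..<\<tau>} \<Otimes>\<^sub>M \<sigma>) (\<lambda>(t, x). (g t x)\<^sup>2)"

definition galbrun_solution ::
    "'a::euclidean_space set \<Rightarrow> 'a measure \<Rightarrow> ('a \<Rightarrow> 'a) \<Rightarrow> ('a \<Rightarrow> real) \<Rightarrow> real \<Rightarrow>
     (real \<Rightarrow> 'a \<Rightarrow> 'a) \<Rightarrow> (real \<Rightarrow> 'a \<Rightarrow> real) \<Rightarrow> (real \<Rightarrow> 'a \<Rightarrow> real) \<Rightarrow> (real \<Rightarrow> 'a \<Rightarrow> real) \<Rightarrow>
     (real \<Rightarrow> 'a \<Rightarrow> 'a) \<Rightarrow> ('a \<Rightarrow> 'a) \<Rightarrow> ('a \<Rightarrow> 'a) \<Rightarrow> (real \<Rightarrow> 'a \<Rightarrow> 'a) \<Rightarrow> (real \<Rightarrow> 'a \<Rightarrow> real) \<Rightarrow> bool" where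
  "galbrun_solution \<Omega> \<sigma> n Y \<tau> u\<^sub>0 p\<^sub>0 \<rho>\<^sub>0 c\<^sub>0 w w\<^sub>I z\<^sub>I \<delta>\<phi> g \<longleftrightarrow>
    (let m = (\<lambda>t x. divg (\<lambda>y. \<rho>\<^sub>0 t y *\<^sub>R w t y) x);
         v = (\<lambda>t x. material u\<^sub>0 w t x - frechet_derivative (u\<^sub>0 t) (at x) (w t x)) in
     (\<forall>t\<in>{0<..<\<tau>}. \<forall>x\<in>\<Omega>.
        \<rho>\<^sub>0 t x *\<^sub>R material u\<^sub>0 v t x
        - grad (\<lambda>y. (c\<^sub>0 t y)\<^sup>2 * m t y) x
        + \<rho>\<^sub>0 t x *\<^sub>R frechet_derivative (u\<^sub>0 t) (at x) (v t x)
        + m t x *\<^sub>R ((1 / \<rho>\<^sub>0 t x) *\<^sub>R grad (p\<^sub>0 t) x)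
        = \<rho>\<^sub>0 t x *\<^sub>R \<delta>\<phi> t x) \<and>
     (\<forall>x\<in>\<Omega>. w 0 x = w\<^sub>I x \<and> dt w 0 x = z\<^sub>I x) \<and>
     (\<forall>t\<in>{0<..<\<tau>}. AE x in \<sigma>.
        - (Y x * c\<^sub>0 t x / \<rho>\<^sub>0 t x * m t x) - n x \<bullet> dt_Lie u\<^sub>0 w t x = g t x))"

end

theory Submission
  imports Defs
begin

text \<open>Let \<open>\<pi> = c m / \<rho>\<close> with \<open>m = div (\<rho> w)\<close>, and let \<open>v = (\<partial>\<^sub>t + L\<^sub>u) w\<close>. The energy density
  \<open>e = \<rho> (\<pi>\<^sup>2 + |v|\<^sup>2 + |w|\<^sup>2 / \<tau>\<^sub>0\<^sup>2) / 2\<close> satisfies a local balance: \<open>\<partial>\<^sub>t e + div (e u - c\<^sup>2 m v)\<close> is a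
  quadratic expression in \<open>\<pi>\<close>, \<open>v\<close>, \<open>w\<close> with bounded coefficients plus \<open>\<rho> v \<bullet> \<delta>\<phi>\<close>. The reason is that
  \<open>m / \<rho>\<close> is a divergence with respect to a transported density, so that \<open>D\<^sub>0 (m / \<rho>) = div (\<rho> v) / \<rho>\<close>,
  and that \<open>\<nabla>p = c\<^sup>2 \<nabla>\<rho>\<close> cancels the remaining derivatives of \<open>\<rho>\<close>. In space-time this commutation is
  a statement on the Lie bracket of \<open>(1, u)\<close> and \<open>(0, w)\<close>. On the boundary \<open>n \<bullet> u = 0\<close>, and the
  impedance condition makes \<open>c\<^sup>2 m (n \<bullet> v) = - \<rho> c (\<pi> g + Y \<pi>\<^sup>2) \<le> \<rho> c g\<^sup>2 / (4 a)\<close>. Integration in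
  space and time gives the estimate.

  The divergence theorem is localised by a partition of unity. In a chart, the region below the
  graph is translated by \<open>s b\<close>, and the derivative at \<open>s = 0\<close> of the integral of a function over it is
  computed line by line. This needs differentiability of the graph almost everywhere, which is
  transferred to all charts from the assumption on the normal, so that Rademacher's theorem is not
  used.\<close>

section \<open>Calculus of continuously differentiable functions\<close>

text \<open>The energy contains \<open>|w|\<^sup>2\<close> although Galbrun's equation directly
  controls only \<open>\<pi>\<close> and \<open>v\<close>: the definition of \<open>v\<close> reads
  \<open>D\<^sub>0 w = v + (w \<bullet> \<nabla>) u\<close>, so the growth of \<open>w\<close> is
  bounded by \<open>v\<close> and \<open>w\<close> themselves and the estimate closes. The factor
  \<open>\<rho>\<close> is natural because mass conservation turns
  \<open>\<partial>\<^sub>t (\<rho> f) + div (\<rho> f u)\<close> into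
  \<open>\<rho> D\<^sub>0 f\<close>. The flow enters the constants only through bounds: the exponent
  collects those of \<open>\<nabla>u\<close> and \<open>D\<^sub>0 c / c\<close> together with the
  weights of Young's inequality, and the factor in front is twice the ratio of the density bounds.
  Hence both are available before \<open>w\<close> is chosen.

  Much of the remaining work is due to the boundary. The surface measure is known only through its
  chart formula, the normal is given almost everywhere by some chart that varies with the point, and
  neither \<open>n\<close> nor \<open>grad h\<close> has to be measurable. This calls for Borel
  versions of both and for a comparison of two graphs at a common point.\<close>

abbreviation Df :: "('a::real_normed_vector \<Rightarrow> 'b::real_normed_vector) \<Rightarrow> 'a \<Rightarrow> 'a \<Rightarrow> 'b" where
  "Df f x \<equiv> frechet_derivative f (at x)"

lemma Df_eqI: "(f has_derivative f') (at x) \<Longrightarrow> Df f x = f'"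
  by (metis frechet_derivative_at)

lemma has_derivative_Df: "f differentiable (at x) \<Longrightarrow> (f has_derivative Df f x) (at x)"
  by (simp add: frechet_derivative_works)

lemma Ck_on_1_iff:
  "Ck_on 1 G f \<longleftrightarrow> (\<forall>x\<in>G. f differentiable (at x)) \<and> (\<forall>v. continuous_on G (\<lambda>x. Df f x v))"
  by simp

lemma Ck_on_1D:
  assumes "Ck_on 1 G f"
  shows "x \<in> G \<Longrightarrow> f differentiable (at x)" "x \<in> G \<Longrightarrow> (f has_derivative Df f x) (at x)"
    "continuous_on G (\<lambda>x. Df f x v)" "continuous_on G f"
  using assms unfolding Ck_on_1_iff
  by (auto simp: has_derivative_Df intro!: differentiable_imp_continuous_on
      simp: differentiable_on_def differentiable_at_withinI)

lemma Ck_on_1I: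
  assumes "\<And>x. x \<in> G \<Longrightarrow> (f has_derivative f' x) (at x)" "\<And>v. continuous_on G (\<lambda>x. f' x v)"
  shows "Ck_on 1 G f"
proof -
  have *: "Df f x = f' x" if "x \<in> G" for x using Df_eqI[OF assms(1)[OF that]] .
  show ?thesis unfolding Ck_on_1_iff
    using assms by (auto simp: * differentiable_def cong: continuous_on_cong)
qed

text \<open>Derivatives are taken in the whole space and not within the set, so passing to an
  arbitrary subset, open or not, leaves them unchanged.\<close>

lemma Ck_on_subset: "Ck_on k G f \<Longrightarrow> H \<subseteq> G \<Longrightarrow> Ck_on k H f"
proof (induction k arbitrary: f)
  case 0 then show ?case by (auto intro: continuous_on_subset)
next
  case (Suc k) then show ?case by auto
qed

lemma Ck_on_2D:
  assumes "Ck_on 2 G f"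
  shows "Ck_on 1 G f" "Ck_on 1 G (\<lambda>x. Df f x v)"
proof -
  have *: "\<And>x. x \<in> G \<Longrightarrow> f differentiable (at x)" "\<And>v. Ck_on 1 G (\<lambda>x. Df f x v)"
    using assms by (auto simp: numeral_2_eq_2)
  show "Ck_on 1 G (\<lambda>x. Df f x v)" by (rule *)
  show "Ck_on 1 G f" unfolding Ck_on_1_iff using * Ck_on_1D(4)[OF *(2)] by auto
qed

lemma Df_linear:
  assumes "f differentiable (at x)"
  shows "Df f x (u + v) = Df f x u + Df f x v" "Df f x (u - v) = Df f x u - Df f x v"
    "Df f x (r *\<^sub>R u) = r *\<^sub>R Df f x u" "Df f x (\<Sum>i\<in>I. h i) = (\<Sum>i\<in>I. Df f x (h i))"
    "Df f x 0 = 0" "Df f x (- u) = - Df f x u"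
  using linear_frechet_derivative[OF assms]
  by (auto simp: linear_add linear_diff linear_cmul linear_sum linear_0 linear_neg)

text \<open>Linearity moves a variable direction into real coefficients. This reduces derivatives
  along vector fields to the constant directions about which \<open>Ck_on\<close> gives
  information.\<close>

lemma Df_basis:
  fixes f :: "'a::euclidean_space \<Rightarrow> 'b::real_normed_vector"
  assumes "f differentiable (at x)"
  shows "Df f x v = (\<Sum>b\<in>Basis. (v \<bullet> b) *\<^sub>R Df f x b)"
proof -
  have "Df f x v = Df f x (\<Sum>b\<in>Basis. (v \<bullet> b) *\<^sub>R b)" by (simp add: euclidean_representation)
  then show ?thesis by (simp add: Df_linear[OF assms])
qed

lemma Ck_on_1_const: "Ck_on 1 G (\<lambda>x. c)"
  by (rule Ck_on_1I[where f'="\<lambda>x v. 0"]) (auto intro: derivative_intros)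

lemma Ck_on_1_bounded_linear:
  assumes "bounded_linear f" shows "Ck_on 1 G f"
  by (rule Ck_on_1I[where f'="\<lambda>x. f"])
    (auto intro: assms bounded_linear_imp_has_derivative)

lemma Ck_on_1_compose_linear:
  assumes "bounded_linear g" "Ck_on 1 G f" shows "Ck_on 1 G (\<lambda>x. g (f x))"
proof (rule Ck_on_1I[where f'="\<lambda>x v. g (Df f x v)"])
  show "((\<lambda>x. g (f x)) has_derivative (\<lambda>v. g (Df f x v))) (at x)" if "x \<in> G" for x
    using bounded_linear.has_derivative[OF assms(1) Ck_on_1D(2)[OF assms(2) that]] .
  show "continuous_on G (\<lambda>x. g (Df f x v))" for v
    using bounded_linear.continuous_on[OF assms(1) Ck_on_1D(3)[OF assms(2)]] .
qed

lemma Ck_on_1_add: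
  assumes "Ck_on 1 G f" "Ck_on 1 G g"
  shows "Ck_on 1 G (\<lambda>x. f x + g x)"
  by (rule Ck_on_1I[where f'="\<lambda>x v. Df f x v + Df g x v"])
    (auto intro!: has_derivative_add continuous_intros Ck_on_1D[OF assms(1)] Ck_on_1D[OF assms(2)] simp del: Ck_on.simps)

lemma Ck_on_1_diff:
  assumes "Ck_on 1 G f" "Ck_on 1 G g"
  shows "Ck_on 1 G (\<lambda>x. f x - g x)"
  by (rule Ck_on_1I[where f'="\<lambda>x v. Df f x v - Df g x v"])
    (auto intro!: has_derivative_diff continuous_intros Ck_on_1D[OF assms(1)] Ck_on_1D[OF assms(2)])

lemma Ck_on_1_sum:
  assumes "\<And>i. i \<in> I \<Longrightarrow> Ck_on 1 G (f i)"
  shows "Ck_on 1 G (\<lambda>x. \<Sum>i\<in>I. f i x)"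
  by (rule Ck_on_1I[where f'="\<lambda>x v. \<Sum>i\<in>I. Df (f i) x v"])
    (auto intro!: has_derivative_sum continuous_intros Ck_on_1D[OF assms])

lemma Ck_on_1_bilinear:
  assumes "bounded_bilinear P" "Ck_on 1 G f" "Ck_on 1 G g"
  shows "Ck_on 1 G (\<lambda>x. P (f x) (g x))"
  by (rule Ck_on_1I[where f'="\<lambda>x v. P (f x) (Df g x v) + P (Df f x v) (g x)"])
    (auto intro!: bounded_bilinear.FDERIV[OF assms(1)] continuous_intros
      bounded_bilinear.continuous_on[OF assms(1)] Ck_on_1D[OF assms(2)] Ck_on_1D[OF assms(3)])

lemmas Ck_on_1_scaleR = Ck_on_1_bilinear[OF bounded_bilinear_scaleR]
  and Ck_on_1_mult = Ck_on_1_bilinear[OF bounded_bilinear_mult]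
  and Ck_on_1_inner = Ck_on_1_bilinear[OF bounded_bilinear_inner]

lemma Df_add:
  assumes "f differentiable (at x)" "g differentiable (at x)"
  shows "Df (\<lambda>x. f x + g x) x v = Df f x v + Df g x v"
  using Df_eqI[OF has_derivative_add[OF assms[THEN has_derivative_Df]]] by simp

lemma Df_diff:
  assumes "f differentiable (at x)" "g differentiable (at x)"
  shows "Df (\<lambda>x. f x - g x) x v = Df f x v - Df g x v"
  using Df_eqI[OF has_derivative_diff[OF assms[THEN has_derivative_Df]]] by simp

lemma Df_sum:
  assumes "\<And>i. i \<in> I \<Longrightarrow> f i differentiable (at x)"
  shows "Df (\<lambda>x. \<Sum>i\<in>I. f i x) x v = (\<Sum>i\<in>I. Df (f i) x v)"
proof -
  have "((\<lambda>x. \<Sum>i\<in>I. f i x) has_derivative (\<lambda>v. \<Sum>i\<in>I. Df (f i) x v)) (at x)"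
    by (intro has_derivative_sum has_derivative_Df assms)
  from Df_eqI[OF this] show ?thesis by simp
qed

lemma Df_bilinear:
  assumes "bounded_bilinear P" "f differentiable (at x)" "g differentiable (at x)"
  shows "Df (\<lambda>x. P (f x) (g x)) x v = P (f x) (Df g x v) + P (Df f x v) (g x)"
  using Df_eqI[OF bounded_bilinear.FDERIV[OF assms(1) assms(2,3)[THEN has_derivative_Df]]] by simp

lemmas Df_scaleR = Df_bilinear[OF bounded_bilinear_scaleR]
  and Df_mult = Df_bilinear[OF bounded_bilinear_mult]

lemma Df_linear_compose:
  assumes "bounded_linear g" "f differentiable (at x)"
  shows "Df (\<lambda>x. g (f x)) x v = g (Df f x v)"
  using Df_eqI[OF bounded_linear.has_derivative[OF assms(1) has_derivative_Df[OF assms(2)]]] by simp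

lemma Ck_on_1_real_compose:
  fixes f :: "'a::real_normed_vector \<Rightarrow> real"
  assumes "Ck_on 1 G f" "\<And>x. x \<in> G \<Longrightarrow> (\<phi> has_real_derivative \<phi>' (f x)) (at (f x))"
    and "continuous_on (f ` G) \<phi>'"
  shows "Ck_on 1 G (\<lambda>x. \<phi> (f x))"
proof (rule Ck_on_1I[where f'="\<lambda>x v. \<phi>' (f x) * Df f x v"])
  show "((\<lambda>x. \<phi> (f x)) has_derivative (\<lambda>v. \<phi>' (f x) * Df f x v)) (at x)" if "x \<in> G" for x
    using has_derivative_compose[OF Ck_on_1D(2)[OF assms(1) that]
       assms(2)[OF that, unfolded has_field_derivative_def]] .
  show "continuous_on G (\<lambda>x. \<phi>' (f x) * Df f x v)" for v
    by (intro continuous_intros Ck_on_1D(3)[OF assms(1)]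
        continuous_on_compose2[OF assms(3) Ck_on_1D(4)[OF assms(1)]]) auto
qed

lemma Ck_on_1_inverse:
  fixes f :: "'a::real_normed_vector \<Rightarrow> real"
  assumes "Ck_on 1 G f" "\<And>x. x \<in> G \<Longrightarrow> f x \<noteq> 0"
  shows "Ck_on 1 G (\<lambda>x. inverse (f x))"
  by (rule Ck_on_1_real_compose[OF assms(1), where \<phi>'="\<lambda>y. - (inverse y ^ 2)"])
    (use assms(2) in \<open>auto intro!: continuous_intros derivative_eq_intros
      simp: power2_eq_square\<close>)

lemma Ck_on_1_divide:
  fixes f :: "'a::real_normed_vector \<Rightarrow> real"
  assumes "Ck_on 1 G f" "Ck_on 1 G g" "\<And>x. x \<in> G \<Longrightarrow> g x \<noteq> 0"
  shows "Ck_on 1 G (\<lambda>x. f x / g x)"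
  unfolding divide_inverse by (intro Ck_on_1_mult Ck_on_1_inverse assms)

lemma Df_divide:
  fixes f g :: "'a::real_normed_vector \<Rightarrow> real"
  assumes "f differentiable (at x)" "g differentiable (at x)" "g x \<noteq> 0"
  shows "Df (\<lambda>x. f x / g x) x v = Df f x v / g x - f x * Df g x v / (g x)\<^sup>2"
  using Df_eqI[OF has_derivative_divide[OF assms(1,2)[THEN has_derivative_Df] assms(3)]]
  by (simp add: assms(3) field_simps power2_eq_square)

section \<open>Restriction to lines and symmetry of second derivatives\<close>

lemma DERIV_along_line:
  fixes f :: "'a::real_normed_vector \<Rightarrow> real"
  assumes "f differentiable (at (x + r *\<^sub>R b))"
  shows "((\<lambda>r. f (x + r *\<^sub>R b)) has_real_derivative Df f (x + r *\<^sub>R b) b) (at r)"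
proof -
  have "((\<lambda>r. f (x + r *\<^sub>R b)) has_derivative (\<lambda>p. Df f (x + r *\<^sub>R b) (p *\<^sub>R b))) (at r)"
    by (rule has_derivative_compose[where f="\<lambda>r. x + r *\<^sub>R b" and g=f, OF _ has_derivative_Df[OF assms]])
      (auto intro!: derivative_eq_intros)
  then show ?thesis
    unfolding has_field_derivative_def
    by (rule has_derivative_eq_rhs) (simp add: Df_linear(3)[OF assms] fun_eq_iff mult.commute)
qed

text \<open>The second difference of \<open>f\<close> is symmetric in the two directions, and by the mean value theorem it
  equals either mixed derivative at an intermediate point.\<close>

lemma second_difference_mvt:
  fixes f :: "'a::real_normed_vector \<Rightarrow> real"
  assumes "open G" "Ck_on 2 G f" "z \<in> G" "\<epsilon> > 0"
  shows "\<exists>d>0. \<forall>s. 0 < s \<and> s < d \<longrightarrow>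
    \<bar>(f (z + s *\<^sub>R u + s *\<^sub>R v) - f (z + s *\<^sub>R u) - f (z + s *\<^sub>R v) + f z) / s\<^sup>2
      - Df (\<lambda>y. Df f y u) z v\<bar> < \<epsilon>"
proof -
  let ?g = "\<lambda>y. Df f y u"
  have C: "Ck_on 1 G f" "Ck_on 1 G ?g" using Ck_on_2D[OF assms(2)] by blast+
  have "isCont (\<lambda>y. Df ?g y v) z"
    using Ck_on_1D(3)[OF C(2)] assms(1,3) by (simp add: continuous_on_eq_continuous_at)
  then obtain d0 where d0: "d0 > 0" "\<And>y. dist y z < d0 \<Longrightarrow> dist (Df ?g y v) (Df ?g z v) < \<epsilon>"
    using assms(4) unfolding continuous_at_eps_delta by blast
  obtain d1 where d1: "d1 > 0" "ball z d1 \<subseteq> G" using assms(1,3) openE by blast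
  \<comment> \<open>Points \<open>z + p u + q v\<close> with \<open>p\<close> and \<open>q\<close>
    at most \<open>s\<close> have distance at most \<open>s (norm u + norm v)\<close> from
    \<open>z\<close>; the summand 1 keeps the denominator positive when both vectors vanish.\<close>
  define d where "d = min d0 d1 / (norm u + norm v + 1)"
  have dpos: "d > 0" using d0 d1 by (simp add: d_def add_nonneg_pos)
  have near: "dist (z + p *\<^sub>R u + q *\<^sub>R v) z < min d0 d1"
    if "0 \<le> p" "p \<le> s" "0 \<le> q" "q \<le> s" "s < d" for p q s
  proof -
    have "dist (z + p *\<^sub>R u + q *\<^sub>R v) z \<le> p * norm u + q * norm v"
      using norm_triangle_ineq[of "p *\<^sub>R u" "q *\<^sub>R v"] that by (simp add: dist_norm)
    also have "\<dots> \<le> s * (norm u + norm v + 1)"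
      using that by (simp add: distrib_left mult_right_mono add_mono add_increasing2)
    also have "\<dots> < d * (norm u + norm v + 1)"
      using that by (intro mult_strict_right_mono) (auto simp: add_nonneg_pos)
    also have "\<dots> = min d0 d1" unfolding d_def
      by (smt (verit, ccfv_SIG) nonzero_eq_divide_eq norm_ge_zero)
    finally show ?thesis .
  qed
  have inG: "z + p *\<^sub>R u + q *\<^sub>R v \<in> G" if "0 \<le> p" "p \<le> s" "0 \<le> q" "q \<le> s" "s < d" for p q s
    using near[OF that] d1(2) by (auto simp: mem_ball dist_commute subset_iff)
  show ?thesis
  proof (intro exI[of _ d] conjI allI impI)
    show "0 < d" by (rule dpos)
    fix s assume s: "0 < s \<and> s < d"
    \<comment> \<open>The second difference is the increment of this function. One mean value
      theorem in direction \<open>u\<close> and a second one in direction \<open>v\<close> then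
      produce the mixed derivative.\<close>
    define \<phi> where "\<phi> p = f (z + p *\<^sub>R u + s *\<^sub>R v) - f (z + p *\<^sub>R u)" for p
    have "\<exists>r>0. r < s \<and> \<phi> s - \<phi> 0 = (s - 0) * (?g (z + r *\<^sub>R u + s *\<^sub>R v) - ?g (z + r *\<^sub>R u))"
    proof (rule MVT2)
      fix r assume r: "0 \<le> r" "r \<le> s"
      have a: "z + r *\<^sub>R u + s *\<^sub>R v \<in> G" using inG[of r s s] r s by auto
      have b: "z + r *\<^sub>R u \<in> G" using inG[of r s 0] r s by auto
      have sw: "z + p *\<^sub>R u + s *\<^sub>R v = z + s *\<^sub>R v + p *\<^sub>R u" for p by simp
      show "DERIV \<phi> r :> ?g (z + r *\<^sub>R u + s *\<^sub>R v) - ?g (z + r *\<^sub>R u)"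
        using a b Ck_on_1D(1)[OF C(1)] unfolding \<phi>_def sw by (intro DERIV_diff DERIV_along_line) auto
    qed (use s in auto)
    then obtain r where r: "r > 0" "r < s"
      "\<phi> s - \<phi> 0 = s * (?g (z + r *\<^sub>R u + s *\<^sub>R v) - ?g (z + r *\<^sub>R u))" by auto
    have "\<exists>q>0. q < s \<and> ?g (z + r *\<^sub>R u + s *\<^sub>R v) - ?g (z + r *\<^sub>R u + 0 *\<^sub>R v)
        = (s - 0) * Df ?g (z + r *\<^sub>R u + q *\<^sub>R v) v"
    proof (rule MVT2[where f="\<lambda>q. ?g (z + r *\<^sub>R u + q *\<^sub>R v)"])
      fix q assume q: "0 \<le> q" "q \<le> s"
      have a: "z + r *\<^sub>R u + q *\<^sub>R v \<in> G" using inG[of r s q] r q s by auto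
      show "DERIV (\<lambda>q. ?g (z + r *\<^sub>R u + q *\<^sub>R v)) q :> Df ?g (z + r *\<^sub>R u + q *\<^sub>R v) v"
        by (rule DERIV_along_line[OF Ck_on_1D(1)[OF C(2) a]])
    qed (use s in auto)
    then obtain q where q: "q > 0" "q < s"
      "?g (z + r *\<^sub>R u + s *\<^sub>R v) - ?g (z + r *\<^sub>R u) = s * Df ?g (z + r *\<^sub>R u + q *\<^sub>R v) v" by auto
    have "(f (z + s *\<^sub>R u + s *\<^sub>R v) - f (z + s *\<^sub>R u) - f (z + s *\<^sub>R v) + f z) / s\<^sup>2
        = (\<phi> s - \<phi> 0) / s\<^sup>2" by (simp add: \<phi>_def algebra_simps)
    also have "\<dots> = Df ?g (z + r *\<^sub>R u + q *\<^sub>R v) v"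
      using s unfolding r(3) q(3) by (simp add: power2_eq_square)
    finally show "\<bar>(f (z + s *\<^sub>R u + s *\<^sub>R v) - f (z + s *\<^sub>R u) - f (z + s *\<^sub>R v) + f z) / s\<^sup>2
      - Df ?g z v\<bar> < \<epsilon>"
      using d0(2)[of "z + r *\<^sub>R u + q *\<^sub>R v"] near[of r s q] r q s by (auto simp: dist_real_def)
  qed
qed

lemma mixed_derivatives_eq_real:
  fixes f :: "'a::real_normed_vector \<Rightarrow> real"
  assumes "open G" "Ck_on 2 G f" "z \<in> G"
  shows "Df (\<lambda>y. Df f y u) z v = Df (\<lambda>y. Df f y v) z u"
proof (rule ccontr)
  let ?a = "Df (\<lambda>y. Df f y u) z v" and ?b = "Df (\<lambda>y. Df f y v) z u"
  assume "?a \<noteq> ?b"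
  then have e: "\<bar>?a - ?b\<bar> / 2 > 0" by simp
  obtain d1 where d1: "d1 > 0" "\<And>s. 0 < s \<and> s < d1 \<Longrightarrow>
    \<bar>(f (z + s *\<^sub>R u + s *\<^sub>R v) - f (z + s *\<^sub>R u) - f (z + s *\<^sub>R v) + f z) / s\<^sup>2 - ?a\<bar> < \<bar>?a - ?b\<bar> / 2"
    using second_difference_mvt[OF assms e, of u v] by blast
  obtain d2 where d2: "d2 > 0" "\<And>s. 0 < s \<and> s < d2 \<Longrightarrow>
    \<bar>(f (z + s *\<^sub>R v + s *\<^sub>R u) - f (z + s *\<^sub>R v) - f (z + s *\<^sub>R u) + f z) / s\<^sup>2 - ?b\<bar> < \<bar>?a - ?b\<bar> / 2"
    using second_difference_mvt[OF assms e, of v u] by blast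
  define s where "s = min d1 d2 / 2"
  have s: "0 < s \<and> s < d1" "0 < s \<and> s < d2" using d1(1) d2(1) by (auto simp: s_def)
  have swap: "z + s *\<^sub>R v + s *\<^sub>R u = z + s *\<^sub>R u + s *\<^sub>R v" by (simp add: algebra_simps)
  then have "(f (z + s *\<^sub>R v + s *\<^sub>R u) - f (z + s *\<^sub>R v) - f (z + s *\<^sub>R u) + f z) / s\<^sup>2
    = (f (z + s *\<^sub>R u + s *\<^sub>R v) - f (z + s *\<^sub>R u) - f (z + s *\<^sub>R v) + f z) / s\<^sup>2" unfolding swap by (simp add: algebra_simps)
  moreover have "\<not> (\<bar>x - p\<bar> < \<bar>p - q\<bar> / 2 \<and> \<bar>x - q\<bar> < \<bar>p - q\<bar> / 2)" for x p q :: real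
    by (smt (verit) field_sum_of_halves)
  ultimately show False using d1(2)[OF s(1)] d2(2)[OF s(2)] by metis
qed

text \<open>The first derivative of the component is identified only on \<open>G\<close>; since
  \<open>G\<close> is open, this identity may be differentiated once more.\<close>

lemma Ck_on_2_inner:
  assumes "open G" "Ck_on 2 G f" shows "Ck_on 2 G (\<lambda>x. f x \<bullet> b)"
proof -
  have D: "Df (\<lambda>x. f x \<bullet> b) x v = Df f x v \<bullet> b" if "x \<in> G" for x v
    using Df_linear_compose[OF bounded_linear_inner_left Ck_on_1D(1)[OF Ck_on_2D(1)[OF assms(2)] that]] .
  have C: "Ck_on 1 G (\<lambda>x. Df f x v \<bullet> b)" for v
    by (rule Ck_on_1_compose_linear[OF bounded_linear_inner_left Ck_on_2D(2)[OF assms(2)]])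
  have "Ck_on 1 G (\<lambda>x. Df (\<lambda>x. f x \<bullet> b) x v)" for v
  proof (rule Ck_on_1I[where f'="Df (\<lambda>x. Df f x v \<bullet> b)"])
    show "((\<lambda>x. Df (\<lambda>x. f x \<bullet> b) x v) has_derivative Df (\<lambda>x. Df f x v \<bullet> b) x) (at x)" if "x \<in> G" for x
      using has_derivative_transform_within_open[OF Ck_on_1D(2)[OF C that] assms(1) that] D by metis
  qed (rule Ck_on_1D(3)[OF C])
  then show ?thesis
    using Ck_on_1D(1)[OF Ck_on_1_compose_linear[OF bounded_linear_inner_left Ck_on_2D(1)[OF assms(2)]]]
    by (auto simp: numeral_2_eq_2)
qed

text \<open>The mean value theorem requires real values, so symmetry is transferred from the
  components.\<close>

lemma mixed_derivatives_eq:
  fixes f :: "'a::real_normed_vector \<Rightarrow> 'b::euclidean_space"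
  assumes "open G" "Ck_on 2 G f" "z \<in> G"
  shows "Df (\<lambda>y. Df f y u) z v = Df (\<lambda>y. Df f y v) z u"
proof (rule euclidean_eqI)
  fix b :: 'b assume "b \<in> Basis"
  have D: "Df (\<lambda>x. f x \<bullet> b) x v = Df f x v \<bullet> b" if "x \<in> G" for x v
    using Df_linear_compose[OF bounded_linear_inner_left Ck_on_1D(1)[OF Ck_on_2D(1)[OF assms(2)] that]] .
  have "Df (\<lambda>y. Df f y u) z v \<bullet> b = Df (\<lambda>y. Df (\<lambda>x. f x \<bullet> b) y u) z v" for u v
  proof -
    have "((\<lambda>y. Df (\<lambda>x. f x \<bullet> b) y u) has_derivative (\<lambda>v. Df (\<lambda>y. Df f y u) z v \<bullet> b)) (at z)"
      using has_derivative_transform_within_open[OF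
        bounded_linear.has_derivative[OF bounded_linear_inner_left
          Ck_on_1D(2)[OF Ck_on_2D(2)[OF assms(2)] assms(3)]] assms(1,3)] D by metis
    from Df_eqI[OF this] show ?thesis by simp
  qed
  then show "Df (\<lambda>y. Df f y u) z v \<bullet> b = Df (\<lambda>y. Df f y v) z u \<bullet> b"
    using mixed_derivatives_eq_real[OF assms(1) Ck_on_2_inner[OF assms(1,2)] assms(3)] by metis
qed

text \<open>Fields such as \<open>v\<close> and \<open>m\<close> have usable formulas only inside
  \<open>G\<close>. Agreement on an open set is enough to carry regularity over to them.\<close>

lemma Ck_on_1_cong:
  assumes "open G" "Ck_on 1 G f" "\<And>x. x \<in> G \<Longrightarrow> f x = g x"
  shows "Ck_on 1 G g"
proof (rule Ck_on_1I[where f'="Df f"])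
  show "(g has_derivative Df f x) (at x)" if "x \<in> G" for x
    using has_derivative_transform_within_open[OF Ck_on_1D(2)[OF assms(2) that] assms(1) that] assms(3) by metis
qed (rule Ck_on_1D(3)[OF assms(2)])

lemma Df_cong:
  assumes "open G" "x \<in> G" "\<And>x. x \<in> G \<Longrightarrow> f x = g x"
  shows "Df f x = Df g x"
proof -
  have "(f has_derivative F) (at x) \<longleftrightarrow> (g has_derivative F) (at x)" for F
    using has_derivative_transform_within_open[OF _ assms(1,2)] assms(3) by metis
  then show ?thesis by (simp add: frechet_derivative_def)
qed

text \<open>Derivatives along a vector field, expanded in the basis so that only derivatives in constant
  directions have to be differentiated.\<close>

lemma
  fixes F :: "'a::euclidean_space \<Rightarrow> 'b::euclidean_space"
  assumes "open G" "Ck_on 2 G F" "Ck_on 1 G X"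
  shows Ck_on_1_Df_field: "Ck_on 1 G (\<lambda>z. Df F z (X z))"
    and Df_Df_field: "z \<in> G \<Longrightarrow>
      Df (\<lambda>z. Df F z (X z)) z v = Df F z (Df X z v) + Df (\<lambda>y. Df F y v) z (X z)"
proof -
  let ?S = "\<lambda>z. \<Sum>b\<in>Basis. (X z \<bullet> b) *\<^sub>R Df F z b"
  note C1 = Ck_on_2D(1)[OF assms(2)] and C2 = Ck_on_2D(2)[OF assms(2)]
  have eq: "?S z = Df F z (X z)" if "z \<in> G" for z
    using Df_basis[OF Ck_on_1D(1)[OF C1 that]] by metis
  have CX: "Ck_on 1 G (\<lambda>z. X z \<bullet> b)" for b
    by (rule Ck_on_1_compose_linear[OF bounded_linear_inner_left assms(3)])
  show "Ck_on 1 G (\<lambda>z. Df F z (X z))"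
    by (rule Ck_on_1_cong[OF assms(1) _ eq]) (intro Ck_on_1_sum Ck_on_1_scaleR CX C2)
  assume z: "z \<in> G"
  have "Df (\<lambda>z. Df F z (X z)) z v = Df ?S z v" using Df_cong[OF assms(1) z eq] by simp
  also have "\<dots> = (\<Sum>b\<in>Basis. Df (\<lambda>z. (X z \<bullet> b) *\<^sub>R Df F z b) z v)"
    by (rule Df_sum) (rule Ck_on_1D(1)[OF Ck_on_1_scaleR[OF CX C2] z])
  also have "\<dots> = (\<Sum>b\<in>Basis. (X z \<bullet> b) *\<^sub>R Df (\<lambda>y. Df F y b) z v + (Df X z v \<bullet> b) *\<^sub>R Df F z b)"
    by (intro sum.cong refl, subst Df_scaleR[OF Ck_on_1D(1)[OF CX z] Ck_on_1D(1)[OF C2 z]],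
      subst Df_linear_compose[OF bounded_linear_inner_left Ck_on_1D(1)[OF assms(3) z]]) simp
  \<comment> \<open>Symmetry exchanges \<open>v\<close> with the basis direction, after which the
    sum over the basis is again a derivative along \<open>X\<close>.\<close>
  also have "\<dots> = (\<Sum>b\<in>Basis. (X z \<bullet> b) *\<^sub>R Df (\<lambda>y. Df F y v) z b + (Df X z v \<bullet> b) *\<^sub>R Df F z b)"
    using mixed_derivatives_eq[OF assms(1,2) z] by metis
  also have "\<dots> = Df F z (Df X z v) + Df (\<lambda>y. Df F y v) z (X z)"
    using Df_basis[OF Ck_on_1D(1)[OF C1 z], of "Df X z v"] Df_basis[OF Ck_on_1D(1)[OF C2 z], of v "X z"]
    by (simp add: sum.distrib)
  finally show "Df (\<lambda>z. Df F z (X z)) z v = Df F z (Df X z v) + Df (\<lambda>y. Df F y v) z (X z)" .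
qed

section \<open>Divergences and Lie brackets\<close>

lemma divg_diff:
  assumes "F differentiable (at x)" "G differentiable (at x)"
  shows "divg (\<lambda>x. F x - G x) x = divg F x - divg G x"
  by (simp add: divg_def Df_diff[OF assms] inner_diff_left sum_subtractf)

lemma divg_scaleR:
  fixes F :: "'a::euclidean_space \<Rightarrow> 'a"
  assumes "f differentiable (at x)" "F differentiable (at x)"
  shows "divg (\<lambda>x. f x *\<^sub>R F x) x = f x * divg F x + Df f x (F x)"
proof -
  have "divg (\<lambda>x. f x *\<^sub>R F x) x = (\<Sum>b\<in>Basis. f x * (Df F x b \<bullet> b) + (F x \<bullet> b) * Df f x b)"
    by (simp add: divg_def Df_scaleR[OF assms] inner_add_left algebra_simps)
  also have "\<dots> = f x * divg F x + Df f x (F x)"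
    by (simp add: sum.distrib divg_def sum_distrib_left Df_basis[OF assms(1), of "F x"])
  finally show ?thesis .
qed

text \<open>Both sides are the same double sum of matrix entries. The identity cancels the products
  of first derivatives in the divergence of a Lie bracket.\<close>

lemma trace_comm:
  fixes F G :: "'a::euclidean_space \<Rightarrow> 'a"
  assumes "linear F" "linear G"
  shows "(\<Sum>b\<in>Basis. F (G b) \<bullet> b) = (\<Sum>b\<in>Basis. G (F b) \<bullet> b)"
proof -
  have *: "(\<Sum>b\<in>Basis. H (K b) \<bullet> b) = (\<Sum>b\<in>Basis. \<Sum>c\<in>Basis. (K b \<bullet> c) * (H c \<bullet> b))"
    if "linear H" for H K :: "'a \<Rightarrow> 'a"
  proof (rule sum.cong[OF refl])
    fix b :: 'a
    have "H (K b) = H (\<Sum>c\<in>Basis. (K b \<bullet> c) *\<^sub>R c)" by (simp add: euclidean_representation)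
    then show "H (K b) \<bullet> b = (\<Sum>c\<in>Basis. (K b \<bullet> c) * (H c \<bullet> b))"
      using that by (simp add: linear_sum linear_cmul inner_sum_left)
  qed
  show ?thesis
    unfolding *[OF assms(1)] *[OF assms(2)] by (subst sum.swap) (simp add: mult.commute)
qed

text \<open>The expression of \<open>Lie\<close>, used here on space-time. For
  \<open>X = (1, u)\<close> and \<open>W = (0, w)\<close> its value is
  \<open>(0, dt_Lie u w)\<close>, so that a single bracket contains both the time derivative and the
  Lie derivative.\<close>

definition lie_bracket :: "('a::euclidean_space \<Rightarrow> 'a) \<Rightarrow> ('a \<Rightarrow> 'a) \<Rightarrow> 'a \<Rightarrow> 'a" where
  "lie_bracket X W z = Df W z (X z) - Df X z (W z)"

lemma Ck_on_1_divg:
  fixes F :: "'a::euclidean_space \<Rightarrow> 'a"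
  assumes "Ck_on 2 G F" shows "Ck_on 1 G (divg F)"
  unfolding divg_def[abs_def]
  by (intro Ck_on_1_sum Ck_on_1_compose_linear[OF bounded_linear_inner_left] Ck_on_2D(2)[OF assms])

lemma Df_divg:
  fixes F :: "'a::euclidean_space \<Rightarrow> 'a"
  assumes "Ck_on 2 G F" "z \<in> G"
  shows "Df (divg F) z v = (\<Sum>b\<in>Basis. Df (\<lambda>y. Df F y b) z v \<bullet> b)"
proof -
  have d: "(\<lambda>y. Df F y b) differentiable (at z)" for b
    using Ck_on_1D(1)[OF Ck_on_2D(2)[OF assms(1)] assms(2)] .
  have "Df (divg F) z v = (\<Sum>b\<in>Basis. Df (\<lambda>y. Df F y b \<bullet> b) z v)"
    unfolding divg_def[abs_def] by (rule Df_sum) (use d in auto)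
  also have "\<dots> = (\<Sum>b\<in>Basis. Df (\<lambda>y. Df F y b) z v \<bullet> b)"
    by (simp add: Df_linear_compose[OF bounded_linear_inner_left d])
  finally show ?thesis .
qed

text \<open>Differentiating the direction \<open>X\<close> leaves the trace of a product of
  Jacobians; differentiating \<open>Df W\<close> leaves second derivatives, which symmetry collects
  into the derivative of \<open>divg W\<close> along \<open>X\<close>.\<close>

lemma divg_Df_field:
  fixes X W :: "'a::euclidean_space \<Rightarrow> 'a"
  assumes G: "open G" "Ck_on 1 G X" "Ck_on 2 G W" "z \<in> G"
  shows "divg (\<lambda>z. Df W z (X z)) z = (\<Sum>b\<in>Basis. Df W z (Df X z b) \<bullet> b) + Df (divg W) z (X z)"
  by (simp add: divg_def[of "\<lambda>z. Df W z (X z)"] Df_Df_field[OF G(1,3,2,4)] inner_add_left sum.distrib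
      Df_divg[OF G(3,4)])

text \<open>The two traces of products of Jacobians differ only in the order of the factors and
  cancel.\<close>

lemma divg_lie_bracket:
  fixes X W :: "'a::euclidean_space \<Rightarrow> 'a"
  assumes G: "open G" "Ck_on 2 G X" "Ck_on 2 G W" "z \<in> G"
  shows "divg (lie_bracket X W) z = Df (divg W) z (X z) - Df (divg X) z (W z)"
proof -
  note X1 = Ck_on_2D(1)[OF G(2)] and W1 = Ck_on_2D(1)[OF G(3)]
  have "divg (lie_bracket X W) z = divg (\<lambda>z. Df W z (X z)) z - divg (\<lambda>z. Df X z (W z)) z"
    unfolding lie_bracket_def[abs_def]
    by (rule divg_diff[OF Ck_on_1D(1)[OF Ck_on_1_Df_field[OF G(1,3) X1] G(4)]
          Ck_on_1D(1)[OF Ck_on_1_Df_field[OF G(1,2) W1] G(4)]])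
  also have "\<dots> = Df (divg W) z (X z) - Df (divg X) z (W z)"
    unfolding divg_Df_field[OF G(1) X1 G(3,4)] divg_Df_field[OF G(1) W1 G(2,4)]
    using trace_comm[OF linear_frechet_derivative[OF Ck_on_1D(1)[OF W1 G(4)]]
        linear_frechet_derivative[OF Ck_on_1D(1)[OF X1 G(4)]]] by simp
  finally show ?thesis .
qed

text \<open>On functions, the bracket acts as the commutator of two derivations: the second
  derivatives of \<open>r\<close> occur in both terms and cancel by symmetry.\<close>

lemma Df_lie_bracket:
  fixes X W :: "'a::euclidean_space \<Rightarrow> 'a" and r :: "'a \<Rightarrow> real"
  assumes G: "open G" "Ck_on 1 G X" "Ck_on 1 G W" "Ck_on 2 G r" "z \<in> G"
  shows "Df r z (lie_bracket X W z) = Df (\<lambda>z. Df r z (W z)) z (X z) - Df (\<lambda>z. Df r z (X z)) z (W z)"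
proof -
  have d: "(\<lambda>y. Df r y v) differentiable (at z)" for v
    using Ck_on_1D(1)[OF Ck_on_2D(2)[OF G(4)] G(5)] .
  show ?thesis
    unfolding lie_bracket_def Df_Df_field[OF G(1,4,2,5)] Df_Df_field[OF G(1,4,3,5)]
    using mixed_derivatives_eq[OF G(1,4,5), of "X z" "W z"]
    by (simp add: Df_linear[OF Ck_on_1D(1)[OF Ck_on_2D(1)[OF G(4)] G(5)]])
qed

text \<open>In its logarithmic form \<open>divg W + Df r W / r\<close>, the divergence weighted by \<open>r\<close> can be treated
  symmetrically for \<open>X\<close> and \<open>W\<close>, and it vanishes for \<open>X\<close>.\<close>

lemma transported_divergence:
  fixes X W :: "'a::euclidean_space \<Rightarrow> 'a" and r :: "'a \<Rightarrow> real"
  assumes G: "open G" "Ck_on 2 G X" "Ck_on 2 G W" "Ck_on 2 G r"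
    and pos: "\<And>z. z \<in> G \<Longrightarrow> r z \<noteq> 0"
    and cont: "\<And>z. z \<in> H \<Longrightarrow> divg (\<lambda>z. r z *\<^sub>R X z) z = 0"
    and H: "open H" "H \<subseteq> G" and z: "z \<in> H"
  shows "Df (\<lambda>z. divg (\<lambda>z. r z *\<^sub>R W z) z / r z) z (X z) = divg (\<lambda>z. r z *\<^sub>R lie_bracket X W z) z / r z"
proof -
  note X1 = Ck_on_2D(1)[OF G(2)] and W1 = Ck_on_2D(1)[OF G(3)] and r1 = Ck_on_2D(1)[OF G(4)]
  have zG: "z \<in> G" using z H by auto
  have log: "divg (\<lambda>z. r z *\<^sub>R V z) y / r y = divg V y + Df r y (V y) / r y"
    if "Ck_on 1 G V" "y \<in> G" for V y
    using pos[OF that(2)] divg_scaleR[OF Ck_on_1D(1)[OF r1 that(2)] Ck_on_1D(1)[OF that]]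
    by (simp add: add_divide_distrib)
  have L1: "Ck_on 1 G (lie_bracket X W)"
    unfolding lie_bracket_def[abs_def] by (intro Ck_on_1_diff Ck_on_1_Df_field G X1 W1)
  have D: "Df (\<lambda>y. divg V y + Df r y (V y) / r y) z v = Df (divg V) z v
      + (Df (\<lambda>y. Df r y (V y)) z v / r z - Df r z (V z) * Df r z v / (r z)\<^sup>2)"
    if "Ck_on 2 G V" for V v
  proof -
    note V1 = Ck_on_2D(1)[OF that]
    have f: "Ck_on 1 G (\<lambda>y. Df r y (V y))" by (intro Ck_on_1_Df_field G V1)
    have q: "Ck_on 1 G (\<lambda>y. Df r y (V y) / r y)" by (intro Ck_on_1_divide f r1 pos)
    show ?thesis
      using Df_add[OF Ck_on_1D(1)[OF Ck_on_1_divg[OF that] zG] Ck_on_1D(1)[OF q zG], of v]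
        Df_divide[OF Ck_on_1D(1)[OF f zG] Ck_on_1D(1)[OF r1 zG] pos[OF zG], of v] by simp
  qed
  \<comment> \<open>The logarithmic divergence of \<open>X\<close> vanishes on the whole open set
    \<open>H\<close> and not just at \<open>z\<close>, hence so does its derivative in direction
    \<open>W z\<close>.\<close>
  have "Df (\<lambda>y. divg X y + Df r y (X y) / r y) z = Df (\<lambda>y. 0::real) z"
  proof (rule Df_cong[OF H(1) z])
    show "divg X y + Df r y (X y) / r y = 0" if "y \<in> H" for y
      using log[OF X1, of y] that H cont[OF that] by auto
  qed
  then have zero: "Df (\<lambda>y. divg X y + Df r y (X y) / r y) z (W z) = 0" by simp
  have "Df (\<lambda>z. divg (\<lambda>z. r z *\<^sub>R W z) z / r z) z (X z)
      = Df (\<lambda>y. divg W y + Df r y (W y) / r y) z (X z)"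
    by (rule fun_cong[OF Df_cong[OF G(1) zG log[OF W1]]])
  \<comment> \<open>Subtracting this zero makes the expression antisymmetric in \<open>X\<close> and
    \<open>W\<close>, so that the products of two first derivatives of \<open>r\<close>
    cancel.\<close>
  also have "\<dots> = \<dots> - Df (\<lambda>y. divg X y + Df r y (X y) / r y) z (W z)" by (simp add: zero)
  also have "\<dots> = divg (lie_bracket X W) z + Df r z (lie_bracket X W z) / r z"
    unfolding D[OF G(2)] D[OF G(3)] divg_lie_bracket[OF G(1-3) zG]
      Df_lie_bracket[OF G(1) X1 W1 G(4) zG] by (simp add: diff_divide_distrib mult.commute)
  also have "\<dots> = divg (\<lambda>z. r z *\<^sub>R lie_bracket X W z) z / r z" using log[OF L1 zG] by simp
  finally show ?thesis .
qed

section \<open>Local energy balance\<close>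

lemma
  assumes "case_prod f differentiable (at (t, x))"
  shows differentiable_slice: "f t differentiable (at x)"
    and Df_slice: "Df (f t) x v = Df (case_prod f) (t, x) (0, v)"
    and dt_slice: "dt f t x = Df (case_prod f) (t, x) (1, 0)"
    and has_vector_derivative_slice: "((\<lambda>s. f s x) has_vector_derivative dt f t x) (at t)"
proof -
  note d = has_derivative_Df[OF assms]
  have 1: "((\<lambda>y. case_prod f (t, y)) has_derivative (\<lambda>v. Df (case_prod f) (t, x) (0, v))) (at x)"
    by (rule has_derivative_compose[where f="\<lambda>y. (t, y)" and g="case_prod f", OF _ d])
      (auto intro!: derivative_eq_intros)
  then show "f t differentiable (at x)" by (auto simp: differentiable_def)
  show "Df (f t) x v = Df (case_prod f) (t, x) (0, v)" using Df_eqI[OF 1] by simp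
  have "((\<lambda>s. case_prod f (s, x)) has_derivative (\<lambda>r. Df (case_prod f) (t, x) (r, 0))) (at t)"
    by (rule has_derivative_compose[where f="\<lambda>s. (s, x)" and g="case_prod f", OF _ d])
      (auto intro!: derivative_eq_intros)
  then have "((\<lambda>s. f s x) has_derivative (\<lambda>r. Df (case_prod f) (t, x) (r, 0))) (at t)" by simp
  moreover have "(\<lambda>r. Df (case_prod f) (t, x) (r, 0)) = (\<lambda>r. r *\<^sub>R Df (case_prod f) (t, x) (1, 0))"
  proof
    fix r show "Df (case_prod f) (t, x) (r, 0) = r *\<^sub>R Df (case_prod f) (t, x) (1, 0)"
      using Df_linear(3)[OF assms, of r "(1, 0)"] by simp
  qed
  ultimately have 2: "((\<lambda>s. f s x) has_vector_derivative Df (case_prod f) (t, x) (1, 0)) (at t)"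
    unfolding has_vector_derivative_def by metis
  show 3: "dt f t x = Df (case_prod f) (t, x) (1, 0)"
    unfolding dt_def by (rule vector_derivative_at[OF 2])
  show "((\<lambda>s. f s x) has_vector_derivative dt f t x) (at t)" unfolding 3 by (rule 2)
qed

text \<open>The material derivative is the derivative along the space-time field
  \<open>(1, u)\<close>. Product rule and bracket calculus therefore apply to it without treating
  time separately.\<close>

lemma material_slice:
  assumes "case_prod f differentiable (at (t, x))"
  shows "material u f t x = Df (case_prod f) (t, x) (1, u t x)"
  using Df_linear(1)[OF assms, of "(1, 0)" "(0, u t x)"]
  by (simp add: material_def dt_slice[OF assms] Df_slice[OF assms])

lemma inner_grad:
  fixes f :: "'a::euclidean_space \<Rightarrow> real"
  assumes "f differentiable (at x)"
  shows "v \<bullet> grad f x = Df f x v"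
  by (simp add: grad_def inner_sum_right Df_basis[OF assms, of v] mult.commute)

lemma Df_Pair:
  assumes "f differentiable (at x)" "g differentiable (at x)"
  shows "Df (\<lambda>x. (f x, g x)) x v = (Df f x v, Df g x v)"
  using Df_eqI[OF has_derivative_Pair[OF assms[THEN has_derivative_Df]]] by simp

text \<open>The basis of the product consists of the time direction and the spatial basis. In this
  form the continuity equation says that \<open>\<rho> (1, u)\<close> has no space-time divergence,
  and \<open>m\<close> is the divergence of \<open>\<rho> (0, w)\<close>.\<close>

lemma divg_Pair:
  fixes f :: "real \<times> 'a::euclidean_space \<Rightarrow> real"
  assumes "f differentiable (at (t, x))" "case_prod g differentiable (at (t, x))"
  shows "divg (\<lambda>z. (f z, case_prod g z)) (t, x) = Df f (t, x) (1, 0) + divg (g t) x"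
proof -
  have 1: "(\<Sum>b\<in>(\<lambda>u. (u, 0::'a)) ` Basis. h b) = h (1, 0)" for h :: "real \<times> 'a \<Rightarrow> real"
    by simp
  have 2: "(\<Sum>b\<in>(\<lambda>v. (0::real, v)) ` Basis. h b) = (\<Sum>b\<in>Basis. h (0, b))" for h :: "real \<times> 'a \<Rightarrow> real"
    by (subst sum.reindex) (auto simp: inj_on_def)
  have "divg (\<lambda>z. (f z, case_prod g z)) (t, x)
      = (\<Sum>b\<in>Basis. (Df f (t, x) b, Df (case_prod g) (t, x) b) \<bullet> b)"
    by (simp add: divg_def Df_Pair[OF assms])
  also have "\<dots> = Df f (t, x) (1, 0) + (\<Sum>b\<in>Basis. Df (case_prod g) (t, x) (0, b) \<bullet> b)"
    unfolding Basis_prod_def by (subst sum.union_disjoint) (auto simp: 2)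
  also have "\<dots> = Df f (t, x) (1, 0) + divg (g t) x"
    by (simp add: divg_def Df_slice[OF assms(2)])
  finally show ?thesis .
qed

lemma Ck_on_1_Pair:
  assumes "Ck_on 1 G f" "Ck_on 1 G g" shows "Ck_on 1 G (\<lambda>x. (f x, g x))"
  by (rule Ck_on_1I[where f'="\<lambda>x v. (Df f x v, Df g x v)"])
    (auto intro!: has_derivative_Pair continuous_intros Ck_on_1D[OF assms(1)] Ck_on_1D[OF assms(2)])

lemma Ck_on_2_Pair_const:
  assumes "open G" "Ck_on 2 G g" shows "Ck_on 2 G (\<lambda>x. (k::real, g x))"
proof -
  note g1 = Ck_on_2D(1)[OF assms(2)]
  have "Ck_on 1 G (\<lambda>x. Df (\<lambda>x. (k, g x)) x v)" for v
  proof (rule Ck_on_1_cong[OF assms(1)])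
    show "Ck_on 1 G (\<lambda>x. (0, Df g x v))" by (intro Ck_on_1_Pair Ck_on_1_const Ck_on_2D(2)[OF assms(2)])
    show "(0, Df g x v) = Df (\<lambda>x. (k, g x)) x v" if "x \<in> G" for x
      using Df_Pair[OF Ck_on_1D(1)[OF Ck_on_1_const that] Ck_on_1D(1)[OF g1 that], of k v] by simp
  qed
  then show ?thesis
    using Ck_on_1D(1)[OF Ck_on_1_Pair[OF Ck_on_1_const g1]] by (auto simp: numeral_2_eq_2)
qed

text \<open>Only regularity and positivity are fixed here, on a neighbourhood \<open>G\<close> of
  the closed space-time cylinder. The equations hold only in the open cylinder and are therefore
  hypotheses of the single lemmas. The weight \<open>k\<close> of the displacement term becomes
  \<open>1 / \<tau>\<^sub>0\<^sup>2\<close>.\<close>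

locale galbrun_fields =
  fixes G :: "(real \<times> 'a::euclidean_space) set" and u w :: "real \<Rightarrow> 'a \<Rightarrow> 'a"
    and \<rho> c :: "real \<Rightarrow> 'a \<Rightarrow> real" and k :: real
  assumes open_G: "open G"
    and u2: "Ck_on 2 G (case_prod u)" and w2: "Ck_on 2 G (case_prod w)"
    and rho2: "Ck_on 2 G (case_prod \<rho>)" and c1: "Ck_on 1 G (case_prod c)"
    and rho_pos: "(t, x) \<in> G \<Longrightarrow> \<rho> t x > 0" and c_pos: "(t, x) \<in> G \<Longrightarrow> c t x > 0"
begin

definition m where "m t x = divg (\<lambda>y. \<rho> t y *\<^sub>R w t y) x"

abbreviation v where "v \<equiv> dt_Lie u w"

text \<open>Physically, \<open>- m\<close> is the Eulerian perturbation of the density and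
  \<open>- c\<^sup>2 m\<close> that of the pressure. Thus \<open>\<pi>\<close> is, up to sign, the
  pressure perturbation divided by the impedance \<open>\<rho> c\<close>, which has the dimension of
  a velocity like \<open>v\<close>.\<close>

definition \<pi> where "\<pi> t x = c t x / \<rho> t x * m t x"

definition energy where
  "energy t x = \<rho> t x / 2 * ((\<pi> t x)\<^sup>2 + (norm (v t x))\<^sup>2 + k * (norm (w t x))\<^sup>2)"

lemmas u1 = Ck_on_2D(1)[OF u2] and w1 = Ck_on_2D(1)[OF w2] and rho1 = Ck_on_2D(1)[OF rho2]
lemmas u_diff = Ck_on_1D(1)[OF u1] and w_diff = Ck_on_1D(1)[OF w1] and rho_diff = Ck_on_1D(1)[OF rho1]
  and c_diff = Ck_on_1D(1)[OF c1]

lemma rho_ne: "z \<in> G \<Longrightarrow> case_prod \<rho> z \<noteq> 0"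
  using rho_pos by (cases z) force

lemma v_eq: "(t, x) \<in> G \<Longrightarrow>
  v t x = Df (case_prod w) (t, x) (1, u t x) - Df (case_prod u) (t, x) (0, w t x)"
  using material_slice[OF w_diff, of t x u]
  by (simp add: dt_Lie_def Lie_def material_def Df_slice[OF u_diff])

lemma m_eq: "(t, x) \<in> G \<Longrightarrow>
  m t x = \<rho> t x * (\<Sum>b\<in>Basis. Df (case_prod w) (t, x) (0, b) \<bullet> b) + Df (case_prod \<rho>) (t, x) (0, w t x)"
  unfolding m_def
  by (subst divg_scaleR) (auto simp: differentiable_slice[OF rho_diff] differentiable_slice[OF w_diff]
      Df_slice[OF rho_diff] divg_def Df_slice[OF w_diff])

text \<open>Inside \<open>G\<close> the field is a difference of space-time derivatives of
  \<open>w\<close> and \<open>u\<close> along continuously differentiable fields. One of the two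
  orders of regularity of \<open>u\<close> and \<open>w\<close> is spent here.\<close>

lemma v1: "Ck_on 1 G (case_prod v)"
proof (rule Ck_on_1_cong[OF open_G])
  show "Ck_on 1 G (\<lambda>z. Df (case_prod w) z (1, case_prod u z) - Df (case_prod u) z (0, case_prod w z))"
    by (intro Ck_on_1_diff Ck_on_1_Df_field open_G w2 u2 Ck_on_1_Pair Ck_on_1_const u1 w1)
qed (clarsimp simp: v_eq)

lemma m1: "Ck_on 1 G (case_prod m)"
proof (rule Ck_on_1_cong[OF open_G])
  show "Ck_on 1 G (\<lambda>z. case_prod \<rho> z * (\<Sum>b\<in>Basis. Df (case_prod w) z (0, b) \<bullet> b)
      + Df (case_prod \<rho>) z (0, case_prod w z))"
    by (intro Ck_on_1_add Ck_on_1_mult Ck_on_1_sum Ck_on_1_compose_linear[OF bounded_linear_inner_left]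
        Ck_on_2D(2)[OF w2] Ck_on_1_Df_field open_G rho2 Ck_on_1_Pair Ck_on_1_const rho1 w1)
qed (clarsimp simp: m_eq)

lemma pi1: "Ck_on 1 G (case_prod \<pi>)"
proof (rule Ck_on_1_cong[OF open_G])
  show "Ck_on 1 G (\<lambda>z. case_prod c z / case_prod \<rho> z * case_prod m z)"
    by (intro Ck_on_1_mult Ck_on_1_divide c1 rho1 m1 rho_ne)
qed (auto simp: \<pi>_def)

text \<open>The energy per unit mass. Its material derivative contains no derivative of
  \<open>\<rho>\<close> from the prefactor, since mass conservation has been used to remove
  it.\<close>

definition specific_energy where
  "specific_energy t x = ((\<pi> t x)\<^sup>2 + (norm (v t x))\<^sup>2 + k * (norm (w t x))\<^sup>2) / 2"

lemma energy_eq: "energy t x = \<rho> t x * specific_energy t x"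
  by (simp add: energy_def specific_energy_def)

lemma specific_energy_eq: "case_prod specific_energy
  = (\<lambda>z. (case_prod \<pi> z * case_prod \<pi> z + case_prod v z \<bullet> case_prod v z
      + k * (case_prod w z \<bullet> case_prod w z)) * (1/2))"
  by (auto simp: specific_energy_def fun_eq_iff power2_eq_square dot_square_norm)

lemma specific_energy1: "Ck_on 1 G (case_prod specific_energy)"
  unfolding specific_energy_eq
  by (intro Ck_on_1_mult Ck_on_1_add Ck_on_1_inner pi1 v1 w1 Ck_on_1_const)

lemma energy1: "Ck_on 1 G (case_prod energy)"
proof (rule Ck_on_1_cong[OF open_G])
  show "Ck_on 1 G (\<lambda>z. case_prod \<rho> z * case_prod specific_energy z)" by (intro Ck_on_1_mult rho1 specific_energy1)
qed (auto simp: energy_eq)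

lemma Df_specific_energy:
  assumes z: "z \<in> G"
  shows "Df (case_prod specific_energy) z h = case_prod \<pi> z * Df (case_prod \<pi>) z h
    + case_prod v z \<bullet> Df (case_prod v) z h + k * (case_prod w z \<bullet> Df (case_prod w) z h)"
proof -
  have "(case_prod specific_energy has_derivative (\<lambda>h. case_prod \<pi> z * Df (case_prod \<pi>) z h
    + case_prod v z \<bullet> Df (case_prod v) z h + k * (case_prod w z \<bullet> Df (case_prod w) z h))) (at z)"
    unfolding specific_energy_eq
    by (rule has_derivative_eq_rhs, (rule derivative_intros Ck_on_1D(2)[OF pi1 z]
      Ck_on_1D(2)[OF v1 z] Ck_on_1D(2)[OF w1 z])+) (auto simp: fun_eq_iff inner_commute algebra_simps)
  from Df_eqI[OF this] show ?thesis by simp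
qed

text \<open>This is \<open>transported_divergence\<close> for \<open>(1, u)\<close> and
  \<open>(0, w)\<close> in space-time: mass conservation makes \<open>\<rho>\<close> the transported
  density, and the bracket of the two fields is \<open>(0, v)\<close>.\<close>

lemma material_pressure:
  assumes H: "open H" "H \<subseteq> G" "(t, x) \<in> H"
    and cont: "\<And>s y. (s, y) \<in> H \<Longrightarrow> material u \<rho> s y + \<rho> s y * divg (u s) y = 0"
  shows "material u (\<lambda>t x. m t x / \<rho> t x) t x = divg (\<lambda>y. \<rho> t y *\<^sub>R v t y) x / \<rho> t x"
proof -
  let ?U = "case_prod u" and ?W = "case_prod w" and ?r = "case_prod \<rho>"
  let ?X = "\<lambda>z. (1::real, ?U z)" and ?V = "\<lambda>z. (0::real, ?W z)"
  have zG: "(t, x) \<in> G" using H by auto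
  \<comment> \<open>The constant time component \<open>a\<close> is 1 for the pair with
    \<open>u\<close>, and 0 for the pairs with \<open>w\<close> and \<open>v\<close>.\<close>
  have pr: "divg (\<lambda>z. ?r z *\<^sub>R (a, case_prod f z)) (s, y)
      = Df (\<lambda>z. ?r z * a) (s, y) (1, 0) + divg (\<lambda>y. \<rho> s y *\<^sub>R f s y) y"
    if "Ck_on 1 G (case_prod f)" "(s, y) \<in> G" for a :: real and f s y
  proof -
    have d: "(\<lambda>z. ?r z * a) differentiable (at (s, y))" "case_prod (\<lambda>s y. \<rho> s y *\<^sub>R f s y) differentiable (at (s, y))"
      using Ck_on_1D(1)[OF Ck_on_1_mult[OF rho1 Ck_on_1_const] that(2)]
        Ck_on_1D(1)[OF Ck_on_1_scaleR[OF rho1 that(1)] that(2)] by (auto simp: case_prod_beta')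
    show ?thesis using divg_Pair[OF d] by (simp add: case_prod_beta')
  qed
  have br: "lie_bracket ?X ?V z = (0, case_prod v z)" if "z \<in> G" for z
  proof -
    obtain s y where z: "z = (s, y)" by (cases z)
    show ?thesis
      using Df_Pair[OF Ck_on_1D(1)[OF Ck_on_1_const that] u_diff[OF that], of "1::real"]
        Df_Pair[OF Ck_on_1D(1)[OF Ck_on_1_const that] w_diff[OF that], of "0::real"] that
      by (simp add: lie_bracket_def z v_eq)
  qed
  have mr: "Ck_on 1 G (\<lambda>z. case_prod m z / ?r z)"
    by (intro Ck_on_1_divide rho1 m1 rho_ne)
  have "material u (\<lambda>t x. m t x / \<rho> t x) t x = Df (\<lambda>z. case_prod m z / ?r z) (t, x) (?X (t, x))"
    using Ck_on_1D(1)[OF mr zG] by (subst material_slice) (auto simp: case_prod_beta')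
  also have "\<dots> = Df (\<lambda>z. divg (\<lambda>z. ?r z *\<^sub>R ?V z) z / ?r z) (t, x) (?X (t, x))"
  proof (rule fun_cong[OF Df_cong[OF open_G zG]])
    fix z assume "z \<in> G"
    then show "case_prod m z / ?r z = divg (\<lambda>z. ?r z *\<^sub>R ?V z) z / ?r z"
      using pr[OF w1, of "fst z" "snd z" 0] by (simp add: m_def case_prod_beta')
  qed
  also have "\<dots> = divg (\<lambda>z. ?r z *\<^sub>R lie_bracket ?X ?V z) (t, x) / ?r (t, x)"
  proof (rule transported_divergence[OF open_G _ _ rho2 _ _ H])
    show "Ck_on 2 G ?X" "Ck_on 2 G ?V" by (intro Ck_on_2_Pair_const open_G u2 w2)+
    show "?r z \<noteq> 0" if "z \<in> G" for z by (rule rho_ne[OF that])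
    show "divg (\<lambda>z. ?r z *\<^sub>R ?X z) z = 0" if z: "z \<in> H" for z
    proof -
      obtain s y where zz: "z = (s, y)" by (cases z)
      have zG: "(s, y) \<in> G" using zz z H by auto
      have "divg (\<lambda>z. ?r z *\<^sub>R ?X z) z = Df ?r (s, y) (1, 0) + divg (\<lambda>y. \<rho> s y *\<^sub>R u s y) y"
        unfolding zz using pr[OF u1 zG, of 1] by simp
      also have "\<dots> = material u \<rho> s y + \<rho> s y * divg (u s) y"
        by (subst divg_scaleR) (auto simp: differentiable_slice[OF rho_diff] differentiable_slice[OF u_diff] zG
          material_def dt_slice[OF rho_diff])
      finally show ?thesis using cont[of s y] z zz by simp
    qed
  qed
  also have "\<dots> = divg (\<lambda>z. ?r z *\<^sub>R (0, case_prod v z)) (t, x) / ?r (t, x)"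
  proof -
    have "Df (\<lambda>z. ?r z *\<^sub>R lie_bracket ?X ?V z) (t, x) = Df (\<lambda>z. ?r z *\<^sub>R (0, case_prod v z)) (t, x)"
      by (rule Df_cong[OF open_G zG]) (simp add: br)
    then show ?thesis by (simp only: divg_def)
  qed
  also have "\<dots> = divg (\<lambda>y. \<rho> t y *\<^sub>R v t y) x / \<rho> t x"
    using pr[OF v1 zG, of 0] by simp
  finally show ?thesis .
qed

lemma energy_balance:
  assumes H: "open H" "H \<subseteq> G" "(t, x) \<in> H"
    and cont: "\<And>s y. (s, y) \<in> H \<Longrightarrow> material u \<rho> s y + \<rho> s y * divg (u s) y = 0"
    and p: "p t differentiable (at x)" "\<And>b. Df (p t) x b = (c t x)\<^sup>2 * Df (\<rho> t) x b"
    and gal: "\<rho> t x *\<^sub>R material u v t x - grad (\<lambda>y. (c t y)\<^sup>2 * m t y) x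
        + \<rho> t x *\<^sub>R Df (u t) x (v t x) + m t x *\<^sub>R ((1 / \<rho> t x) *\<^sub>R grad (p t) x) = \<rho> t x *\<^sub>R \<phi>"
  shows "dt energy t x + divg (\<lambda>y. energy t y *\<^sub>R u t y - ((c t y)\<^sup>2 * m t y) *\<^sub>R v t y) x
    = \<rho> t x * ((\<pi> t x)\<^sup>2 * (material u c t x / c t x) - v t x \<bullet> Df (u t) x (v t x) + v t x \<bullet> \<phi>
        + k * (w t x \<bullet> (v t x + Df (u t) x (w t x))))"
proof -
  let ?z = "(t, x)" and ?X = "(1::real, u t x)"
  have zG: "?z \<in> G" using H by auto
  have rp: "\<rho> t x > 0" and cp: "c t x > 0" using rho_pos c_pos zG by auto
  note pd = Ck_on_1D(1)[OF pi1 zG] and vd = Ck_on_1D(1)[OF v1 zG] and wd = w_diff[OF zG]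
    and ud = u_diff[OF zG] and rd = rho_diff[OF zG] and cd = c_diff[OF zG]
    and ed = Ck_on_1D(1)[OF energy1 zG] and dd = Ck_on_1D(1)[OF specific_energy1 zG]
  note slices = pd[THEN differentiable_slice] vd[THEN differentiable_slice] wd[THEN differentiable_slice]
    ud[THEN differentiable_slice] rd[THEN differentiable_slice] ed[THEN differentiable_slice]
  have c2m: "Ck_on 1 G (case_prod (\<lambda>t y. (c t y)\<^sup>2 * m t y))"
    using Ck_on_1_mult[OF Ck_on_1_mult[OF c1 c1] m1] by (simp add: case_prod_beta' power2_eq_square)
  note cmd = Ck_on_1D(1)[OF c2m zG, THEN differentiable_slice]
  have div_u: "material u \<rho> t x = - (\<rho> t x * divg (u t) x)" using cont[OF H(3)] by simp
  \<comment> \<open>The continuity equation replaces the material derivative of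
    \<open>\<rho>\<close> by a multiple of \<open>divg u\<close>, which is exactly the term that the
    divergence of \<open>energy u\<close> compensates.\<close>
  have "material u energy t x = Df (\<lambda>z. case_prod \<rho> z * case_prod specific_energy z) ?z ?X"
    by (simp add: material_slice[OF ed] energy_eq case_prod_beta')
  also have "\<dots> = \<rho> t x * Df (case_prod specific_energy) ?z ?X + Df (case_prod \<rho>) ?z ?X * specific_energy t x"
    by (simp add: Df_mult[OF rd dd])
  also have "Df (case_prod \<rho>) ?z ?X = - (\<rho> t x * divg (u t) x)"
    using div_u by (simp add: material_slice[OF rd])
  finally have De: "material u energy t x + energy t x * divg (u t) x = \<rho> t x * Df (case_prod specific_energy) ?z ?X"
    by (simp add: energy_eq[of t x])
  have lhs: "dt energy t x + divg (\<lambda>y. energy t y *\<^sub>R u t y - ((c t y)\<^sup>2 * m t y) *\<^sub>R v t y) x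
    = \<rho> t x * Df (case_prod specific_energy) ?z ?X
      - ((c t x)\<^sup>2 * m t x * divg (v t) x + v t x \<bullet> grad (\<lambda>y. (c t y)\<^sup>2 * m t y) x)"
    by (subst divg_diff) (auto simp: slices cmd differentiable_scaleR divg_scaleR inner_grad De[symmetric] material_def)
  \<comment> \<open>This is the definition of \<open>v\<close> solved for the material derivative of
    \<open>w\<close>; it makes the displacement part of the energy a quadratic expression without
    new derivatives of \<open>w\<close>.\<close>
  have wX: "Df (case_prod w) ?z ?X = v t x + Df (u t) x (w t x)"
    using v_eq[OF zG] by (simp add: Df_slice[OF ud])
  have "case_prod \<pi> = (\<lambda>z. case_prod c z * case_prod (\<lambda>t x. m t x / \<rho> t x) z)"
    by (auto simp: \<pi>_def)
  moreover have q1: "Ck_on 1 G (case_prod (\<lambda>t x. m t x / \<rho> t x))"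
    using Ck_on_1_divide[OF m1 rho1 rho_ne] by (simp only: case_prod_beta')
  ultimately have piX: "Df (case_prod \<pi>) ?z ?X = c t x * (divg (\<lambda>y. \<rho> t y *\<^sub>R v t y) x / \<rho> t x)
      + material u c t x * (m t x / \<rho> t x)"
    using material_pressure[OF H cont] 
    by (simp add: Df_mult[OF cd Ck_on_1D(1)[OF q1 zG]] material_slice[OF cd]
        material_slice[OF Ck_on_1D(1)[OF q1 zG]])
  have dv: "divg (\<lambda>y. \<rho> t y *\<^sub>R v t y) x = \<rho> t x * divg (v t) x + Df (\<rho> t) x (v t x)"
    by (simp add: divg_scaleR slices)
  have "v t x \<bullet> (\<rho> t x *\<^sub>R material u v t x) = v t x \<bullet> (\<rho> t x *\<^sub>R \<phi> + grad (\<lambda>y. (c t y)\<^sup>2 * m t y) x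
        - \<rho> t x *\<^sub>R Df (u t) x (v t x) - m t x *\<^sub>R ((1 / \<rho> t x) *\<^sub>R grad (p t) x))"
    unfolding gal[symmetric] by (simp add: algebra_simps)
  \<comment> \<open>Galbrun's equation tested with \<open>v\<close>, where the pressure gradient has
    been expressed by the density gradient.\<close>
  then have gv: "\<rho> t x * (v t x \<bullet> Df (case_prod v) ?z ?X) = \<rho> t x * (v t x \<bullet> \<phi>)
      + v t x \<bullet> grad (\<lambda>y. (c t y)\<^sup>2 * m t y) x - \<rho> t x * (v t x \<bullet> Df (u t) x (v t x))
      - m t x / \<rho> t x * ((c t x)\<^sup>2 * Df (\<rho> t) x (v t x))"
    by (simp add: material_slice[OF vd] inner_add_right inner_diff_right inner_grad[OF p(1)] p(2))
  \<comment> \<open>The term with the density gradient is the one that \<open>gv\<close> contains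
    with the opposite sign. The term with \<open>divg v\<close> and the gradient of
    \<open>c\<^sup>2 m\<close> in \<open>gv\<close> add up to the divergence of
    \<open>c\<^sup>2 m v\<close>, the acoustic part of the flux.\<close>
  have pp: "\<rho> t x * (\<pi> t x * Df (case_prod \<pi>) ?z ?X)
      = (c t x)\<^sup>2 * m t x * divg (v t) x + m t x / \<rho> t x * ((c t x)\<^sup>2 * Df (\<rho> t) x (v t x))
        + \<rho> t x * ((\<pi> t x)\<^sup>2 * (material u c t x / c t x))"
    unfolding piX dv \<pi>_def using rp cp by (simp add: field_simps power2_eq_square)
  have "\<rho> t x * Df (case_prod specific_energy) ?z ?X = \<rho> t x * (\<pi> t x * Df (case_prod \<pi>) ?z ?X)
      + \<rho> t x * (v t x \<bullet> Df (case_prod v) ?z ?X) + \<rho> t x * (k * (w t x \<bullet> (v t x + Df (u t) x (w t x))))"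
    by (simp add: Df_specific_energy[OF zG] wX distrib_left)
  then show ?thesis unfolding lhs gv pp by (simp add: algebra_simps)
qed

end

section \<open>Flux through a graph\<close>

definition slab :: "'a::euclidean_space \<Rightarrow> 'a set" where
  "slab e = {x. 0 \<le> x \<bullet> e \<and> x \<bullet> e < 1}"

definition graph_pt :: "'a::euclidean_space \<Rightarrow> ('a \<Rightarrow> real) \<Rightarrow> 'a \<Rightarrow> 'a" where
  "graph_pt e h x = x + (h x - x \<bullet> e) *\<^sub>R e"

lemma slab_borel [measurable]: "slab e \<in> sets borel"
  unfolding slab_def by measurable

lemma lborel_nn_integral_translate:
  fixes f :: "'a::euclidean_space \<Rightarrow> ennreal"
  assumes "f \<in> borel_measurable borel"
  shows "(\<integral>\<^sup>+x. f (x + a) \<partial>lborel) = (\<integral>\<^sup>+x. f x \<partial>lborel)"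
proof -
  have "(\<integral>\<^sup>+x. f x \<partial>lborel) = (\<integral>\<^sup>+x. f x \<partial>distr lborel borel ((+) a))"
    by (simp add: lborel_distr_plus)
  also have "\<dots> = (\<integral>\<^sup>+x. f (a + x) \<partial>lborel)" using assms by (subst nn_integral_distr) auto
  finally show ?thesis by (simp add: add.commute)
qed

lemma lborel_integral_translate:
  fixes f :: "'a::euclidean_space \<Rightarrow> real"
  assumes "f \<in> borel_measurable borel"
  shows "(LINT x|lborel. f (x + a)) = (LINT x|lborel. f x)"
proof -
  have "(LINT x|lborel. f x) = (LINT x|distr lborel borel ((+) a). f x)"
    by (simp add: lborel_distr_plus)
  also have "\<dots> = (LINT x|lborel. f (a + x))" using assms by (subst integral_distr) auto
  finally show ?thesis by (simp add: add.commute)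
qed

text \<open>Projecting out \<open>e\<close> does not increase norms and forgets \<open>r\<close>,
  and a point of the slab differs from its projection by at most one. Consequently lines through
  remote slab points miss a given ball.\<close>

lemma norm_slab_le:
  assumes e: "norm e = 1" and y: "y \<in> slab e"
  shows "norm y \<le> norm (y + r *\<^sub>R e) + 1"
proof -
  have ee: "e \<bullet> e = 1" using e by (simp add: dot_square_norm)
  let ?P = "\<lambda>z. z - (z \<bullet> e) *\<^sub>R e"
  have "(norm (?P z))\<^sup>2 \<le> (norm z)\<^sup>2" for z
    by (simp add: power2_norm_eq_inner algebra_simps ee inner_commute)
  then have "norm (?P z) \<le> norm z" for z using power2_le_imp_le norm_ge_zero by blast
  moreover have "?P (y + r *\<^sub>R e) = ?P y" by (simp add: algebra_simps ee)
  ultimately have "norm (?P y) \<le> norm (y + r *\<^sub>R e)" by metis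
  moreover have "norm y \<le> norm (?P y) + norm ((y \<bullet> e) *\<^sub>R e)"
    using norm_triangle_ineq[of "?P y" "(y \<bullet> e) *\<^sub>R e"] by simp
  moreover have "norm ((y \<bullet> e) *\<^sub>R e) \<le> 1" using y e by (auto simp: slab_def)
  ultimately show ?thesis by linarith
qed

lemma integrable_indicator_cball:
  "integrable lborel (\<lambda>x::'a::euclidean_space. (B::real) * indicator (cball a R) x)"
  by (intro integrable_mult_right integrable_real_indicator emeasure_bounded_finite) auto

lemma integrable_bounded_support:
  fixes f :: "'a::euclidean_space \<Rightarrow> real"
  assumes "f \<in> borel_measurable borel" "\<And>x. \<bar>f x\<bar> \<le> B" "\<And>x. x \<notin> cball a R \<Longrightarrow> f x = 0"
  shows "integrable lborel f"
proof (rule Bochner_Integration.integrable_bound[OF integrable_indicator_cball])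
  have "B \<ge> 0" using assms(2)[of 0] by linarith
  then show "AE x in lborel. norm (f x) \<le> norm (B * indicator (cball a R) x)"
    using assms(2,3) by (intro AE_I2) (auto simp: indicator_def)
qed (use assms(1) in simp)

text \<open>The lines in direction \<open>e\<close> through the points of the slab cover the space uniformly,
  because every point sees a set of slab points of length one along its line.\<close>

lemma slab_distr:
  fixes e :: "'a::euclidean_space"
  assumes "norm e = 1"
  shows "distr (density (lborel \<Otimes>\<^sub>M lborel) (\<lambda>z. ennreal (indicator (slab e) (fst z)))) borel
    (\<lambda>z. fst z + snd z *\<^sub>R e) = (lborel :: 'a measure)" (is "distr (density ?P ?i) borel ?T = _")
proof (rule measure_eqI)
  fix A assume "A \<in> sets (distr (density ?P ?i) borel ?T)"
  then have A [measurable]: "A \<in> sets borel" by simp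
  have "emeasure (distr (density ?P ?i) borel ?T) A
      = (\<integral>\<^sup>+z. indicator A z \<partial>distr (density ?P ?i) borel ?T)" by simp
  also have "\<dots> = (\<integral>\<^sup>+z. indicator A (?T z) \<partial>density ?P ?i)" by (subst nn_integral_distr) auto
  also have "\<dots> = (\<integral>\<^sup>+z. ?i z * indicator A (?T z) \<partial>?P)" by (subst nn_integral_density) auto
  also have "\<dots> = (\<integral>\<^sup>+s. \<integral>\<^sup>+y. indicator (slab e) y * indicator A (y + s *\<^sub>R e) \<partial>lborel \<partial>lborel)"
    by (subst lborel_pair.nn_integral_snd[symmetric]) (auto simp: ennreal_indicator)
  also have "\<dots> = (\<integral>\<^sup>+s. \<integral>\<^sup>+y. indicator (slab e) (y - s *\<^sub>R e) * indicator A y \<partial>lborel \<partial>lborel)"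
  proof (rule nn_integral_cong)
    fix s :: real
    show "(\<integral>\<^sup>+y. indicator (slab e) y * indicator A (y + s *\<^sub>R e) \<partial>lborel)
        = (\<integral>\<^sup>+y. indicator (slab e) (y - s *\<^sub>R e) * indicator A y \<partial>lborel)"
      using lborel_nn_integral_translate[of "\<lambda>y. indicator (slab e) (y - s *\<^sub>R e) * indicator A y" "s *\<^sub>R e"]
      by simp
  qed
  also have "\<dots> = (\<integral>\<^sup>+y. \<integral>\<^sup>+s. indicator (slab e) (y - s *\<^sub>R e) * indicator A y \<partial>lborel \<partial>lborel)"
    by (rule lborel_pair.Fubini') simp
  also have "\<dots> = (\<integral>\<^sup>+y. indicator A y \<partial>lborel)"
  proof (rule nn_integral_cong)
    fix y :: 'a
    have "e \<bullet> e = 1" using assms by (simp add: dot_square_norm)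
    \<comment> \<open>For fixed \<open>y\<close> the admissible parameters form an interval of
      length one, half-open because the slab is.\<close>
    then have "indicator (slab e) (y - s *\<^sub>R e) = (indicator {y \<bullet> e - 1 <.. y \<bullet> e} s :: ennreal)" for s
      by (auto simp: slab_def indicator_def inner_diff_left)
    then show "(\<integral>\<^sup>+s. indicator (slab e) (y - s *\<^sub>R e) * indicator A y \<partial>lborel) = indicator A y"
      by (simp add: nn_integral_multc)
  qed
  finally show "emeasure (distr (density ?P ?i) borel ?T) A = emeasure lborel A" by simp
qed simp

text \<open>Fubini's theorem in direction \<open>e\<close>, with the hyperplane orthogonal to
  \<open>e\<close> replaced by the slab.\<close>

lemma slab_integral:
  fixes e :: "'a::euclidean_space" and F :: "'a \<Rightarrow> real"
  assumes "norm e = 1" "integrable lborel F"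
  shows "(LINT x|lborel. F x) = (LINT y|lborel. indicator (slab e) y * (LINT s|lborel. F (y + s *\<^sub>R e)))"
proof -
  have [measurable]: "F \<in> borel_measurable borel" using assms(2) by simp
  let ?P = "lborel \<Otimes>\<^sub>M lborel :: ('a \<times> real) measure" and ?T = "\<lambda>z. fst z + snd z *\<^sub>R e"
  let ?i = "\<lambda>z. indicator (slab e) (fst z) :: real"
  have "integrable (distr (density ?P ?i) borel ?T) F"
    using assms by (simp add: slab_distr)
  then have "integrable (density ?P ?i) (\<lambda>z. F (?T z))"
    by (subst (asm) integrable_distr_eq) auto
  then have int: "integrable ?P (\<lambda>z. ?i z * F (?T z))"
    by (subst (asm) integrable_density) auto
  have "(LINT x|lborel. F x) = (LINT x|distr (density ?P ?i) borel ?T. F x)"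
    using assms by (simp add: slab_distr)
  also have "\<dots> = (LINT z|density ?P ?i. F (?T z))" by (subst integral_distr) auto
  also have "\<dots> = (LINT z|?P. ?i z * F (?T z))" by (subst integral_density) auto
  also have "\<dots> = (LINT y|lborel. LINT s|lborel. indicator (slab e) y * F (y + s *\<^sub>R e))"
    using lborel_pair.integral_fst'[OF int] by simp
  finally show ?thesis by simp
qed

text \<open>The difference of the two indicators is the oriented indicator of the interval from
  \<open>p\<close> to \<open>q\<close>. It expresses integrals from \<open>p\<close> to
  \<open>q\<close> uniformly for either order of the end points.\<close>

lemma integral_below_diff_bound:
  fixes \<psi> :: "real \<Rightarrow> real"
  assumes "\<And>r. min p q \<le> r \<Longrightarrow> r \<le> max p q \<Longrightarrow> \<bar>\<psi> r\<bar> \<le> C"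
  shows "\<bar>LINT r|lborel. (indicator {..<q} r - indicator {..<p} r) * \<psi> r\<bar> \<le> C * \<bar>q - p\<bar>"
proof -
  have C: "C \<ge> 0" using assms[of "min p q"] by force
  have int: "integrable lborel (\<lambda>r. C * indicator {min p q .. max p q} r)"
    by (intro integrable_mult_right integrable_real_indicator) auto
  have "norm (LINT r|lborel. (indicator {..<q} r - indicator {..<p} r) * \<psi> r)
      \<le> (LINT r|lborel. norm ((indicator {..<q} r - indicator {..<p} r) * \<psi> r))"
    by (rule integral_norm_bound)
  also have "\<dots> \<le> (LINT r|lborel. C * indicator {min p q .. max p q} r)"
    by (rule integral_mono'[OF int]) (use assms C in \<open>auto simp: indicator_def\<close>)
  also have "\<dots> = C * \<bar>q - p\<bar>" by (cases "p \<le> q") (simp_all add: measure_def)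
  finally show ?thesis by simp
qed

lemma integral_below_diff: "(LINT r|lborel. indicator {..<q} r - indicator {..<p} r) = q - (p::real)"
proof (cases "p \<le> q")
  case True
  then have "(\<lambda>r. indicator {..<q} r - indicator {..<p} r) = (indicator {p..<q} :: real \<Rightarrow> real)"
    by (auto simp: indicator_def fun_eq_iff)
  then show ?thesis using True by (simp add: measure_def)
next
  case False
  then have "(\<lambda>r. indicator {..<q} r - indicator {..<p} r) = (\<lambda>r. - indicator {q..<p} r :: real)"
    by (auto simp: indicator_def fun_eq_iff)
  then show ?thesis using False by (simp add: measure_def)
qed

lemma integrable_below_diff:
  fixes \<psi> :: "real \<Rightarrow> real"
  assumes "\<psi> \<in> borel_measurable borel" "\<And>r. \<bar>\<psi> r\<bar> \<le> B"
  shows "integrable lborel (\<lambda>r. (indicator {..<q} r - indicator {..<p} r) * \<psi> r)"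
proof (rule Bochner_Integration.integrable_bound)
  show "integrable lborel (\<lambda>r. B * indicator {min p q .. max p q} r)"
    by (intro integrable_mult_right integrable_real_indicator) auto
  show "(\<lambda>r. (indicator {..<q} r - indicator {..<p} r) * \<psi> r) \<in> borel_measurable lborel"
    using assms(1) by measurable
  have "B \<ge> 0" using assms(2)[of 0] by linarith
  then show "AE r in lborel. norm ((indicator {..<q} r - indicator {..<p} r) * \<psi> r)
      \<le> norm (B * indicator {min p q .. max p q} r)"
    using assms(2) by (intro AE_I2) (auto simp: indicator_def intro: order_trans)
qed

text \<open>The fundamental theorem of calculus at one point: the deviation of \<open>\<psi>\<close>
  from \<open>\<psi> p\<close> is small near \<open>p\<close>, and the oriented interval has length
  \<open>|q - p|\<close>.\<close>

lemma DERIV_integral_below: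
  fixes \<psi> :: "real \<Rightarrow> real"
  assumes "\<psi> \<in> borel_measurable borel" "\<And>r. \<bar>\<psi> r\<bar> \<le> B" "isCont \<psi> p"
  shows "((\<lambda>q. LINT r|lborel. (indicator {..<q} r - indicator {..<p} r) * \<psi> r)
    has_real_derivative \<psi> p) (at p)" (is "(?J has_real_derivative _) _")
proof -
  have eq: "?J q - \<psi> p * (q - p) = (LINT r|lborel. (indicator {..<q} r - indicator {..<p} r) * (\<psi> r - \<psi> p))" for q
  proof -
    have i: "integrable lborel (\<lambda>r. (indicator {..<q} r - indicator {..<p} r) * \<psi> p)"
      by (rule integrable_below_diff[where B="\<bar>\<psi> p\<bar>"]) auto
    have "(LINT r|lborel. (indicator {..<q} r - indicator {..<p} r) * (\<psi> r - \<psi> p))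
      = ?J q - (LINT r|lborel. (indicator {..<q} r - indicator {..<p} r) * \<psi> p)"
      unfolding right_diff_distrib using integrable_below_diff[OF assms(1,2), of q p] i
      by (rule Bochner_Integration.integral_diff)
    then show ?thesis using integral_below_diff[of q p] by simp
  qed
  have "\<exists>d>0. \<forall>q. q \<noteq> p \<and> \<bar>q - p\<bar> < d \<longrightarrow> \<bar>(?J q - ?J p) / (q - p) - \<psi> p\<bar> < \<epsilon>" if "\<epsilon> > 0" for \<epsilon>
  proof -
    obtain d where d: "d > 0" "\<And>r. \<bar>r - p\<bar> < d \<Longrightarrow> \<bar>\<psi> r - \<psi> p\<bar> < \<epsilon> / 2"
      using assms(3) half_gt_zero[OF \<open>\<epsilon> > 0\<close>] unfolding continuous_at_eps_delta dist_real_def by blast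
    have "\<bar>(?J q - ?J p) / (q - p) - \<psi> p\<bar> < \<epsilon>" if q: "q \<noteq> p" "\<bar>q - p\<bar> < d" for q
    proof -
      have "\<bar>?J q - \<psi> p * (q - p)\<bar> \<le> \<epsilon> / 2 * \<bar>q - p\<bar>"
        unfolding eq by (rule integral_below_diff_bound) (use d(2) q in \<open>force intro: less_imp_le\<close>)
      moreover have "(?J q - ?J p) / (q - p) - \<psi> p = (?J q - \<psi> p * (q - p)) / (q - p)"
        using q by (simp add: field_simps)
      ultimately have "\<bar>(?J q - ?J p) / (q - p) - \<psi> p\<bar> \<le> \<epsilon> / 2"
        using q by (simp add: abs_divide pos_divide_le_eq)
      then show ?thesis using \<open>\<epsilon> > 0\<close> by linarith
    qed
    then show ?thesis using d(1) by blast
  qed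
  then have "((\<lambda>q. (?J q - ?J p) / (q - p)) \<longlongrightarrow> \<psi> p) (at p)"
    unfolding LIM_eq real_norm_def by blast
  then show ?thesis by (simp add: has_field_derivative_iff)
qed

lemma bounded_support:
  fixes f :: "'a::euclidean_space \<Rightarrow> real"
  assumes "continuous_on UNIV f" "\<And>x. norm x > R \<Longrightarrow> f x = 0"
  shows "\<exists>B\<ge>0. \<forall>x. \<bar>f x\<bar> \<le> B"
proof -
  have "compact (f ` cball 0 R)"
    by (intro compact_continuous_image continuous_on_subset[OF assms(1)]) auto
  from compact_imp_bounded[OF this] obtain B where B: "\<And>y. y \<in> f ` cball 0 R \<Longrightarrow> norm y \<le> B"
    unfolding bounded_iff by blast
  have "\<bar>f x\<bar> \<le> max B 0" for x
    using B[of "f x"] assms(2)[of x] by (cases "norm x > R") auto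
  then show ?thesis by (intro exI[of _ "max B 0"]) auto
qed

lemma Df_zero_outside:
  fixes f :: "'a::euclidean_space \<Rightarrow> real"
  assumes "\<And>x. norm x > R \<Longrightarrow> f x = 0" "norm x > R"
  shows "Df f x b = 0"
proof -
  have "Df f x = Df (\<lambda>x. 0) x"
    by (rule Df_cong[of "{x. norm x > R}"]) (use assms in \<open>auto intro!: open_Collect_less continuous_intros\<close>)
  then show ?thesis by simp
qed

lemma difference_le_Df_bound:
  fixes f :: "'a::euclidean_space \<Rightarrow> real"
  assumes "Ck_on 1 UNIV f" "\<And>x. \<bar>Df f x b\<bar> \<le> M" "s \<ge> 0"
  shows "\<bar>f (x + s *\<^sub>R b) - f x\<bar> \<le> M * s"
proof (cases "s = 0")
  case False
  have "\<exists>r>0. r < s \<and> f (x + s *\<^sub>R b) - f (x + 0 *\<^sub>R b) = (s - 0) * Df f (x + r *\<^sub>R b) b"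
  proof (rule MVT2[where f="\<lambda>r. f (x + r *\<^sub>R b)"])
    fix r :: real
    show "DERIV (\<lambda>r. f (x + r *\<^sub>R b)) r :> Df f (x + r *\<^sub>R b) b"
      by (rule DERIV_along_line[OF Ck_on_1D(1)[OF assms(1)]]) simp
  qed (use False assms in auto)
  then obtain r where "f (x + s *\<^sub>R b) - f x = s * Df f (x + r *\<^sub>R b) b" by auto
  then show ?thesis using assms(2)[of "x + r *\<^sub>R b"] assms(3)
    by (simp add: abs_mult mult.commute[of M] mult_left_mono)
qed (use assms(2)[of x] in auto)

text \<open>Dominated convergence and measurability of limits are used for sequences, so all
  difference quotients are taken with the steps \<open>1 / (n + 1)\<close>.\<close>

lemma inverse_Suc_LIMSEQ_at: "filterlim (\<lambda>n. inverse (real (Suc n))) (at 0) sequentially"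
  unfolding filterlim_at using LIMSEQ_inverse_real_of_nat by auto

lemma difference_quotient_LIMSEQ:
  fixes f :: "'a::real_normed_vector \<Rightarrow> real"
  assumes "(f has_derivative f') (at x)"
  shows "(\<lambda>n. (f (x + inverse (real (Suc n)) *\<^sub>R b) - f x) / inverse (real (Suc n))) \<longlonglongrightarrow> f' b"
proof -
  have "((\<lambda>r. f (x + r *\<^sub>R b)) has_real_derivative f' b) (at 0)"
    using DERIV_along_line[of f x 0 b] assms Df_eqI[OF assms] by (auto simp: differentiable_def)
  then have "((\<lambda>s. (f (x + s *\<^sub>R b) - f x) / s) \<longlongrightarrow> f' b) (at 0)"
    by (simp add: has_field_derivative_iff)
  from filterlim_compose[OF this inverse_Suc_LIMSEQ_at] show ?thesis .
qed

text \<open>The first of the two evaluations of the translation derivative, with the derivative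
  falling on \<open>f\<close>. The quotients are bounded by a bound of the directional derivative,
  and since the steps are at most 1 they vanish outside the ball of radius
  \<open>R + norm b\<close>.\<close>

lemma integral_difference_quotient_LIMSEQ:
  fixes f :: "'a::euclidean_space \<Rightarrow> real"
  assumes f: "Ck_on 1 UNIV f" "\<And>x. norm x > R \<Longrightarrow> f x = 0" and A: "A \<in> sets borel"
  shows "(\<lambda>n. LINT x|lborel. indicator A x * ((f (x + inverse (real (Suc n)) *\<^sub>R b) - f x) / inverse (real (Suc n))))
    \<longlonglongrightarrow> (LINT x|lborel. indicator A x * Df f x b)"
proof -
  have cD: "continuous_on UNIV (\<lambda>x. Df f x b)" and cf: "continuous_on UNIV f"
    using Ck_on_1D(3,4)[OF f(1)] by auto
  obtain M where M: "M \<ge> 0" "\<And>x. \<bar>Df f x b\<bar> \<le> M"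
    using bounded_support[OF cD, of R] Df_zero_outside[of R f _ b] f(2) by blast
  have [measurable]: "A \<in> sets borel" "f \<in> borel_measurable borel" "(\<lambda>x. Df f x b) \<in> borel_measurable borel"
    using A cf cD by (auto intro: borel_measurable_continuous_onI)
  show ?thesis
  proof (rule integral_dominated_convergence[where w="\<lambda>x. M * indicator (cball 0 (R + norm b)) x"])
    show "integrable lborel (\<lambda>x. M * indicator (cball 0 (R + norm b)) x :: real)"
      by (rule integrable_indicator_cball)
    show "AE x in lborel. (\<lambda>n. indicator A x * ((f (x + inverse (real (Suc n)) *\<^sub>R b) - f x) / inverse (real (Suc n))))
        \<longlonglongrightarrow> indicator A x * Df f x b"
      by (intro AE_I2 tendsto_mult tendsto_const difference_quotient_LIMSEQ Ck_on_1D(2)[OF f(1)] UNIV_I)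
    show "AE x in lborel. norm (indicator A x * ((f (x + inverse (real (Suc n)) *\<^sub>R b) - f x) / inverse (real (Suc n))))
      \<le> M * indicator (cball 0 (R + norm b)) x" for n
    proof (rule AE_I2)
      fix x :: 'a
      let ?s = "inverse (real (Suc n))"
      have s: "0 < ?s" "?s \<le> 1" by (auto simp: field_simps)
      show "norm (indicator A x * ((f (x + ?s *\<^sub>R b) - f x) / ?s)) \<le> M * indicator (cball 0 (R + norm b)) x"
      proof (cases "x \<in> cball 0 (R + norm b)")
        case True
        have "\<bar>f (x + ?s *\<^sub>R b) - f x\<bar> \<le> M * ?s"
          by (rule difference_le_Df_bound[OF f(1) M(2)]) simp
        then have "\<bar>(f (x + ?s *\<^sub>R b) - f x) / ?s\<bar> \<le> M"
          using s by (simp add: abs_divide pos_divide_le_eq del: inverse_eq_divide)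
        then show ?thesis using True M(1) by (auto simp: indicator_def abs_mult simp del: of_nat_Suc)
      next
        case False
        then have n1: "norm x > R + norm b" by auto
        have "norm x \<le> norm (x + ?s *\<^sub>R b) + norm (?s *\<^sub>R b)"
          using norm_triangle_ineq4[of "x + ?s *\<^sub>R b" "?s *\<^sub>R b"] by simp
        also have "norm (?s *\<^sub>R b) \<le> norm b"
          using s mult_right_mono[of ?s 1 "norm b"] by (simp del: of_nat_Suc)
        finally have "norm (x + ?s *\<^sub>R b) > R" using n1 by linarith
        moreover have "norm x > R" using n1 norm_ge_zero[of b] by linarith
        ultimately show ?thesis using False by (simp add: f(2) del: of_nat_Suc)
      qed
    qed
  qed measurable
qed

text \<open>Translating the region \<open>x \<bullet> e < h x\<close> moves its boundary on the line through \<open>y\<close> by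
  \<open>h (y - s b) - h y + s (b \<bullet> e)\<close>. Differentiating the integral of \<open>f\<close> over the translated region
  in two ways gives the flux through the graph, without any change of variables.\<close>

lemma graph_flux:
  fixes f :: "'a::euclidean_space \<Rightarrow> real"
  assumes e: "norm e = 1" and lip: "L-lipschitz_on UNIV h" and inv: "\<And>x s. h (x + s *\<^sub>R e) = h x"
    and f: "Ck_on 1 UNIV f" "\<And>x. norm x > R \<Longrightarrow> f x = 0"
    and \<gamma>: "\<gamma> \<in> borel_measurable borel"
    and diff: "AE y in lborel. y \<in> slab e \<longrightarrow> f (graph_pt e h y) \<noteq> 0 \<longrightarrow> (h has_derivative (\<lambda>v. v \<bullet> \<gamma> y)) (at y)"
  shows "(LINT x|lborel. indicator {x. x \<bullet> e < h x} x * Df f x b)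
    = (LINT y|lborel. indicator (slab e) y * (f (graph_pt e h y) * (b \<bullet> (e - \<gamma> y))))"
proof -
  let ?H = "{x. x \<bullet> e < h x}" and ?s = "\<lambda>n. inverse (real (Suc n))"
  have ee: "e \<bullet> e = 1" using e by (simp add: dot_square_norm)
  have L0: "L \<ge> 0" using lip lipschitz_on_nonneg by blast
  have ch: "continuous_on UNIV h" by (rule lipschitz_on_continuous_on[OF lip])
  have cf: "continuous_on UNIV f" using Ck_on_1D(4)[OF f(1)] .
  obtain B where B: "B \<ge> 0" "\<And>x. \<bar>f x\<bar> \<le> B" using bounded_support[OF cf f(2)] by blast
  have [measurable]: "f \<in> borel_measurable borel" "h \<in> borel_measurable borel"
    using cf ch by (auto intro: borel_measurable_continuous_onI)
  have Hm [measurable]: "?H \<in> sets borel" by measurable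
  have gm [measurable]: "graph_pt e h \<in> borel_measurable borel"
    unfolding graph_pt_def[abs_def] by measurable
  note \<gamma> [measurable]
  \<comment> \<open>The line \<open>y + r e\<close> lies in the region translated by
    \<open>s b\<close> exactly for \<open>r < \<beta> y s\<close>. At \<open>s = 0\<close> the end
    point of this ray is \<open>graph_pt e h y\<close>.\<close>
  define \<beta> where "\<beta> y s = h (y - s *\<^sub>R b) + s * (b \<bullet> e) - y \<bullet> e" for y s
  define I where "I n y = (LINT r|lborel. (indicator {..<\<beta> y (?s n)} r - indicator {..<\<beta> y 0} r) * f (y + r *\<^sub>R e)) / ?s n" for n y
  have spos: "?s n > 0" for n by simp
  have line: "indicator ?H (y + r *\<^sub>R e - s *\<^sub>R b) = (indicator {..<\<beta> y s} r :: real)" for y r s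
  proof -
    have "h (y + r *\<^sub>R e - s *\<^sub>R b) = h (y - s *\<^sub>R b)" using inv[of "y - s *\<^sub>R b" r] by (simp add: algebra_simps)
    then show ?thesis by (auto simp: indicator_def \<beta>_def algebra_simps ee)
  qed
  have intf: "integrable lborel (\<lambda>x. indicator A (x - a) * f x)" if "A \<in> sets borel" for A :: "'a set" and a
  proof (rule integrable_bounded_support)
    show "\<bar>indicator A (x - a) * f x\<bar> \<le> B" for x using B by (simp add: indicator_def)
    show "indicator A (x - a) * f x = 0" if "x \<notin> cball 0 R" for x using f(2)[of x] that by simp
  qed (use that in measurable)
  \<comment> \<open>Translation invariance of the Lebesgue integral shifts the region instead of
    \<open>f\<close>; the difference of the two regions is then integrated line by line.\<close>
  have step: "(LINT x|lborel. indicator ?H x * ((f (x + ?s n *\<^sub>R b) - f x) / ?s n))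
    = (LINT y|lborel. indicator (slab e) y * I n y)" for n
  proof -
    define s where "s = ?s n"
    have i0: "integrable lborel (\<lambda>x. indicator ?H x * f x)" using intf[OF Hm, of 0] by simp
    have i1: "integrable lborel (\<lambda>x. indicator ?H (x - s *\<^sub>R b) * f x)" by (rule intf[OF Hm])
    have tr: "integrable lborel (\<lambda>x. indicator ?H x * f (x + s *\<^sub>R b))"
    proof (rule integrable_bounded_support)
      show "\<bar>indicator ?H x * f (x + s *\<^sub>R b)\<bar> \<le> B" for x using B by (simp add: indicator_def)
      show "indicator ?H x * f (x + s *\<^sub>R b) = 0" if "x \<notin> cball (- s *\<^sub>R b) R" for x
        using f(2)[of "x + s *\<^sub>R b"] that by (simp add: dist_norm norm_minus_commute add.commute)
    qed measurable
    have "(LINT x|lborel. indicator ?H x * ((f (x + s *\<^sub>R b) - f x) / s))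
      = (LINT x|lborel. (indicator ?H x * f (x + s *\<^sub>R b) - indicator ?H x * f x) / s)"
      by (simp add: right_diff_distrib)
    also have "\<dots> = ((LINT x|lborel. indicator ?H x * f (x + s *\<^sub>R b)) - (LINT x|lborel. indicator ?H x * f x)) / s"
      using Bochner_Integration.integral_diff[OF tr i0] by simp
    also have "(LINT x|lborel. indicator ?H x * f (x + s *\<^sub>R b))
      = (LINT x|lborel. indicator ?H (x - s *\<^sub>R b) * f x)"
      using lborel_integral_translate[of "\<lambda>x. indicator ?H (x - s *\<^sub>R b) * f x" "s *\<^sub>R b"] by simp
    also have "\<dots> - (LINT x|lborel. indicator ?H x * f x)
      = (LINT x|lborel. (indicator ?H (x - s *\<^sub>R b) - indicator ?H x) * f x)"
      using Bochner_Integration.integral_diff[OF i1 i0] by (simp add: left_diff_distrib)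
    also have "\<dots> = (LINT y|lborel. indicator (slab e) y *
        (LINT r|lborel. (indicator ?H (y + r *\<^sub>R e - s *\<^sub>R b) - indicator ?H (y + r *\<^sub>R e)) * f (y + r *\<^sub>R e)))"
      by (rule slab_integral[OF e]) (use Bochner_Integration.integrable_diff[OF i1 i0] in \<open>simp add: left_diff_distrib\<close>)
    also have "\<dots> / s = (LINT y|lborel. indicator (slab e) y * I n y)"
      using line[where s=0] by (simp add: I_def line s_def)
    finally show ?thesis by (simp add: s_def)
  qed
  have \<beta>lip: "\<bar>\<beta> y (?s n) - \<beta> y 0\<bar> \<le> (L + 1) * norm b * ?s n" for y n
  proof -
    have "\<bar>h (y - ?s n *\<^sub>R b) - h y\<bar> \<le> L * (?s n * norm b)"
      using lipschitz_onD[OF lip, of "y - ?s n *\<^sub>R b" y] by (simp add: dist_norm)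
    moreover have "\<bar>?s n * (b \<bullet> e)\<bar> \<le> ?s n * norm b"
      using Cauchy_Schwarz_ineq2[of b e] e by (simp add: abs_mult mult_left_mono)
    ultimately show ?thesis by (simp add: \<beta>_def algebra_simps)
  qed
  have \<beta>tends: "(\<lambda>n. \<beta> y (?s n)) \<longlonglongrightarrow> \<beta> y 0" for y
  proof (rule LIM_zero_cancel, rule Lim_null_comparison[OF always_eventually])
    show "\<forall>n. norm (\<beta> y (?s n) - \<beta> y 0) \<le> (L + 1) * norm b * ?s n" using \<beta>lip by simp
    show "(\<lambda>n. (L + 1) * norm b * ?s n) \<longlonglongrightarrow> 0"
      using tendsto_mult_left[OF LIMSEQ_inverse_real_of_nat, of "(L + 1) * norm b"] by simp
  qed
  have fb: "f (y + \<beta> y 0 *\<^sub>R e) = f (graph_pt e h y)" for y by (simp add: \<beta>_def graph_pt_def)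
  let ?J = "\<lambda>y q. LINT r|lborel. (indicator {..<q} r - indicator {..<\<beta> y 0} r) * f (y + r *\<^sub>R e)"
  have DJ: "(?J y has_real_derivative f (graph_pt e h y)) (at (\<beta> y 0))" for y
    unfolding fb[symmetric]
  proof (rule DERIV_integral_below)
    have "continuous_on UNIV (\<lambda>r. f (y + r *\<^sub>R e))"
      by (intro continuous_on_compose2[OF cf] continuous_intros) auto
    then show "(\<lambda>r. f (y + r *\<^sub>R e)) \<in> borel_measurable borel" "isCont (\<lambda>r. f (y + r *\<^sub>R e)) (\<beta> y 0)"
      by (auto intro: borel_measurable_continuous_onI simp: continuous_on_eq_continuous_at)
  qed (rule B)
  \<comment> \<open>Where \<open>f\<close> does not vanish on the graph, this is the chain rule for
    the integral up to a moving end point. Where it vanishes, \<open>h\<close> need not have a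
    derivative, and the limit must be shown to be zero directly.\<close>
  have lim: "(\<lambda>n. I n y) \<longlonglongrightarrow> f (graph_pt e h y) * (b \<bullet> (e - \<gamma> y))"
    if hd: "f (graph_pt e h y) \<noteq> 0 \<longrightarrow> (h has_derivative (\<lambda>v. v \<bullet> \<gamma> y)) (at y)" for y
  proof -
    have I_eq: "I n y = ?J y (\<beta> y (?s n)) / ?s n" for n by (simp add: I_def)
    show ?thesis
    proof (cases "f (graph_pt e h y) = 0")
      case False
      with hd have hd: "(h has_derivative (\<lambda>v. v \<bullet> \<gamma> y)) (at y)" by simp
      have d1: "((\<lambda>s. h (y - s *\<^sub>R b)) has_derivative (\<lambda>s. (- (s *\<^sub>R b)) \<bullet> \<gamma> y)) (at 0)"
        by (rule has_derivative_compose[where f="\<lambda>s. y - s *\<^sub>R b" and g=h])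
          (use hd in \<open>auto intro!: derivative_eq_intros\<close>)
      have d2: "(\<beta> y has_real_derivative b \<bullet> (e - \<gamma> y)) (at 0)"
        unfolding has_field_derivative_def \<beta>_def
        by (rule has_derivative_eq_rhs, (rule derivative_intros d1)+)
          (auto simp: fun_eq_iff algebra_simps)
      have "((\<lambda>s. ?J y (\<beta> y s)) has_real_derivative f (graph_pt e h y) * (b \<bullet> (e - \<gamma> y))) (at 0)"
        using DERIV_chain2[OF DJ d2] .
      then have "((\<lambda>s. (?J y (\<beta> y s) - ?J y (\<beta> y 0)) / (s - 0)) \<longlongrightarrow> f (graph_pt e h y) * (b \<bullet> (e - \<gamma> y))) (at 0)"
        by (simp only: has_field_derivative_iff)
      from filterlim_compose[OF this inverse_Suc_LIMSEQ_at] show ?thesis unfolding I_eq by simp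
    next
      case True
      \<comment> \<open>The end point moves by at most \<open>(L + 1) norm b\<close> times the step,
        while \<open>f\<close> is smaller than \<open>\<epsilon> / K\<close> near it. The summand 1
        in \<open>K\<close> keeps the divisor positive and the comparison strict.\<close>
      have "(\<lambda>n. I n y) \<longlonglongrightarrow> 0"
      proof (rule LIMSEQ_I)
        fix \<epsilon> :: real assume \<epsilon>: "\<epsilon> > 0"
        define K where "K = (L + 1) * norm b + 1"
        have K: "K > 0" "(L + 1) * norm b < K" using L0 by (auto simp: K_def add_nonneg_pos)
        have "continuous_on UNIV (\<lambda>r. f (y + r *\<^sub>R e))"
          by (intro continuous_on_compose2[OF cf] continuous_intros) auto
        then have "isCont (\<lambda>r. f (y + r *\<^sub>R e)) (\<beta> y 0)"
          by (simp add: continuous_on_eq_continuous_at)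
        then obtain d where d: "d > 0" "\<And>r. \<bar>r - \<beta> y 0\<bar> < d \<Longrightarrow> \<bar>f (y + r *\<^sub>R e)\<bar> < \<epsilon> / K"
          unfolding continuous_at_eps_delta dist_real_def using divide_pos_pos[OF \<epsilon> K(1)] fb[of y] True by force
        obtain N where N: "\<And>n. n \<ge> N \<Longrightarrow> \<bar>\<beta> y (?s n) - \<beta> y 0\<bar> < d"
          using LIMSEQ_D[OF \<beta>tends d(1)] unfolding real_norm_def by blast
        show "\<exists>N. \<forall>n\<ge>N. norm (I n y - 0) < \<epsilon>"
        proof (intro exI[of _ N] allI impI)
          fix n assume "n \<ge> N"
          have "\<bar>?J y (\<beta> y (?s n))\<bar> \<le> \<epsilon> / K * \<bar>\<beta> y (?s n) - \<beta> y 0\<bar>"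
            by (rule integral_below_diff_bound) (use d(2) N[OF \<open>n \<ge> N\<close>] in \<open>force intro: less_imp_le\<close>)
          also have "\<dots> \<le> \<epsilon> / K * ((L + 1) * norm b * ?s n)"
            using \<beta>lip \<epsilon> K(1) by (intro mult_left_mono) auto
          also have "\<dots> < \<epsilon> / K * (K * ?s n)"
            using \<epsilon> K spos by (intro mult_strict_left_mono mult_strict_right_mono) auto
          finally have "\<bar>?J y (\<beta> y (?s n))\<bar> < \<epsilon> * ?s n" using K by simp
          then show "norm (I n y - 0) < \<epsilon>"
            unfolding I_eq using spos[of n] by (simp add: abs_divide pos_divide_less_eq del: of_nat_Suc inverse_eq_divide)
        qed
      qed
      then show ?thesis using True by simp
    qed
  qed
  \<comment> \<open>The domination needed for the limit: a slab point of norm above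
    \<open>R + 1\<close> lies on a line that misses the support of \<open>f\<close>, and elsewhere
    the Lipschitz bound of the end point applies.\<close>
  have Ib: "\<bar>indicator (slab e) y * I n y\<bar> \<le> B * ((L + 1) * norm b) * indicator (cball 0 (R + 1)) y" for n y
  proof (cases "y \<in> slab e \<and> norm y > R + 1")
    case True
    have "f (y + r *\<^sub>R e) = 0" for r
    proof (rule f(2))
      have "norm y \<le> norm (y + r *\<^sub>R e) + 1" by (rule norm_slab_le[OF e]) (use True in simp)
      then show "norm (y + r *\<^sub>R e) > R" using True by linarith
    qed
    then show ?thesis using B(1) L0 True by (simp add: I_def)
  next
    case False
    have "\<bar>?J y (\<beta> y (?s n))\<bar> \<le> B * \<bar>\<beta> y (?s n) - \<beta> y 0\<bar>"
      by (rule integral_below_diff_bound) (rule B)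
    also have "\<dots> \<le> B * ((L + 1) * norm b * ?s n)" using \<beta>lip B(1) by (intro mult_left_mono) auto
    finally have "\<bar>I n y\<bar> \<le> B * ((L + 1) * norm b)"
      unfolding I_def using spos[of n]
      by (simp add: abs_divide pos_divide_le_eq algebra_simps del: of_nat_Suc inverse_eq_divide)
    then show ?thesis using False B(1) L0 by (auto simp: indicator_def not_less)
  qed
  have Im [measurable]: "I n \<in> borel_measurable lborel" for n
    unfolding I_def[abs_def] \<beta>_def indicator_def lessThan_iff by measurable
  have "(\<lambda>n. LINT y|lborel. indicator (slab e) y * I n y)
    \<longlonglongrightarrow> (LINT y|lborel. indicator (slab e) y * (f (graph_pt e h y) * (b \<bullet> (e - \<gamma> y))))"
  proof (rule integral_dominated_convergence[where w="\<lambda>y. B * ((L + 1) * norm b) * indicator (cball 0 (R + 1)) y"])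
    show "integrable lborel (\<lambda>y::'a. B * ((L + 1) * norm b) * indicator (cball 0 (R + 1)) y)"
      by (rule integrable_indicator_cball)
    show "AE y in lborel. (\<lambda>n. indicator (slab e) y * I n y)
        \<longlonglongrightarrow> indicator (slab e) y * (f (graph_pt e h y) * (b \<bullet> (e - \<gamma> y)))"
      using diff
    proof eventually_elim
      case (elim y)
      then show ?case
        using lim[of y] by (cases "y \<in> slab e") (auto intro!: tendsto_mult)
    qed
    show "AE y in lborel. norm (indicator (slab e) y * I n y)
        \<le> B * ((L + 1) * norm b) * indicator (cball 0 (R + 1)) y" for n
      using Ib by simp
  qed measurable
  then have "(\<lambda>n. LINT x|lborel. indicator ?H x * ((f (x + ?s n *\<^sub>R b) - f x) / ?s n))
    \<longlonglongrightarrow> (LINT y|lborel. indicator (slab e) y * (f (graph_pt e h y) * (b \<bullet> (e - \<gamma> y))))"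
    by (simp only: step)
  from LIMSEQ_unique[OF integral_difference_quotient_LIMSEQ[OF f Hm] this] show ?thesis .
qed

text \<open>Translation invariance makes the integral of every difference quotient zero, and the
  same limit as for the graph applies with the whole space as region.\<close>

lemma integral_Df_eq_0:
  fixes f :: "'a::euclidean_space \<Rightarrow> real"
  assumes f: "Ck_on 1 UNIV f" "\<And>x. norm x > R \<Longrightarrow> f x = 0"
  shows "(LINT x|lborel. Df f x b) = 0"
proof -
  have [measurable]: "f \<in> borel_measurable borel"
    by (intro borel_measurable_continuous_onI Ck_on_1D(4)[OF f(1)])
  obtain B where B: "B \<ge> 0" "\<And>x. \<bar>f x\<bar> \<le> B"
    using bounded_support[OF Ck_on_1D(4)[OF f(1)] f(2)] by blast
  have i: "integrable lborel (\<lambda>x. f (x + a))" for a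
  proof (rule integrable_bounded_support)
    show "f (x + a) = 0" if "x \<notin> cball (- a) R" for x
      using f(2)[of "x + a"] that by (simp add: dist_norm norm_minus_commute add.commute)
  qed (measurable, rule B)
  have zero: "(LINT x|lborel. indicator UNIV x * ((f (x + s *\<^sub>R b) - f x) / s)) = 0" for s
    using Bochner_Integration.integral_diff[OF i[of "s *\<^sub>R b"] i[of 0]]
      lborel_integral_translate[of f "s *\<^sub>R b"] by simp
  then have "(\<lambda>n. 0) \<longlonglongrightarrow> (LINT x|lborel. indicator UNIV x * Df f x b)"
    using integral_difference_quotient_LIMSEQ[OF f, where A=UNIV and b=b] unfolding zero by simp
  from LIMSEQ_unique[OF this tendsto_const] show ?thesis by simp
qed

section \<open>Lipschitz boundaries and the surface measure\<close>

lemma local_graphD: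
  assumes "local_graph \<Omega> e h U"
  shows "norm e = 1" "\<exists>L\<ge>0. L-lipschitz_on UNIV h" "h (x + s *\<^sub>R e) = h x" "open U"
    "y \<in> U \<Longrightarrow> y \<in> \<Omega> \<longleftrightarrow> y \<bullet> e < h y" "e \<bullet> e = 1" "continuous_on UNIV h"
proof -
  show 1: "norm e = 1" and 2: "h (x + s *\<^sub>R e) = h x" "open U" "y \<in> U \<Longrightarrow> y \<in> \<Omega> \<longleftrightarrow> y \<bullet> e < h y"
    using assms unfolding local_graph_def by auto
  obtain L where "L-lipschitz_on UNIV h" using assms unfolding local_graph_def by auto
  then show "\<exists>L\<ge>0. L-lipschitz_on UNIV h" "continuous_on UNIV h"
    using lipschitz_on_nonneg lipschitz_on_continuous_on by blast+
  show "e \<bullet> e = 1" using 1 by (simp add: dot_square_norm)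
qed

text \<open>Points of \<open>U\<close> strictly above the graph have a neighbourhood disjoint from
  \<open>\<Omega>\<close>, while points on the graph are approached from below along
  \<open>- e\<close>.\<close>

lemma frontier_iff_graph:
  assumes "open \<Omega>" "local_graph \<Omega> e h U" "x \<in> U"
  shows "x \<in> frontier \<Omega> \<longleftrightarrow> x \<bullet> e = h x"
proof
  note c = local_graphD[OF assms(2)]
  assume x: "x \<in> frontier \<Omega>"
  then have "x \<notin> \<Omega>" using assms(1) by (simp add: frontier_def interior_open)
  then have "\<not> x \<bullet> e < h x" using c(5)[OF assms(3)] by simp
  moreover have "\<not> x \<bullet> e > h x"
  proof
    assume "x \<bullet> e > h x"
    moreover have "open (U \<inter> {y. h y < y \<bullet> e})"
      using c(4,7) by (intro open_Int open_Collect_less continuous_intros)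
    moreover have "(U \<inter> {y. h y < y \<bullet> e}) \<inter> \<Omega> = {}" using c(5) by auto
    ultimately have "x \<notin> closure \<Omega>"
      using assms(3) open_Int_closure_eq_empty[of "U \<inter> {y. h y < y \<bullet> e}" \<Omega>] by blast
    then show False using x by (simp add: frontier_def)
  qed
  ultimately show "x \<bullet> e = h x" by simp
next
  note c = local_graphD[OF assms(2)]
  assume eq: "x \<bullet> e = h x"
  then have "x \<notin> \<Omega>" using c(5)[OF assms(3)] by simp
  moreover have "x \<in> closure \<Omega>"
    unfolding closure_approachable
  proof (intro allI impI)
    fix \<epsilon> :: real assume "\<epsilon> > 0"
    obtain d where d: "d > 0" "ball x d \<subseteq> U" using c(4) assms(3) openE by blast
    define s where "s = min d \<epsilon> / 2"
    have s: "s > 0" "s < d" "s < \<epsilon>" using d(1) \<open>\<epsilon> > 0\<close> by (auto simp: s_def)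
    have y: "x - s *\<^sub>R e \<in> U" using d(2) s c(1) by (auto simp: subset_iff dist_norm)
    have "h (x - s *\<^sub>R e) = h x" using c(3)[of x "- s"] by simp
    then have "x - s *\<^sub>R e \<in> \<Omega>" using c(5)[OF y] c(6) eq s by (simp add: inner_diff_left)
    then show "\<exists>y\<in>\<Omega>. dist y x < \<epsilon>" using s c(1) by (intro bexI[of _ "x - s *\<^sub>R e"]) (auto simp: dist_norm)
  qed
  ultimately show "x \<in> frontier \<Omega>" using assms(1) by (simp add: frontier_def interior_open)
qed

section \<open>Gradients, normals and change of chart\<close>

lemma has_derivative_grad:
  fixes h :: "'a::euclidean_space \<Rightarrow> real"
  assumes "h differentiable (at x)" shows "(h has_derivative (\<lambda>v. v \<bullet> grad h x)) (at x)"
  using has_derivative_Df[OF assms] inner_grad[OF assms] by presburger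

lemma grad_eqI:
  fixes h :: "'a::euclidean_space \<Rightarrow> real"
  assumes "(h has_derivative (\<lambda>v. v \<bullet> g)) (at x)" shows "grad h x = g"
  using Df_eqI[OF assms] by (simp add: grad_def inner_commute[of _ g] euclidean_representation)

lemma grad_orthogonal:
  fixes h :: "'a::euclidean_space \<Rightarrow> real"
  assumes "h differentiable (at x)" "\<And>s. h (x + s *\<^sub>R e) = h x" shows "e \<bullet> grad h x = 0"
proof -
  have "(\<lambda>n. 0) \<longlonglongrightarrow> e \<bullet> grad h x"
    using difference_quotient_LIMSEQ[OF has_derivative_grad[OF assms(1)], of e] by (simp add: assms(2))
  from LIMSEQ_unique[OF this tendsto_const] show ?thesis .
qed

text \<open>Pythagoras: \<open>h\<close> is constant in direction \<open>e\<close>, so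
  \<open>grad h\<close> is orthogonal to it. The normalising factor of the normal is thus the length
  of \<open>e - grad h\<close>, which makes normals from different charts comparable.\<close>

lemma norm_graph_normal:
  assumes "local_graph \<Omega> e h U" "h differentiable (at x)"
  shows "norm (e - grad h x) = sqrt (1 + (norm (grad h x))\<^sup>2)"
  using grad_orthogonal[where h=h and e=e, OF assms(2) local_graphD(3)[OF assms(1)]] local_graphD(6)[OF assms(1)]
  by (simp add: norm_eq_sqrt_inner inner_diff_left inner_diff_right inner_commute)

text \<open>The idea is that a Lipschitz graph cannot have a vertical tangent plane, so that the tangent plane of
  the first graph determines a derivative of the second one.\<close>

lemma graph_change:
  fixes \<Omega> :: "'a::euclidean_space set"
  assumes \<Omega>: "open \<Omega>" and c: "local_graph \<Omega> e h U" and c': "local_graph \<Omega> e' h' U'"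
    and x: "x \<in> frontier \<Omega>" "x \<in> U" "x \<in> U'" and d: "h differentiable (at x)"
  shows "h' differentiable (at x) \<and>
    (\<exists>\<kappa>>0. e' - grad h' x = \<kappa> *\<^sub>R (e - grad h x))"
proof -
  note C = local_graphD[OF c] and C' = local_graphD[OF c']
  define N where "N = e - grad h x"
  \<comment> \<open>Both \<open>\<phi>\<close> and \<open>\<phi>'\<close> are defining functions of
    \<open>\<Omega>\<close>: near \<open>x\<close> they are positive exactly inside and vanish
    exactly on the frontier. All comparison between the charts runs through these signs.\<close>
  define \<phi> where "\<phi> y = h y - y \<bullet> e" for y
  define \<phi>' where "\<phi>' y = h' y - y \<bullet> e'" for y
  obtain L where L: "L \<ge> 0" "L-lipschitz_on UNIV h'" using C'(2) by blast
  have pos: "\<phi> y > 0 \<longleftrightarrow> \<phi>' y > 0" and zero: "\<phi> y = 0 \<longleftrightarrow> \<phi>' y = 0" if "y \<in> U \<inter> U'" for y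
  proof -
    have y: "y \<in> U" "y \<in> U'" using that by auto
    have "y \<in> \<Omega> \<longleftrightarrow> \<phi> y > 0" "y \<in> \<Omega> \<longleftrightarrow> \<phi>' y > 0"
      using C(5)[OF y(1)] C'(5)[OF y(2)] by (auto simp only: \<phi>_def \<phi>'_def diff_gt_0_iff_gt)
    then show "\<phi> y > 0 \<longleftrightarrow> \<phi>' y > 0" by simp
    have "y \<in> frontier \<Omega> \<longleftrightarrow> \<phi> y = 0" "y \<in> frontier \<Omega> \<longleftrightarrow> \<phi>' y = 0"
      using frontier_iff_graph[OF \<Omega> c y(1)] frontier_iff_graph[OF \<Omega> c' y(2)]
      by (auto simp only: \<phi>_def \<phi>'_def right_minus_eq)
    then show "\<phi> y = 0 \<longleftrightarrow> \<phi>' y = 0" by simp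
  qed
  have 0: "\<phi> x = 0" "\<phi>' x = 0"
    using frontier_iff_graph[OF \<Omega> c x(2)] frontier_iff_graph[OF \<Omega> c' x(3)] x(1) by (auto simp: \<phi>_def \<phi>'_def)
  obtain r where r: "r > 0" "ball x r \<subseteq> U \<inter> U'"
    using open_Int[OF C(4) C'(4)] x openE by (metis IntI)
  have d\<phi>: "(\<phi> has_derivative (\<lambda>v. - (v \<bullet> N))) (at x)"
    unfolding \<phi>_def[abs_def]
    by (rule has_derivative_eq_rhs, (rule derivative_intros has_derivative_grad[OF d])+)
      (auto simp: N_def inner_diff_right)
  have "e \<bullet> grad h x = 0" by (rule grad_orthogonal[where h=h and e=e, OF d C(3)])
  then have "N \<bullet> e = 1" using C(6) by (simp add: N_def inner_diff_left inner_commute[of "grad h x"])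
  then have N0: "N \<noteq> 0" by auto
  \<comment> \<open>The direction \<open>v = \<epsilon> N - e'\<close> leads below the second graph
    for every positive step, because \<open>\<epsilon>\<close> is so small that the Lipschitz bound
    loses at most half of the descent along \<open>e'\<close>. Hence \<open>\<phi>\<close> is
    positive along it close to \<open>x\<close>, its derivative \<open>- (v \<bullet> N)\<close> is
    nonnegative, and this reads
    \<open>\<epsilon> (N \<bullet> N) \<le> N \<bullet> e'\<close>.\<close>
  have Ne: "N \<bullet> e' > 0"
  proof -
    define \<epsilon> where "\<epsilon> = 1 / (2 * (norm N * (L + 1)))"
    have \<epsilon>: "\<epsilon> > 0" using N0 L(1) by (simp add: \<epsilon>_def)
    have \<epsilon>2: "\<epsilon> * (norm N * (L + 1)) = 1 / 2" using N0 L(1) by (simp add: \<epsilon>_def)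
    define v where "v = \<epsilon> *\<^sub>R N - e'"
    have p: "\<phi>' (x + s *\<^sub>R v) > 0" if s: "s > 0" for s
    proof -
      have "h' (x + s *\<^sub>R v) = h' (x + (s * \<epsilon>) *\<^sub>R N)"
        using C'(3)[of "x + (s * \<epsilon>) *\<^sub>R N" "- s"] by (simp add: v_def algebra_simps)
      moreover have "\<bar>h' (x + (s * \<epsilon>) *\<^sub>R N) - h' x\<bar> \<le> L * (s * \<epsilon> * norm N)"
        using lipschitz_onD[OF L(2), of "x + (s * \<epsilon>) *\<^sub>R N" x] s \<epsilon> by (simp add: dist_norm)
      moreover have "\<bar>N \<bullet> e'\<bar> \<le> norm N" using Cauchy_Schwarz_ineq2[of N e'] C'(1) by simp
      then have "s * \<epsilon> * (N \<bullet> e') \<le> s * \<epsilon> * norm N" using s \<epsilon> by (intro mult_left_mono) auto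
      moreover have "(x + s *\<^sub>R v) \<bullet> e' = x \<bullet> e' + s * \<epsilon> * (N \<bullet> e') - s"
        using C'(6) by (simp add: v_def algebra_simps)
      moreover have "h' x = x \<bullet> e'" using 0 by (simp add: \<phi>'_def)
      ultimately have "\<phi>' (x + s *\<^sub>R v) \<ge> s - s * (\<epsilon> * (norm N * (L + 1)))"
        unfolding \<phi>'_def by (simp add: algebra_simps)
      then show ?thesis using s unfolding \<epsilon>2 by simp
    qed
    have "(\<lambda>n. (\<phi> (x + inverse (real (Suc n)) *\<^sub>R v) - \<phi> x) / inverse (real (Suc n))) \<longlonglongrightarrow> - (v \<bullet> N)"
      by (rule difference_quotient_LIMSEQ[OF d\<phi>])
    moreover have "\<exists>M. \<forall>n\<ge>M. 0 \<le> (\<phi> (x + inverse (real (Suc n)) *\<^sub>R v) - \<phi> x) / inverse (real (Suc n))"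
    proof -
      have "(\<lambda>n. x + inverse (real (Suc n)) *\<^sub>R v) \<longlonglongrightarrow> x + 0 *\<^sub>R v"
        by (intro tendsto_intros LIMSEQ_inverse_real_of_nat)
      then have "\<forall>\<^sub>F n in sequentially. x + inverse (real (Suc n)) *\<^sub>R v \<in> ball x r"
        using r(1) by (intro topological_tendstoD) auto
      then obtain M where "\<And>n. n \<ge> M \<Longrightarrow> x + inverse (real (Suc n)) *\<^sub>R v \<in> ball x r"
        unfolding eventually_sequentially by blast
      then have "\<And>n. n \<ge> M \<Longrightarrow> \<phi> (x + inverse (real (Suc n)) *\<^sub>R v) > 0"
        using r(2) pos p by (metis inverse_positive_iff_positive of_nat_0_less_iff subset_iff zero_less_Suc)
      then show ?thesis using 0 by (intro exI[of _ M]) (auto intro: less_imp_le)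
    qed
    ultimately have "0 \<le> - (v \<bullet> N)" by (rule LIMSEQ_le_const)
    then have "\<epsilon> * (N \<bullet> N) \<le> N \<bullet> e'" by (simp add: v_def inner_diff_left inner_commute[of e'])
    moreover have "\<epsilon> * (N \<bullet> N) > 0" using \<epsilon> N0 by simp
    ultimately show ?thesis by linarith
  qed
  have lip\<phi>': "\<bar>\<phi>' y\<bar> \<le> (L + 1) * norm (y - x)" for y
  proof -
    have "\<phi>' y = (h' y - h' x) - (y - x) \<bullet> e'" using 0 by (simp add: \<phi>'_def algebra_simps)
    moreover have "\<bar>h' y - h' x\<bar> \<le> L * norm (y - x)"
      using lipschitz_onD[OF L(2), of y x] by (simp add: dist_norm)
    moreover have "\<bar>(y - x) \<bullet> e'\<bar> \<le> norm (y - x)"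
      using Cauchy_Schwarz_ineq2[of "y - x" e'] C'(1) by simp
    ultimately show ?thesis unfolding distrib_right by linarith
  qed
  have "(\<phi>' has_derivative (\<lambda>v. - (v \<bullet> N / (N \<bullet> e')))) (at x)"
    unfolding has_derivative_at_alt
  proof (intro conjI allI impI)
    show "bounded_linear (\<lambda>v. - (v \<bullet> N / (N \<bullet> e')))"
      by (intro bounded_linear_minus bounded_linear_compose[OF bounded_linear_divide] bounded_linear_inner_left)
    fix \<epsilon> :: real assume \<epsilon>: "\<epsilon> > 0"
    \<comment> \<open>Chosen so that the factor \<open>L + 2\<close> from the displacement of
      \<open>y\<close> to the second graph cancels, and the divisor \<open>N \<bullet> e'\<close> of
      the claimed derivative is accounted for.\<close>
    define \<epsilon>1 where "\<epsilon>1 = \<epsilon> * (N \<bullet> e') / (L + 2)"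
    have "\<epsilon>1 > 0" using \<epsilon> Ne L(1) by (simp add: \<epsilon>1_def)
    with d\<phi> obtain \<delta> where \<delta>: "\<delta> > 0"
      "\<And>y. norm (y - x) < \<delta> \<Longrightarrow> norm (\<phi> y - \<phi> x - - ((y - x) \<bullet> N)) \<le> \<epsilon>1 * norm (y - x)"
      unfolding has_derivative_at_alt by blast
    show "\<exists>d>0. \<forall>y. norm (y - x) < d \<longrightarrow>
      norm (\<phi>' y - \<phi>' x - - ((y - x) \<bullet> N / (N \<bullet> e'))) \<le> \<epsilon> * norm (y - x)"
    proof (intro exI[of _ "min \<delta> r / (L + 2)"] conjI allI impI)
      show "0 < min \<delta> r / (L + 2)" using \<delta>(1) r(1) L(1) by simp
      fix y assume y: "norm (y - x) < min \<delta> r / (L + 2)"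
      \<comment> \<open>The point of the second graph on the line through \<open>y\<close> in
        direction \<open>e'\<close>. There \<open>\<phi>\<close> vanishes as well, so the derivative
        of \<open>\<phi>\<close> at \<open>x\<close> makes \<open>(y' - x) \<bullet> N\<close>
        small, and this relation can be solved for \<open>\<phi>' y\<close>.\<close>
      define y' where "y' = y + \<phi>' y *\<^sub>R e'"
      have "norm (y' - x) \<le> norm (y - x) + \<bar>\<phi>' y\<bar>"
        using norm_triangle_ineq[of "y - x" "\<phi>' y *\<^sub>R e'"] C'(1) by (simp add: y'_def algebra_simps)
      then have n: "norm (y' - x) \<le> (L + 2) * norm (y - x)"
        using lip\<phi>'[of y] by (simp add: algebra_simps)
      also have "\<dots> < min \<delta> r" using y L(1) by (simp add: pos_less_divide_eq mult.commute)
      finally have y': "norm (y' - x) < \<delta>" "y' \<in> ball x r" by (auto simp: dist_norm norm_minus_commute)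
      have "\<phi>' y' = 0" using C'(3)[of y "\<phi>' y"] C'(6) by (simp add: y'_def \<phi>'_def inner_add_left)
      then have "\<phi> y' = 0" using zero y'(2) r(2) by blast
      then have "\<bar>(y' - x) \<bullet> N\<bar> \<le> \<epsilon>1 * norm (y' - x)" using \<delta>(2)[OF y'(1)] 0 by simp
      also have "\<dots> \<le> \<epsilon>1 * ((L + 2) * norm (y - x))" using n \<open>\<epsilon>1 > 0\<close> by (intro mult_left_mono) auto
      also have "\<dots> = \<epsilon> * (N \<bullet> e') * norm (y - x)" using L(1) by (simp add: \<epsilon>1_def)
      also have "(y' - x) \<bullet> N = (\<phi>' y + (y - x) \<bullet> N / (N \<bullet> e')) * (N \<bullet> e')"
        using Ne by (simp add: y'_def inner_add_left inner_diff_left distrib_right inner_commute[of e' N])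
      finally have "\<bar>\<phi>' y + (y - x) \<bullet> N / (N \<bullet> e')\<bar> * (N \<bullet> e') \<le> \<epsilon> * norm (y - x) * (N \<bullet> e')"
        by (simp only: abs_mult abs_of_pos[OF Ne] mult.assoc mult.commute[of "N \<bullet> e'"])
      then show "norm (\<phi>' y - \<phi>' x - - ((y - x) \<bullet> N / (N \<bullet> e'))) \<le> \<epsilon> * norm (y - x)"
        using Ne 0 by simp
    qed
  qed
  then have "((\<lambda>y. \<phi>' y + y \<bullet> e') has_derivative (\<lambda>v. - (v \<bullet> N / (N \<bullet> e')) + v \<bullet> e')) (at x)"
    by (intro derivative_intros) auto
  moreover have "(\<lambda>y. \<phi>' y + y \<bullet> e') = h'" by (simp add: \<phi>'_def)
  moreover have "(\<lambda>v. - (v \<bullet> N / (N \<bullet> e')) + v \<bullet> e') = (\<lambda>v. v \<bullet> (e' - (1 / (N \<bullet> e')) *\<^sub>R N))"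
    by (simp add: fun_eq_iff inner_diff_right)
  ultimately have hd: "(h' has_derivative (\<lambda>v. v \<bullet> (e' - (1 / (N \<bullet> e')) *\<^sub>R N))) (at x)" by simp
  show ?thesis
  proof (intro conjI exI[of _ "1 / (N \<bullet> e')"])
    show "h' differentiable (at x)" using hd by (auto simp: differentiable_def)
    show "0 < 1 / (N \<bullet> e')" using Ne by simp
    show "e' - grad h' x = (1 / (N \<bullet> e')) *\<^sub>R (e - grad h x)"
      using grad_eqI[OF hd] by (simp add: N_def)
  qed
qed

definition graph_normal :: "'a::euclidean_space \<Rightarrow> 'a \<Rightarrow> 'a" where
  "graph_normal e g = (1 / sqrt (1 + (norm g)\<^sup>2)) *\<^sub>R (e - g)"

text \<open>The definition provides the normal in some chart, whereas the flux is computed in a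
  prescribed one. The positive factor between the two normal directions disappears under
  normalisation.\<close>

lemma outward_unit_normal_in_chart:
  fixes \<Omega> :: "'a::euclidean_space set"
  assumes \<Omega>: "open \<Omega>" and c: "local_graph \<Omega> e h U" and x: "x \<in> U"
    and n: "is_outward_unit_normal \<Omega> x \<nu>"
  shows "h differentiable (at x)" "\<nu> = graph_normal e (grad h x)"
proof -
  obtain e' h' U' where c': "local_graph \<Omega> e' h' U'" and x': "x \<in> frontier \<Omega>" "x \<in> U'"
    and d': "h' differentiable (at x)" and \<nu>: "\<nu> = graph_normal e' (grad h' x)"
    using n unfolding is_outward_unit_normal_def graph_normal_def by blast
  obtain \<kappa> where d: "h differentiable (at x)" and \<kappa>: "\<kappa> > 0" "e - grad h x = \<kappa> *\<^sub>R (e' - grad h' x)"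
    using graph_change[OF \<Omega> c' c x'(1,2) x d'] by blast
  show "h differentiable (at x)" by (rule d)
  have "norm (e - grad h x) = \<kappa> * norm (e' - grad h' x)" using \<kappa> by simp
  then show "\<nu> = graph_normal e (grad h x)"
    unfolding \<nu> graph_normal_def norm_graph_normal[OF c d, symmetric]
      norm_graph_normal[OF c' d', symmetric] using \<kappa> by simp
qed

text \<open>Where \<open>h\<close> is not differentiable, \<open>grad h\<close> is an unspecified value, so that \<open>grad h\<close> need not be
  measurable.\<close>

definition bgrad :: "('a::euclidean_space \<Rightarrow> real) \<Rightarrow> 'a \<Rightarrow> 'a" where
  "bgrad h x = (\<Sum>b\<in>Basis. lim (\<lambda>n. (h (x + inverse (real (Suc n)) *\<^sub>R b) - h x) / inverse (real (Suc n))) *\<^sub>R b)"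

lemma bgrad_measurable:
  assumes "continuous_on UNIV h" shows "bgrad h \<in> borel_measurable borel"
proof -
  have [measurable]: "h \<in> borel_measurable borel" using assms by (rule borel_measurable_continuous_onI)
  show ?thesis unfolding bgrad_def[abs_def] by measurable
qed

lemma bgrad_eq:
  assumes "h differentiable (at x)" shows "bgrad h x = grad h x"
  unfolding bgrad_def grad_def
  using limI[OF difference_quotient_LIMSEQ[OF has_derivative_Df[OF assms]]] by simp

lemma bgrad_translate:
  assumes "\<And>x s. h (x + s *\<^sub>R e) = h x" shows "bgrad h (x + s *\<^sub>R e) = bgrad h x"
proof -
  have "h (x + s *\<^sub>R e + v) = h (x + v)" for v
    using assms[of "x + v" s] by (simp add: algebra_simps)
  then show ?thesis by (simp add: bgrad_def assms)
qed

lemma differentiable_translate: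
  assumes "\<And>x s. h (x + s *\<^sub>R e) = h x" "h differentiable (at (x + s *\<^sub>R e))"
  shows "h differentiable (at x)"
proof -
  obtain D where "(h has_derivative D) (at (x + s *\<^sub>R e))" using assms(2) differentiable_def by blast
  then have "((\<lambda>y. h (y + s *\<^sub>R e)) has_derivative (\<lambda>v. D v)) (at x)"
    by (rule has_derivative_compose[where f="\<lambda>y. y + s *\<^sub>R e" and g=h, rotated])
      (auto intro!: derivative_eq_intros)
  then show ?thesis using assms(1) by (auto simp: differentiable_def)
qed

section \<open>The surface measure in local charts\<close>

locale lipschitz_boundary =
  fixes \<Omega> :: "'a::euclidean_space set" and \<sigma> :: "'a measure" and n :: "'a \<Rightarrow> 'a"
  assumes dom: "lipschitz_domain \<Omega>" and surf: "is_surface_measure \<Omega> \<sigma>"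
    and normal: "AE x in \<sigma>. is_outward_unit_normal \<Omega> x (n x)"
begin

lemma open_dom: "open \<Omega>" and bounded_dom: "bounded \<Omega>"
  using dom unfolding lipschitz_domain_def by auto

lemma sets_surf [simp, measurable_cong]: "sets \<sigma> = sets borel"
  using surf unfolding is_surface_measure_def by auto

lemma space_surf [simp]: "space \<sigma> = UNIV"
  using sets_eq_imp_space_eq[OF sets_surf] by simp

lemma AE_frontier: "AE x in \<sigma>. x \<in> frontier \<Omega>"
proof (rule AE_I[where N="- frontier \<Omega>"])
  show "emeasure \<sigma> (- frontier \<Omega>) = 0" using surf unfolding is_surface_measure_def by auto
qed auto

lemma chart_emeasure:
  assumes "local_graph \<Omega> e h U" "A \<in> sets borel" "A \<subseteq> frontier \<Omega> \<inter> U"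
  shows "emeasure \<sigma> A = (\<integral>\<^sup>+x. indicator A (graph_pt e h x)
    * ennreal (sqrt (1 + (norm (grad h x))\<^sup>2)) * indicator (slab e) x \<partial>lborel)"
  using surf assms unfolding is_surface_measure_def graph_pt_def slab_def by blast

lemma graph_pt_measurable:
  assumes "continuous_on UNIV h" shows "graph_pt e h \<in> borel_measurable borel"
proof -
  have [measurable]: "h \<in> borel_measurable borel" using assms by (rule borel_measurable_continuous_onI)
  show ?thesis unfolding graph_pt_def[abs_def] by measurable
qed

lemma graph_pt_frontier:
  assumes c: "local_graph \<Omega> e h U" "graph_pt e h y \<in> U"
  shows "graph_pt e h y \<in> frontier \<Omega>"
proof -
  have "h (graph_pt e h y) = h y" unfolding graph_pt_def by (rule local_graphD(3)[OF c(1)])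
  then show ?thesis
    unfolding frontier_iff_graph[OF open_dom c] by (simp add: graph_pt_def inner_add_left local_graphD(6)[OF c(1)])
qed

text \<open>The surface density is at least 1, so a null set of the surface pulls back to a Lebesgue
  null set of the slab. Monotonicity of the nonnegative integral suffices, which avoids
  measurability of \<open>grad h\<close>.\<close>

lemma AE_slab:
  assumes c: "local_graph \<Omega> e h U" and P: "AE x in \<sigma>. P x"
  shows "AE y in lborel. y \<in> slab e \<longrightarrow> graph_pt e h y \<in> U \<longrightarrow> P (graph_pt e h y)"
proof -
  note C = local_graphD[OF c]
  obtain N where N: "{x. \<not> P x} \<subseteq> N" "emeasure \<sigma> N = 0" "N \<in> sets borel"
    using AE_E[OF P] by auto
  define A where "A = N \<inter> (frontier \<Omega> \<inter> U)"
  have A [measurable]: "A \<in> sets borel" using N(3) C(4) by (auto simp: A_def)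
  have [measurable]: "graph_pt e h \<in> borel_measurable borel" by (rule graph_pt_measurable[OF C(7)])
  have "emeasure \<sigma> A \<le> emeasure \<sigma> N" by (rule emeasure_mono) (auto simp: A_def N)
  then have "emeasure \<sigma> A = 0" using N(2) by simp
  moreover have "(\<integral>\<^sup>+x. indicator A (graph_pt e h x) * indicator (slab e) x \<partial>lborel) \<le> emeasure \<sigma> A"
    unfolding chart_emeasure[OF c A, unfolded A_def, OF Int_lower2, folded A_def]
  proof (rule nn_integral_mono)
    fix y
    have "1 \<le> ennreal (sqrt (1 + (norm (grad h y))\<^sup>2))"
      using ennreal_leI[of 1 "sqrt (1 + (norm (grad h y))\<^sup>2)"] by simp
    then show "indicator A (graph_pt e h y) * indicator (slab e) y \<le> indicator A (graph_pt e h y)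
        * ennreal (sqrt (1 + (norm (grad h y))\<^sup>2)) * indicator (slab e) y"
      by (auto simp: indicator_def)
  qed
  ultimately have "(\<integral>\<^sup>+x. indicator A (graph_pt e h x) * indicator (slab e) x \<partial>lborel) = 0" by simp
  then have "AE x in lborel. indicator A (graph_pt e h x) * indicator (slab e) x = (0::ennreal)"
    by (subst (asm) nn_integral_0_iff_AE) auto
  then show ?thesis
  proof eventually_elim
    case (elim y)
    show ?case
    proof (intro impI, rule ccontr)
      assume y: "y \<in> slab e" "graph_pt e h y \<in> U" "\<not> P (graph_pt e h y)"
      have "graph_pt e h y \<in> frontier \<Omega>" by (rule graph_pt_frontier[OF c y(2)])
      then show False using elim y N(1) by (auto simp: A_def)
    qed
  qed
qed

lemma AE_chart_normal:
  assumes c: "local_graph \<Omega> e h U"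
  shows "AE x in \<sigma>. x \<in> U \<longrightarrow> h differentiable (at x) \<and> n x = graph_normal e (bgrad h x)"
  using normal
proof eventually_elim
  case (elim x)
  then show ?case using outward_unit_normal_in_chart[OF open_dom c _ elim] bgrad_eq by metis
qed

text \<open>The normal gives differentiability at points of the graph. Since \<open>h\<close> is
  constant in direction \<open>e\<close>, it passes along the line to the slab point.\<close>

lemma AE_slab_differentiable:
  assumes c: "local_graph \<Omega> e h U"
  shows "AE y in lborel. y \<in> slab e \<longrightarrow> graph_pt e h y \<in> U \<longrightarrow> h differentiable (at y)"
  using AE_slab[OF c AE_chart_normal[OF c]]
proof eventually_elim
  case (elim y)
  then show ?case
    using differentiable_translate[where h=h and e=e, OF local_graphD(3)[OF c]] unfolding graph_pt_def by blast
qed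

text \<open>In the chart the surface measure is an image of a weighted Lebesgue measure. Replacing
  \<open>grad\<close> by \<open>bgrad\<close> almost everywhere makes the weight Borel, so that the
  transformation rules for integrals apply.\<close>

lemma chart_density:
  assumes c: "local_graph \<Omega> e h U"
  shows "density \<sigma> (\<lambda>x. ennreal (indicator (frontier \<Omega> \<inter> U) x))
    = distr (density lborel (\<lambda>y. ennreal (indicator (slab e) y * indicator (frontier \<Omega> \<inter> U) (graph_pt e h y)
        * sqrt (1 + (norm (bgrad h y))\<^sup>2)))) borel (graph_pt e h)" (is "?L = distr (density lborel ?d) borel ?g")
proof (rule measure_eqI)
  note C = local_graphD[OF c]
  let ?S = "frontier \<Omega> \<inter> U"
  have S [measurable]: "?S \<in> sets borel" using C(4) by auto
  have [measurable]: "?g \<in> borel_measurable borel" by (rule graph_pt_measurable[OF C(7)])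
  have [measurable]: "bgrad h \<in> borel_measurable borel" by (rule bgrad_measurable[OF C(7)])
  show "sets ?L = sets (distr (density lborel ?d) borel ?g)" by simp
  fix A assume "A \<in> sets ?L"
  then have A [measurable]: "A \<in> sets borel" by simp
  have "emeasure ?L A = (\<integral>\<^sup>+x. ennreal (indicator ?S x) * indicator A x \<partial>\<sigma>)"
    by (subst emeasure_density) auto
  also have "\<dots> = (\<integral>\<^sup>+x. indicator (A \<inter> ?S) x \<partial>\<sigma>)"
    by (intro nn_integral_cong) (auto simp: indicator_def)
  also have "\<dots> = emeasure \<sigma> (A \<inter> ?S)" by simp
  also have "\<dots> = (\<integral>\<^sup>+x. indicator (A \<inter> ?S) (?g x)
    * ennreal (sqrt (1 + (norm (grad h x))\<^sup>2)) * indicator (slab e) x \<partial>lborel)"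
    by (rule chart_emeasure[OF c]) auto
  also have "\<dots> = (\<integral>\<^sup>+y. ?d y * indicator A (?g y) \<partial>lborel)"
    by (rule nn_integral_cong_AE, use AE_slab_differentiable[OF c] in eventually_elim)
      (auto simp: indicator_def bgrad_eq)
  also have "\<dots> = (\<integral>\<^sup>+y. indicator A (?g y) \<partial>density lborel ?d)"
    by (subst nn_integral_density) auto
  also have "\<dots> = emeasure (distr (density lborel ?d) borel ?g) A"
    by (subst nn_integral_distr[symmetric, where T="?g" and M'=borel]) auto
  finally show "emeasure ?L A = emeasure (distr (density lborel ?d) borel ?g) A" .
qed

lemma chart_integral:
  fixes g :: "'a \<Rightarrow> real"
  assumes c: "local_graph \<Omega> e h U" and g: "g \<in> borel_measurable borel" "\<And>x. x \<notin> U \<Longrightarrow> g x = 0"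
  shows "(LINT x|\<sigma>. g x) = (LINT y|lborel. indicator (slab e) y
    * (g (graph_pt e h y) * sqrt (1 + (norm (bgrad h y))\<^sup>2)))"
proof -
  note C = local_graphD[OF c]
  let ?S = "frontier \<Omega> \<inter> U" and ?g = "graph_pt e h"
  have S [measurable]: "?S \<in> sets borel" using C(4) by auto
  have [measurable]: "?g \<in> borel_measurable borel" by (rule graph_pt_measurable[OF C(7)])
  have [measurable]: "bgrad h \<in> borel_measurable borel" by (rule bgrad_measurable[OF C(7)])
  note g(1) [measurable]
  let ?d = "\<lambda>y. indicator (slab e) y * indicator ?S (?g y) * sqrt (1 + (norm (bgrad h y))\<^sup>2)"
  have gS: "indicator ?S (?g y) * g (?g y) = g (?g y)" for y
    using graph_pt_frontier[OF c] g(2) by (cases "?g y \<in> U") auto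
  have "(LINT x|\<sigma>. g x) = (LINT x|\<sigma>. indicator ?S x *\<^sub>R g x)"
  proof (rule integral_cong_AE)
    show "AE x in \<sigma>. g x = indicator ?S x *\<^sub>R g x"
      using AE_frontier by eventually_elim (use g(2) in \<open>auto simp: indicator_def\<close>)
  qed measurable
  also have "\<dots> = (LINT x|density \<sigma> (\<lambda>x. ennreal (indicator ?S x)). g x)"
    by (subst integral_density) auto
  also have "\<dots> = (LINT x|distr (density lborel (\<lambda>y. ennreal (?d y))) borel ?g. g x)"
    unfolding chart_density[OF c] ..
  also have "\<dots> = (LINT y|density lborel (\<lambda>y. ennreal (?d y)). g (?g y))"
    by (subst integral_distr) auto
  also have "\<dots> = (LINT y|lborel. ?d y *\<^sub>R g (?g y))"
    by (subst integral_density) auto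
  also have "\<dots> = (LINT y|lborel. indicator (slab e) y * (g (?g y) * sqrt (1 + (norm (bgrad h y))\<^sup>2)))"
  proof (rule Bochner_Integration.integral_cong[OF refl])
    fix y
    have "?d y *\<^sub>R g (?g y) = indicator (slab e) y * (indicator ?S (?g y) * g (?g y)) * sqrt (1 + (norm (bgrad h y))\<^sup>2)"
      by simp
    then show "?d y *\<^sub>R g (?g y) = indicator (slab e) y * (g (?g y) * sqrt (1 + (norm (bgrad h y))\<^sup>2))"
      unfolding gS by simp
  qed
  finally show ?thesis .
qed

text \<open>Testing the derivative in its own direction \<open>grad h\<close> bounds the gradient by
  the Lipschitz constant, and slab points over a bounded part of the graph are bounded.\<close>

lemma chart_finite:
  assumes c: "local_graph \<Omega> e h U"
  shows "emeasure \<sigma> (frontier \<Omega> \<inter> (U \<inter> ball x r)) < \<infinity>"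
proof -
  note C = local_graphD[OF c]
  let ?A = "frontier \<Omega> \<inter> (U \<inter> ball x r)"
  obtain L where L: "L \<ge> 0" "L-lipschitz_on UNIV h" using C(2) by blast
  define K where "K = sqrt (1 + L\<^sup>2)"
  have Am [measurable]: "?A \<in> sets borel" using C(4) by auto
  have "emeasure \<sigma> ?A = (\<integral>\<^sup>+y. indicator ?A (graph_pt e h y)
    * ennreal (sqrt (1 + (norm (grad h y))\<^sup>2)) * indicator (slab e) y \<partial>lborel)"
    by (rule chart_emeasure[OF c Am]) auto
  also have "\<dots> \<le> (\<integral>\<^sup>+y. ennreal K * indicator (ball (0::'a) (norm x + r + 1)) y \<partial>lborel)"
  proof (rule nn_integral_mono_AE)
    show "AE y in lborel. indicator ?A (graph_pt e h y) * ennreal (sqrt (1 + (norm (grad h y))\<^sup>2))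
        * indicator (slab e) y \<le> ennreal K * indicator (ball (0::'a) (norm x + r + 1)) y"
      using AE_slab_differentiable[OF c]
    proof eventually_elim
      case (elim y)
      show ?case
      proof (cases "graph_pt e h y \<in> ?A \<and> y \<in> slab e")
        case True
        then have d: "h differentiable (at y)" using elim by auto
        have "(\<lambda>k. \<bar>(h (y + inverse (real (Suc k)) *\<^sub>R grad h y) - h y) / inverse (real (Suc k))\<bar>)
            \<longlonglongrightarrow> \<bar>grad h y \<bullet> grad h y\<bar>"
          by (intro tendsto_rabs difference_quotient_LIMSEQ has_derivative_grad d)
        then have "\<bar>grad h y \<bullet> grad h y\<bar> \<le> L * norm (grad h y)"
        proof (rule LIMSEQ_le_const2)
          have "\<bar>(h (y + s *\<^sub>R grad h y) - h y) / s\<bar> \<le> L * norm (grad h y)" if "s > 0" for s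
            using lipschitz_onD[OF L(2), of "y + s *\<^sub>R grad h y" y] that
            by (simp add: dist_norm abs_divide pos_divide_le_eq algebra_simps)
          then show "\<exists>N. \<forall>k\<ge>N. \<bar>(h (y + inverse (real (Suc k)) *\<^sub>R grad h y) - h y) / inverse (real (Suc k))\<bar>
              \<le> L * norm (grad h y)" by (metis inverse_positive_iff_positive of_nat_0_less_iff zero_less_Suc)
        qed
        then have "norm (grad h y) * norm (grad h y) \<le> L * norm (grad h y)"
          by (simp add: dot_square_norm power2_eq_square)
        then have "norm (grad h y) \<le> L" using L(1) by (cases "grad h y = 0") auto
        then have K: "sqrt (1 + (norm (grad h y))\<^sup>2) \<le> K" using L(1) by (simp add: K_def power_mono)
        have e: "norm e = 1" by (rule C(1))
        have "norm y < norm x + r + 1"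
        proof -
          have "norm y \<le> norm (graph_pt e h y) + 1"
            unfolding graph_pt_def by (rule norm_slab_le[OF e]) (use True in simp)
          moreover have "norm (graph_pt e h y) < norm x + r"
          proof -
            have "norm (graph_pt e h y - x) < r" using True by (simp add: dist_norm norm_minus_commute)
            then show ?thesis using norm_triangle_ineq[of "graph_pt e h y - x" x] by simp
          qed
          ultimately show ?thesis by linarith
        qed
        then show ?thesis using True K by (simp add: ennreal_leI)
      qed auto
    qed
  qed
  also have "\<dots> = ennreal K * emeasure lborel (ball (0::'a) (norm x + r + 1))"
    by (rule nn_integral_cmult_indicator) auto
  also have "\<dots> < \<infinity>" using emeasure_bounded_finite[OF bounded_ball, of "0::'a" "norm x + r + 1"]
    by (simp add: ennreal_mult_less_top)
  finally show ?thesis .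
qed

text \<open>Cutting charts down to unit balls keeps them charts and makes their surface measure
  finite; compactness of the frontier then leaves finitely many.\<close>

lemma finite_charts:
  obtains \<C> :: "('a \<times> ('a \<Rightarrow> real) \<times> 'a set) set" where "finite \<C>"
    "\<And>e h U. (e, h, U) \<in> \<C> \<Longrightarrow> local_graph \<Omega> e h U \<and> emeasure \<sigma> (frontier \<Omega> \<inter> U) < \<infinity>"
    "frontier \<Omega> \<subseteq> (\<Union>(e, h, U)\<in>\<C>. U)"
proof -
  define \<A> where "\<A> = {(e, h, U). local_graph \<Omega> e h U \<and> emeasure \<sigma> (frontier \<Omega> \<inter> U) < \<infinity>}"
  have "frontier \<Omega> \<subseteq> (\<Union>T\<in>\<A>. snd (snd T))"
  proof
    fix x assume x: "x \<in> frontier \<Omega>"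
    then obtain e h U where c: "local_graph \<Omega> e h U" "x \<in> U"
      using dom unfolding lipschitz_domain_def by blast
    have "local_graph \<Omega> e h (U \<inter> ball x 1)"
      using c(1) unfolding local_graph_def by auto
    then have "(e, h, U \<inter> ball x 1) \<in> \<A>" using chart_finite[OF c(1), of x 1] by (simp add: \<A>_def)
    then show "x \<in> (\<Union>T\<in>\<A>. snd (snd T))" using c(2) by force
  qed
  moreover have "compact (frontier \<Omega>)" using bounded_dom by (rule compact_frontier_bounded)
  moreover have "\<And>T. T \<in> \<A> \<Longrightarrow> open (snd (snd T))" using local_graphD(4) by (auto simp: \<A>_def)
  ultimately obtain \<C> where "\<C> \<subseteq> \<A>" "finite \<C>" "frontier \<Omega> \<subseteq> (\<Union>T\<in>\<C>. snd (snd T))"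
    using compactE_image[of "frontier \<Omega>" \<A> "\<lambda>T. snd (snd T)"] by metis
  then show thesis by (intro that[of \<C>]) (auto simp: \<A>_def case_prod_beta')
qed

lemma finite_surf: "emeasure \<sigma> UNIV < \<infinity>"
proof -
  obtain \<C> where \<C>: "finite \<C>"
    "\<And>e h U. (e, h, U) \<in> \<C> \<Longrightarrow> local_graph \<Omega> e h U \<and> emeasure \<sigma> (frontier \<Omega> \<inter> U) < \<infinity>"
    "frontier \<Omega> \<subseteq> (\<Union>(e, h, U)\<in>\<C>. U)" using finite_charts by metis
  have m: "frontier \<Omega> \<inter> snd (snd T) \<in> sets \<sigma>" if "T \<in> \<C>" for T
  proof -
    have "open (snd (snd T))"
      using \<C>(2)[of "fst T" "fst (snd T)" "snd (snd T)"] that by (auto intro: local_graphD(4)[of \<Omega>])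
    then show ?thesis by auto
  qed
  have "emeasure \<sigma> (frontier \<Omega>) \<le> emeasure \<sigma> (\<Union>T\<in>\<C>. frontier \<Omega> \<inter> snd (snd T))"
    using \<C>(3) m \<C>(1) by (intro emeasure_mono sets.finite_UN) (auto simp: case_prod_beta')
  also have "\<dots> \<le> (\<Sum>T\<in>\<C>. emeasure \<sigma> (frontier \<Omega> \<inter> snd (snd T)))"
    using m \<C>(1) by (intro emeasure_subadditive_finite) auto
  also have "\<dots> < \<infinity>" using \<C>(1,2) by (auto simp: less_top[symmetric] case_prod_beta')
  finally have "emeasure \<sigma> (frontier \<Omega>) < \<infinity>" .
  moreover have "emeasure \<sigma> (frontier \<Omega>) = emeasure \<sigma> UNIV"
    by (rule emeasure_eq_AE) (use AE_frontier in auto)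
  ultimately show ?thesis by simp
qed

text \<open>\<open>n\<close> is known only up to null sets. In every chart it agrees almost
  everywhere with the Borel function built from \<open>bgrad\<close>, so these functions can be
  glued along a finite cover, and it does not matter which chart takes precedence on
  overlaps.\<close>

lemma normal_borel: "\<exists>n'\<in>borel_measurable borel. AE x in \<sigma>. n' x = n x"
proof -
  obtain \<C> where \<C>: "finite \<C>"
    "\<And>e h U. (e, h, U) \<in> \<C> \<Longrightarrow> local_graph \<Omega> e h U \<and> emeasure \<sigma> (frontier \<Omega> \<inter> U) < \<infinity>"
    "frontier \<Omega> \<subseteq> (\<Union>(e, h, U)\<in>\<C>. U)" using finite_charts by metis
  have "\<exists>n'\<in>borel_measurable borel. AE x in \<sigma>. x \<in> (\<Union>T\<in>\<C>. snd (snd T)) \<longrightarrow> n' x = n x"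
    using \<C>(1,2)
  proof (induction \<C>)
    case empty
    then show ?case by (intro bexI[of _ "\<lambda>_. 0"]) auto
  next
    case (insert T \<C>)
    obtain e h U where T: "T = (e, h, U)" by (cases T) auto
    have c: "local_graph \<Omega> e h U" using insert.prems[of e h U] T by auto
    note C = local_graphD[OF c]
    obtain n' where n': "n' \<in> borel_measurable borel"
      "AE x in \<sigma>. x \<in> (\<Union>T\<in>\<C>. snd (snd T)) \<longrightarrow> n' x = n x"
      using insert.IH insert.prems by auto
    note n'(1) [measurable]
    have [measurable]: "U \<in> sets borel" using C(4) by simp
    have [measurable]: "bgrad h \<in> borel_measurable borel" by (rule bgrad_measurable[OF C(7)])
    show ?case
    proof (rule bexI[of _ "\<lambda>x. if x \<in> U then graph_normal e (bgrad h x) else n' x"])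
      show "AE x in \<sigma>. x \<in> (\<Union>T\<in>insert T \<C>. snd (snd T)) \<longrightarrow>
          (if x \<in> U then graph_normal e (bgrad h x) else n' x) = n x"
        using n'(2) AE_chart_normal[OF c] by eventually_elim (auto simp: T)
      show "(\<lambda>x. if x \<in> U then graph_normal e (bgrad h x) else n' x) \<in> borel_measurable borel"
        unfolding graph_normal_def by measurable
    qed
  qed
  then obtain n' where n': "n' \<in> borel_measurable borel"
    "AE x in \<sigma>. x \<in> (\<Union>T\<in>\<C>. snd (snd T)) \<longrightarrow> n' x = n x" by blast
  have "AE x in \<sigma>. n' x = n x"
    using n'(2) AE_frontier by eventually_elim (use \<C>(3) in \<open>auto simp: case_prod_beta'\<close>)
  then show ?thesis using n'(1) by blast
qed

end

section \<open>Divergence theorem on Lipschitz domains\<close>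

lemma DERIV_max_sq: "((\<lambda>t::real. (max 0 t)\<^sup>2) has_real_derivative 2 * max 0 x) (at x)"
proof -
  consider "x > 0" | "x < 0" | "x = 0" by linarith
  then show ?thesis
  proof cases
    case 1
    have "((\<lambda>t. t\<^sup>2) has_real_derivative 2 * max 0 x) (at x)"
      by (rule derivative_eq_intros refl)+ (use 1 in auto)
    then show ?thesis
      by (rule has_field_derivative_transform_within_open[where S="{0<..}"]) (use 1 in auto)
  next
    case 2
    have "((\<lambda>t. 0) has_real_derivative 2 * max 0 x) (at x)" using 2 by simp
    then show ?thesis
      by (rule has_field_derivative_transform_within_open[where S="{..<0}"]) (use 2 in auto)
  next
    case 3
    have "((\<lambda>t::real. (max 0 t)\<^sup>2 / t) \<longlongrightarrow> 0) (at 0)"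
    proof (rule Lim_null_comparison)
      show "\<forall>\<^sub>F t in at 0. norm ((max 0 t)\<^sup>2 / t) \<le> \<bar>t\<bar>"
        by (intro always_eventually) (auto simp: max_def power2_eq_square)
      show "((\<lambda>t::real. \<bar>t\<bar>) \<longlongrightarrow> 0) (at 0)" by (rule tendsto_rabs_zero) (rule tendsto_ident_at)
    qed
    then show ?thesis using 3 by (simp add: has_field_derivative_iff)
  qed
qed

lemma Ck_on_1_max_sq:
  fixes f :: "'a::real_normed_vector \<Rightarrow> real"
  assumes "Ck_on 1 G f" shows "Ck_on 1 G (\<lambda>x. (max 0 (f x))\<^sup>2)"
  by (rule Ck_on_1_real_compose[OF assms DERIV_max_sq]) (intro continuous_intros)

text \<open>One continuous derivative is enough, so two nested squares of positive parts serve as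
  cutoff. The factor \<open>4 / (3 r\<^sup>2)\<close> makes the inner quadratic function equal to 1
  at distance \<open>r / 2\<close>, and it is negative beyond distance \<open>r\<close>.\<close>

lemma C1_bump:
  fixes z :: "'a::euclidean_space"
  assumes "r > 0"
  obtains \<psi> :: "'a \<Rightarrow> real" where "Ck_on 1 UNIV \<psi>" "\<And>x. x \<in> ball z (r / 2) \<Longrightarrow> \<psi> x = 1"
    "\<And>x. x \<notin> cball z r \<Longrightarrow> \<psi> x = 0"
proof
  let ?q = "\<lambda>x. 4 / (3 * r\<^sup>2) * (r\<^sup>2 - (x - z) \<bullet> (x - z))"
  let ?\<psi> = "\<lambda>x. 1 - (max 0 (1 - (max 0 (?q x))\<^sup>2))\<^sup>2"
  have "Ck_on 1 UNIV (\<lambda>x::'a. x)" by (rule Ck_on_1_bounded_linear[OF bounded_linear_ident])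
  then have "Ck_on 1 UNIV ?q" by (intro Ck_on_1_mult Ck_on_1_diff Ck_on_1_inner Ck_on_1_const)
  then show "Ck_on 1 UNIV ?\<psi>" by (intro Ck_on_1_diff Ck_on_1_max_sq Ck_on_1_const)
  show "?\<psi> x = 1" if "x \<in> ball z (r / 2)" for x
  proof -
    have "norm (x - z) \<le> r / 2" using that by (simp add: dist_norm norm_minus_commute)
    then have "(norm (x - z))\<^sup>2 \<le> (r / 2)\<^sup>2" by (intro power_mono) auto
    then have "(x - z) \<bullet> (x - z) \<le> r\<^sup>2 / 4" by (simp add: dot_square_norm power_divide)
    then have "4 / (3 * r\<^sup>2) * (r\<^sup>2 - (x - z) \<bullet> (x - z)) \<ge> 4 / (3 * r\<^sup>2) * (3 / 4 * r\<^sup>2)"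
      using assms by (intro mult_left_mono) auto
    then have q: "?q x \<ge> 1" using assms by simp
    then have "(max 0 (?q x))\<^sup>2 \<ge> 1\<^sup>2" by (intro power_mono) auto
    then have "max 0 (1 - (max 0 (?q x))\<^sup>2) = 0" by (intro max_absorb1) (simp only: power_one diff_le_0_iff_le)
    then show ?thesis by (simp only:) simp
  qed
  show "?\<psi> x = 0" if "x \<notin> cball z r" for x
  proof -
    have "norm (x - z) > r" using that by (simp add: dist_norm norm_minus_commute)
    then have "(norm (x - z))\<^sup>2 \<ge> r\<^sup>2" using assms by (intro power_mono) auto
    then have "?q x \<le> 0" using assms by (intro mult_nonneg_nonpos) (auto simp: dot_square_norm)
    then have "max 0 (?q x) = 0" by (rule max_absorb1)
    then show ?thesis by (simp only:) simp
  qed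
qed

lemma Ck_on_1_Un:
  assumes "open A" "open B" "Ck_on 1 A f" "Ck_on 1 B f" shows "Ck_on 1 (A \<union> B) f"
  using assms unfolding Ck_on_1_iff by (auto intro: continuous_on_open_Un)

text \<open>The open sets \<open>V\<close> and \<open>- K\<close> cover the space, and the product
  is zero on the second. Cutting off thus yields the globally defined functions that
  \<open>graph_flux\<close> requires.\<close>

lemma Ck_on_1_extend_zero:
  fixes f \<psi> :: "'a::euclidean_space \<Rightarrow> real"
  assumes "open V" "Ck_on 1 V f" "Ck_on 1 UNIV \<psi>" "closed K" "K \<subseteq> V" "\<And>x. x \<notin> K \<Longrightarrow> \<psi> x = 0"
  shows "Ck_on 1 UNIV (\<lambda>x. \<psi> x * f x)"
proof -
  have "Ck_on 1 V (\<lambda>x. \<psi> x * f x)"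
    using Ck_on_subset[OF assms(3)] by (intro Ck_on_1_mult assms(2)) auto
  moreover have "Ck_on 1 (- K) (\<lambda>x. \<psi> x * f x)"
    by (rule Ck_on_1_cong[OF _ Ck_on_1_const[of _ 0]]) (use assms(4,6) in auto)
  ultimately have "Ck_on 1 (V \<union> - K) (\<lambda>x. \<psi> x * f x)"
    using assms(1,4) by (intro Ck_on_1_Un) auto
  moreover have "V \<union> - K = UNIV" using assms(5) by auto
  ultimately show ?thesis by simp
qed

section \<open>Integrability and localisation of the divergence theorem\<close>

context lipschitz_boundary
begin

lemma frontier_borel [measurable]: "frontier \<Omega> \<in> sets borel" and dom_borel [measurable]: "\<Omega> \<in> sets borel"
  using open_dom by auto

lemma compact_closure_dom: "compact (closure \<Omega>)" and compact_frontier_dom: "compact (frontier \<Omega>)"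
  using bounded_dom by (auto simp: compact_closure intro: compact_frontier_bounded)

lemma frontier_subset: "frontier \<Omega> \<subseteq> closure \<Omega>" and dom_subset: "\<Omega> \<subseteq> closure \<Omega>"
  by (auto simp: frontier_def closure_subset)

lemma norm_normal: "AE x in \<sigma>. norm (n x) = 1"
  using normal
proof eventually_elim
  case (elim x)
  then obtain e h U where c: "local_graph \<Omega> e h U" "h differentiable (at x)"
    "n x = (1 / sqrt (1 + (norm (grad h x))\<^sup>2)) *\<^sub>R (e - grad h x)"
    unfolding is_outward_unit_normal_def by blast
  have "0 < 1 + (norm (grad h x))\<^sup>2" by (simp add: add_pos_nonneg)
  then show ?case using norm_graph_normal[OF c(1,2)] c(3) by simp
qed

lemma finite_measure_surf: "finite_measure \<sigma>"
  using finite_surf by (intro finite_measureI) (auto simp: less_top)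

lemma continuous_bounded_dom:
  fixes f :: "'a \<Rightarrow> 'b::real_normed_vector"
  assumes "continuous_on (closure \<Omega>) f"
  shows "\<exists>B\<ge>0. \<forall>x\<in>closure \<Omega>. norm (f x) \<le> B"
proof -
  have "bounded (f ` closure \<Omega>)"
    using compact_continuous_image[OF assms compact_closure_dom] compact_imp_bounded by blast
  then obtain B where B: "\<forall>y\<in>f ` closure \<Omega>. norm y \<le> B" unfolding bounded_iff by blast
  then show ?thesis by (intro exI[of _ "max B 0"]) auto
qed

lemma integrable_dom:
  fixes f :: "'a \<Rightarrow> real"
  assumes "continuous_on (closure \<Omega>) f"
  shows "integrable lborel (\<lambda>x. indicator \<Omega> x * f x)"
proof -
  obtain B where B: "B \<ge> 0" "\<forall>x\<in>closure \<Omega>. norm (f x) \<le> B"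
    using continuous_bounded_dom[OF assms] by blast
  show ?thesis
  proof (rule Bochner_Integration.integrable_bound)
    show "integrable lborel (\<lambda>x. B * indicator \<Omega> x)"
      using emeasure_bounded_finite[OF bounded_dom]
      by (intro integrable_mult_right integrable_real_indicator) auto
    show "(\<lambda>x. indicator \<Omega> x * f x) \<in> borel_measurable lborel"
      using borel_measurable_continuous_on_indicator[OF dom_borel continuous_on_subset[OF assms dom_subset]] by simp
    show "AE x in lborel. norm (indicator \<Omega> x * f x) \<le> norm (B * indicator \<Omega> x)"
      using B dom_subset by (intro AE_I2) (auto simp: indicator_def)
  qed
qed

lemma integrable_frontier:
  fixes f :: "'a \<Rightarrow> 'a"
  assumes "continuous_on (closure \<Omega>) f" "n' \<in> borel_measurable borel" "AE x in \<sigma>. n' x = n x"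
  shows "integrable \<sigma> (\<lambda>x. indicator (frontier \<Omega>) x * (f x \<bullet> n' x))"
proof -
  interpret finite_measure \<sigma> by (rule finite_measure_surf)
  obtain B where B: "B \<ge> 0" "\<forall>x\<in>closure \<Omega>. norm (f x) \<le> B"
    using continuous_bounded_dom[OF assms(1)] by blast
  note assms(2) [measurable]
  have [measurable]: "(\<lambda>x. indicator (frontier \<Omega>) x *\<^sub>R f x) \<in> borel_measurable borel"
    by (rule borel_measurable_continuous_on_indicator[OF frontier_borel continuous_on_subset[OF assms(1) frontier_subset]])
  have "(\<lambda>x. (indicator (frontier \<Omega>) x *\<^sub>R f x) \<bullet> n' x) \<in> borel_measurable \<sigma>" by measurable
  then have m: "(\<lambda>x. indicator (frontier \<Omega>) x * (f x \<bullet> n' x)) \<in> borel_measurable \<sigma>" by simp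
  show ?thesis
  proof (rule integrable_const_bound[where B=B, OF _ m])
    show "AE x in \<sigma>. norm (indicator (frontier \<Omega>) x * (f x \<bullet> n' x)) \<le> B"
      using norm_normal assms(3) AE_frontier
    proof eventually_elim
      case (elim x)
      have "\<bar>f x \<bullet> n' x\<bar> \<le> norm (f x) * norm (n' x)" by (rule Cauchy_Schwarz_ineq2)
      also have "\<dots> \<le> B" using elim B(2) frontier_subset by auto
      finally show ?case using elim by simp
    qed
  qed
qed

text \<open>The divergence theorem for the field \<open>f b\<close> with a constant vector
  \<open>b\<close>. The parameter \<open>n'\<close> is meant to be a Borel version of the
  normal.\<close>

definition flux_formula :: "('a \<Rightarrow> 'a) \<Rightarrow> 'a \<Rightarrow> ('a \<Rightarrow> real) \<Rightarrow> bool" where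
  "flux_formula n' b f \<longleftrightarrow> (LINT x|lborel. indicator \<Omega> x * Df f x b)
    = (LINT x|\<sigma>. indicator (frontier \<Omega>) x * (f x *\<^sub>R b \<bullet> n' x))"

lemma flux_formula_zero:
  assumes "open W" "closure \<Omega> \<subseteq> W" "\<And>x. x \<in> W \<Longrightarrow> f x = 0"
  shows "flux_formula n' b f"
proof -
  have "Df f x b = 0" if "x \<in> \<Omega>" for x
    using Df_cong[OF assms(1), of x f "\<lambda>_. 0"] that assms dom_subset by auto
  then have "(\<lambda>x. indicator \<Omega> x * Df f x b) = (\<lambda>x. 0)" by (auto simp: indicator_def)
  moreover have "(\<lambda>x. indicator (frontier \<Omega>) x * (f x *\<^sub>R b \<bullet> n' x)) = (\<lambda>x. 0)"
    using assms(2,3) frontier_subset by (fastforce simp: indicator_def fun_eq_iff)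
  ultimately show ?thesis by (simp add: flux_formula_def)
qed

lemma Df_zero_outside_closed:
  assumes "closed K" "\<And>x. x \<notin> K \<Longrightarrow> f x = (0::real)" "x \<notin> K" shows "Df f x b = 0"
  using Df_cong[OF open_Compl[OF assms(1)], of x f "\<lambda>_. 0"] assms(2,3) by auto

lemma flux_formula_interior:
  assumes f: "Ck_on 1 UNIV f" "\<And>x. x \<notin> cball z r \<Longrightarrow> f x = 0" and K: "cball z r \<subseteq> \<Omega>"
  shows "flux_formula n' b f"
proof -
  have R: "f x = 0" if "norm x > norm z + r" for x
    using that norm_triangle_ineq[of z "x - z"] by (intro f(2)) (simp add: dist_norm norm_minus_commute)
  have "(\<lambda>x. indicator \<Omega> x * Df f x b) = (\<lambda>x. Df f x b)"
    using Df_zero_outside_closed[OF closed_cball f(2)] K by (force simp: indicator_def)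
  moreover have "(\<lambda>x. indicator (frontier \<Omega>) x * (f x *\<^sub>R b \<bullet> n' x)) = (\<lambda>x. 0)"
    using f(2) K open_dom by (force simp: indicator_def frontier_def interior_open)
  ultimately show ?thesis using integral_Df_eq_0[OF f(1) R] by (simp add: flux_formula_def)
qed

text \<open>On the support of \<open>f\<close> the domain coincides with the full region below the
  graph, so \<open>graph_flux\<close> applies and its right-hand side is read as a surface
  integral.\<close>

lemma flux_formula_chart:
  assumes n': "n' \<in> borel_measurable borel" "AE x in \<sigma>. n' x = n x"
    and c: "local_graph \<Omega> e h U"
    and f: "Ck_on 1 UNIV f" "\<And>x. x \<notin> cball z r \<Longrightarrow> f x = 0" and K: "cball z r \<subseteq> U"
  shows "flux_formula n' b f"
proof -
  note C = local_graphD[OF c]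
  obtain L where L: "L-lipschitz_on UNIV h" using C(2) by blast
  have R: "f x = 0" if "norm x > norm z + r" for x
    using that norm_triangle_ineq[of z "x - z"] by (intro f(2)) (simp add: dist_norm norm_minus_commute)
  have fU: "f x = 0" if "x \<notin> U" for x using f(2) K that by blast
  have [measurable]: "f \<in> borel_measurable borel"
    by (intro borel_measurable_continuous_onI Ck_on_1D(4)[OF f(1)])
  have bm [measurable]: "bgrad h \<in> borel_measurable borel" by (rule bgrad_measurable[OF C(7)])
  note n'(1) [measurable]
  let ?g = "graph_pt e h"
  have "(\<lambda>x. indicator \<Omega> x * Df f x b) = (\<lambda>x. indicator {x. x \<bullet> e < h x} x * Df f x b)"
    using Df_zero_outside_closed[OF closed_cball f(2)] K C(5) by (force simp: indicator_def)
  then have "(LINT x|lborel. indicator \<Omega> x * Df f x b) = (LINT x|lborel. indicator {x. x \<bullet> e < h x} x * Df f x b)"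
    by simp
  also have "\<dots> = (LINT y|lborel. indicator (slab e) y * (f (?g y) * (b \<bullet> (e - bgrad h y))))"
  proof (rule graph_flux[OF C(1) L C(3) f(1) R bm])
    show "AE y in lborel. y \<in> slab e \<longrightarrow> f (?g y) \<noteq> 0 \<longrightarrow> (h has_derivative (\<lambda>v. v \<bullet> bgrad h y)) (at y)"
      using AE_slab_differentiable[OF c]
      by eventually_elim (metis fU bgrad_eq has_derivative_grad)
  qed
  also have "\<dots> = (LINT y|lborel. indicator (slab e) y
      * ((f (?g y) *\<^sub>R b \<bullet> graph_normal e (bgrad h (?g y))) * sqrt (1 + (norm (bgrad h y))\<^sup>2)))"
  proof (rule Bochner_Integration.integral_cong[OF refl])
    fix y
    have b: "bgrad h (?g y) = bgrad h y"
      unfolding graph_pt_def by (rule bgrad_translate[where h=h and e=e, OF C(3)])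
    \<comment> \<open>The surface density is the length of \<open>e - bgrad h\<close> wherever
      \<open>h\<close> is differentiable and cancels the normalisation of the normal; as an identity
      of formulas this holds at every point.\<close>
    have "1 + (norm (bgrad h y))\<^sup>2 > 0" by (simp add: add_pos_nonneg)
    then have "sqrt (1 + (norm (bgrad h y))\<^sup>2) \<noteq> 0" by simp
    then show "indicator (slab e) y * (f (?g y) * (b \<bullet> (e - bgrad h y))) = indicator (slab e) y
      * ((f (?g y) *\<^sub>R b \<bullet> graph_normal e (bgrad h (?g y))) * sqrt (1 + (norm (bgrad h y))\<^sup>2))"
      unfolding b graph_normal_def by simp
  qed
  also have "\<dots> = (LINT x|\<sigma>. f x *\<^sub>R b \<bullet> graph_normal e (bgrad h x))"
    by (rule chart_integral[OF c, symmetric]) (auto simp: fU graph_normal_def)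
  also have "\<dots> = (LINT x|\<sigma>. indicator (frontier \<Omega>) x * (f x *\<^sub>R b \<bullet> n' x))"
  proof (rule integral_cong_AE)
    show "AE x in \<sigma>. f x *\<^sub>R b \<bullet> graph_normal e (bgrad h x) = indicator (frontier \<Omega>) x * (f x *\<^sub>R b \<bullet> n' x)"
      using AE_chart_normal[OF c] n'(2) AE_frontier by eventually_elim (use fU in fastforce)
  qed (auto simp: graph_normal_def)
  finally show ?thesis by (simp add: flux_formula_def)
qed

lemma flux_formula_add:
  assumes n': "n' \<in> borel_measurable borel" "AE x in \<sigma>. n' x = n x"
    and V: "closure \<Omega> \<subseteq> V" "Ck_on 1 V f" "Ck_on 1 V g"
    and "flux_formula n' b f" "flux_formula n' b g"
  shows "flux_formula n' b (\<lambda>x. f x + g x)"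
proof -
  note cont = continuous_on_subset[OF Ck_on_1D(3) V(1)] continuous_on_subset[OF Ck_on_1D(4) V(1)]
  have "(LINT x|lborel. indicator \<Omega> x * Df (\<lambda>x. f x + g x) x b)
      = (LINT x|lborel. indicator \<Omega> x * Df f x b + indicator \<Omega> x * Df g x b)"
    using Df_add[OF Ck_on_1D(1)[OF V(2)] Ck_on_1D(1)[OF V(3)]] V(1) dom_subset
    by (intro Bochner_Integration.integral_cong refl) (auto simp: indicator_def)
  also have "\<dots> = (LINT x|lborel. indicator \<Omega> x * Df f x b) + (LINT x|lborel. indicator \<Omega> x * Df g x b)"
    by (intro Bochner_Integration.integral_add integrable_dom cont V)
  also have "\<dots> = (LINT x|\<sigma>. indicator (frontier \<Omega>) x * (f x *\<^sub>R b \<bullet> n' x))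
      + (LINT x|\<sigma>. indicator (frontier \<Omega>) x * (g x *\<^sub>R b \<bullet> n' x))"
    using assms(6,7) by (simp add: flux_formula_def)
  also have "\<dots> = (LINT x|\<sigma>. indicator (frontier \<Omega>) x * (f x *\<^sub>R b \<bullet> n' x)
      + indicator (frontier \<Omega>) x * (g x *\<^sub>R b \<bullet> n' x))"
    by (intro Bochner_Integration.integral_add[symmetric] integrable_frontier n' continuous_intros cont V)
  also have "\<dots> = (LINT x|\<sigma>. indicator (frontier \<Omega>) x * ((f x + g x) *\<^sub>R b \<bullet> n' x))"
    by (simp add: algebra_simps)
  finally show ?thesis by (simp add: flux_formula_def)
qed

text \<open>Each step of the induction splits off the part of \<open>f\<close> near one ball by a
  bump function. The remainder vanishes on the half ball too, so the open set \<open>W\<close> of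
  known zeros grows until it contains the closure and the formula is trivial.\<close>

lemma flux_formula_cover:
  assumes n': "n' \<in> borel_measurable borel" "AE x in \<sigma>. n' x = n x"
    and V: "open V" "closure \<Omega> \<subseteq> V" and "finite I"
    and I: "\<And>z r. (z, r) \<in> I \<Longrightarrow> r > 0 \<and> cball z r \<subseteq> V \<and>
      (cball z r \<subseteq> \<Omega> \<or> (\<exists>e h U. local_graph \<Omega> e h U \<and> cball z r \<subseteq> U))"
    and W: "open W" "closure \<Omega> \<subseteq> W \<union> (\<Union>(z, r)\<in>I. ball z (r / 2))"
    and f: "Ck_on 1 V f" "\<And>x. x \<in> V \<inter> W \<Longrightarrow> f x = 0"
  shows "flux_formula n' b f"
  using \<open>finite I\<close> I W f
proof (induction I arbitrary: W f)
  case empty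
  show ?case by (rule flux_formula_zero[of "V \<inter> W"]) (use empty V in auto)
next
  case (insert j I)
  obtain z r where j: "j = (z, r)" by (cases j)
  have zr: "r > 0" "cball z r \<subseteq> V" "cball z r \<subseteq> \<Omega> \<or> (\<exists>e h U. local_graph \<Omega> e h U \<and> cball z r \<subseteq> U)"
    using insert.prems(1)[of z r] j by auto
  obtain \<psi> :: "'a \<Rightarrow> real" where \<psi>: "Ck_on 1 UNIV \<psi>" "\<And>x. x \<in> ball z (r / 2) \<Longrightarrow> \<psi> x = 1"
    "\<And>x. x \<notin> cball z r \<Longrightarrow> \<psi> x = 0" using C1_bump[OF zr(1)] by metis
  have \<psi>V: "Ck_on 1 V \<psi>" using Ck_on_subset[OF \<psi>(1)] by auto
  let ?f1 = "\<lambda>x. \<psi> x * f x" and ?f2 = "\<lambda>x. (1 - \<psi> x) * f x"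
  have f1: "Ck_on 1 V ?f1" "Ck_on 1 V ?f2"
    by (intro Ck_on_1_mult Ck_on_1_diff Ck_on_1_const \<psi>V insert.prems)+
  have f1U: "Ck_on 1 UNIV ?f1"
    by (rule Ck_on_1_extend_zero[OF V(1) insert.prems(4) \<psi>(1) closed_cball zr(2) \<psi>(3)])
  have z1: "?f1 x = 0" if "x \<notin> cball z r" for x using \<psi>(3)[OF that] by simp
  have P1: "flux_formula n' b ?f1"
    using zr(3) flux_formula_interior[OF f1U z1] flux_formula_chart[OF n' _ f1U z1] by blast
  have P2: "flux_formula n' b ?f2"
  proof (rule insert.IH)
    show "open (W \<union> ball z (r / 2))" using insert.prems by auto
    show "closure \<Omega> \<subseteq> (W \<union> ball z (r / 2)) \<union> (\<Union>(z, r)\<in>I. ball z (r / 2))"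
      using insert.prems(3) j by auto
    show "?f2 x = 0" if "x \<in> V \<inter> (W \<union> ball z (r / 2))" for x
      using that insert.prems(5)[of x] \<psi>(2)[of x] by auto
  qed (use insert.prems(1) f1 in auto)
  have "flux_formula n' b (\<lambda>x. ?f1 x + ?f2 x)" by (rule flux_formula_add[OF n' V(2) f1 P1 P2])
  then show ?case by (simp add: algebra_simps)
qed

lemma flux_formula_C1:
  assumes n': "n' \<in> borel_measurable borel" "AE x in \<sigma>. n' x = n x"
    and V: "open V" "closure \<Omega> \<subseteq> V" and f: "Ck_on 1 V f"
  shows "flux_formula n' b f"
proof -
  define \<A> where "\<A> = {(z, r). r > 0 \<and> cball z r \<subseteq> V \<and>
      (cball z r \<subseteq> \<Omega> \<or> (\<exists>e h U. local_graph \<Omega> e h U \<and> cball z r \<subseteq> U))}"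
  \<comment> \<open>The cover uses half radii, because a bump function equals one only on the half
    ball.\<close>
  have "closure \<Omega> \<subseteq> (\<Union>T\<in>\<A>. ball (fst T) (snd T / 2))"
  proof
    fix x assume x: "x \<in> closure \<Omega>"
    have "\<exists>r. (x, r) \<in> \<A>"
    proof (cases "x \<in> \<Omega>")
      case True
      then obtain r where "r > 0" "cball x r \<subseteq> V \<inter> \<Omega>"
        using open_contains_cball[of "V \<inter> \<Omega>"] V open_dom x by blast
      then show ?thesis by (auto simp: \<A>_def)
    next
      case False
      then have "x \<in> frontier \<Omega>" using x open_dom by (simp add: frontier_def interior_open)
      then obtain e h U where c: "local_graph \<Omega> e h U" "x \<in> U"
        using dom unfolding lipschitz_domain_def by blast
      then obtain r where "r > 0" "cball x r \<subseteq> V \<inter> U"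
        using open_contains_cball[of "V \<inter> U"] V local_graphD(4)[OF c(1)] x by blast
      then show ?thesis using c(1) by (auto simp: \<A>_def)
    qed
    then obtain r where "(x, r) \<in> \<A>" by blast
    then show "x \<in> (\<Union>T\<in>\<A>. ball (fst T) (snd T / 2))"
      by (intro UN_I[of "(x, r)"]) (auto simp: \<A>_def)
  qed
  then obtain I where I: "I \<subseteq> \<A>" "finite I" "closure \<Omega> \<subseteq> (\<Union>T\<in>I. ball (fst T) (snd T / 2))"
    by (rule compactE_image[OF compact_closure_dom, rotated]) auto
  have 1: "r > 0 \<and> cball z r \<subseteq> V \<and>
      (cball z r \<subseteq> \<Omega> \<or> (\<exists>e h U. local_graph \<Omega> e h U \<and> cball z r \<subseteq> U))" if "(z, r) \<in> I" for z r
    using subsetD[OF I(1) that] unfolding \<A>_def by (simp only: mem_Collect_eq case_prod_conv)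
  have 2: "closure \<Omega> \<subseteq> {} \<union> (\<Union>(z, r)\<in>I. ball z (r / 2))"
    using I(3) by (simp only: case_prod_beta' Un_empty_left)
  show ?thesis by (rule flux_formula_cover[OF n' V I(2) 1 open_empty 2 f]) simp_all
qed

theorem divergence_theorem:
  assumes n': "n' \<in> borel_measurable borel" "AE x in \<sigma>. n' x = n x"
    and V: "open V" "closure \<Omega> \<subseteq> V" and F: "Ck_on 1 V F"
  shows "(LINT x|lborel. indicator \<Omega> x * divg F x) = (LINT x|\<sigma>. indicator (frontier \<Omega>) x * (F x \<bullet> n' x))"
proof -
  have c: "Ck_on 1 V (\<lambda>x. F x \<bullet> b)" for b
    by (rule Ck_on_1_compose_linear[OF bounded_linear_inner_left F])
  note cont = continuous_on_subset[OF Ck_on_1D(3) V(2)] continuous_on_subset[OF Ck_on_1D(4) V(2)]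
  have "(LINT x|lborel. indicator \<Omega> x * divg F x) = (LINT x|lborel. (\<Sum>b\<in>Basis. indicator \<Omega> x * Df (\<lambda>x. F x \<bullet> b) x b))"
  proof (rule Bochner_Integration.integral_cong[OF refl])
    fix x
    show "indicator \<Omega> x * divg F x = (\<Sum>b\<in>Basis. indicator \<Omega> x * Df (\<lambda>x. F x \<bullet> b) x b)"
    proof (cases "x \<in> \<Omega>")
      case True
      then have "F differentiable (at x)" using Ck_on_1D(1)[OF F] V(2) dom_subset by blast
      then show ?thesis
        using True by (simp add: divg_def Df_linear_compose[OF bounded_linear_inner_left])
    qed simp
  qed
  also have "\<dots> = (\<Sum>b\<in>Basis. LINT x|lborel. indicator \<Omega> x * Df (\<lambda>x. F x \<bullet> b) x b)"
    by (intro Bochner_Integration.integral_sum integrable_dom cont c)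
  also have "\<dots> = (\<Sum>b\<in>Basis. LINT x|\<sigma>. indicator (frontier \<Omega>) x * ((F x \<bullet> b) *\<^sub>R b \<bullet> n' x))"
    using flux_formula_C1[OF n' V c] unfolding flux_formula_def by simp
  also have "\<dots> = (LINT x|\<sigma>. (\<Sum>b\<in>Basis. indicator (frontier \<Omega>) x * ((F x \<bullet> b) *\<^sub>R b \<bullet> n' x)))"
    by (intro Bochner_Integration.integral_sum[symmetric] integrable_frontier n' continuous_intros cont F)
  also have "\<dots> = (LINT x|\<sigma>. indicator (frontier \<Omega>) x * (F x \<bullet> n' x))"
    by (simp add: sum_distrib_left[symmetric] inner_sum_left[symmetric] euclidean_representation del: inner_scaleR_left)
  finally show ?thesis .
qed

end

section \<open>Energy estimate\<close>

lemma L2_norm_squared: "(L2_norm M f)\<^sup>2 = (LINT x|M. (norm (f x))\<^sup>2)"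
  unfolding L2_norm_def by (intro real_sqrt_pow2 Bochner_Integration.integral_nonneg) simp

lemma Ck_on_1_slice:
  fixes f :: "real \<Rightarrow> 'a::euclidean_space \<Rightarrow> 'b::real_normed_vector"
  assumes "Ck_on 1 G (case_prod f)" shows "Ck_on 1 {x. (t, x) \<in> G} (f t)"
proof (rule Ck_on_1I[where f'="\<lambda>x v. Df (case_prod f) (t, x) (0, v)"])
  fix x assume "x \<in> {x. (t, x) \<in> G}"
  then have d: "case_prod f differentiable (at (t, x))" using Ck_on_1D(1)[OF assms] by simp
  show "(f t has_derivative (\<lambda>v. Df (case_prod f) (t, x) (0, v))) (at x)"
    using has_derivative_Df[OF differentiable_slice[OF d]] unfolding Df_slice[OF d] by simp
next
  fix v
  show "continuous_on {x. (t, x) \<in> G} (\<lambda>x. Df (case_prod f) (t, x) (0, v))"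
    by (rule continuous_on_compose2[OF Ck_on_1D(3)[OF assms]]) (auto intro!: continuous_intros)
qed

lemma open_slice:
  fixes G :: "('a::topological_space \<times> 'b::topological_space) set"
  assumes "open G" shows "open {x. (t, x) \<in> G}"
proof -
  have "open (Pair t -` G)" by (intro open_vimage assms continuous_intros)
  then show ?thesis by (simp add: vimage_def)
qed

lemma continuous_slice:
  assumes "continuous_on G (case_prod f)" shows "continuous_on {x. (t, x) \<in> G} (f t)"
proof -
  have "continuous_on {x. (t, x) \<in> G} (\<lambda>x. case_prod f (t, x))"
    by (rule continuous_on_compose2[OF assms]) (auto intro!: continuous_intros)
  then show ?thesis by simp
qed

context lipschitz_boundary
begin

text \<open>The norms of the claim refer to the completed measure. Continuity on
  \<open>\<Omega>\<close> allows a passage to \<open>lborel\<close>, where translation and Fubini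
  arguments take place.\<close>

lemma L2_norm_dom:
  fixes f :: "'a \<Rightarrow> 'b::real_normed_vector"
  assumes "continuous_on \<Omega> f"
  shows "(L2_norm (lebesgue_on \<Omega>) f)\<^sup>2 = (LINT x|lborel. indicator \<Omega> x * (norm (f x))\<^sup>2)"
proof -
  have "continuous_on \<Omega> (\<lambda>x. (norm (f x))\<^sup>2)" by (intro continuous_intros assms)
  then have m: "(\<lambda>x. indicator \<Omega> x * (norm (f x))\<^sup>2) \<in> borel_measurable lborel"
    using borel_measurable_continuous_on_indicator[OF dom_borel] by fastforce
  have "(L2_norm (lebesgue_on \<Omega>) f)\<^sup>2 = (LINT x|lebesgue. indicator \<Omega> x *\<^sub>R (norm (f x))\<^sup>2)"
    unfolding L2_norm_squared by (rule integral_restrict_space) (simp add: dom_borel)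
  also have "\<dots> = (LINT x|lborel. indicator \<Omega> x * (norm (f x))\<^sup>2)"
    using integral_completion[OF m] by simp
  finally show ?thesis .
qed

lemma AE_lebesgue_on_dom: "(AE x in lebesgue_on \<Omega>. P x) \<longleftrightarrow> (AE x in lborel. x \<in> \<Omega> \<longrightarrow> P x)"
  by (subst AE_restrict_space_iff) (auto simp: dom_borel AE_completion_iff)

lemma integrable_cylinder:
  fixes f :: "real \<Rightarrow> 'a \<Rightarrow> real"
  assumes "continuous_on ({0..\<tau>} \<times> closure \<Omega>) (case_prod f)" "t \<le> \<tau>"
  shows "integrable (lborel \<Otimes>\<^sub>M lborel) (\<lambda>(s, x). indicator {0..t} s * (indicator \<Omega> x * f s x))"
proof -
  have sub: "{0..t} \<times> \<Omega> \<subseteq> {0..\<tau>} \<times> closure \<Omega>" using assms(2) dom_subset by auto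
  have "bounded (case_prod f ` ({0..\<tau>} \<times> closure \<Omega>))"
    using compact_continuous_image[OF assms(1) compact_Times[OF compact_Icc compact_closure_dom]]
      compact_imp_bounded by blast
  then obtain B where B: "\<And>y. y \<in> case_prod f ` ({0..\<tau>} \<times> closure \<Omega>) \<Longrightarrow> norm y \<le> B"
    unfolding bounded_iff by blast
  have B': "\<bar>f s x\<bar> \<le> \<bar>B\<bar>" if "s \<in> {0..t}" "x \<in> \<Omega>" for s x
    using B[of "f s x"] sub that by (force simp: image_iff)
  have S: "{0..t} \<times> \<Omega> \<in> sets (borel :: (real \<times> 'a) measure)"
    unfolding borel_prod[symmetric] by (intro pair_measureI) auto
  have eq: "(\<lambda>(s, x). indicator {0..t} s * (indicator \<Omega> x * f s x))
      = (\<lambda>z. indicator ({0..t} \<times> \<Omega>) z *\<^sub>R case_prod f z)"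
    by (auto simp: fun_eq_iff indicator_def)
  show ?thesis
    unfolding eq
  proof (rule Bochner_Integration.integrable_bound)
    have "bounded ({0..t} \<times> \<Omega>)" using bounded_dom by (intro bounded_Times) auto
    from emeasure_bounded_finite[OF this] S
    show "integrable (lborel \<Otimes>\<^sub>M lborel) (\<lambda>z::real \<times> 'a. \<bar>B\<bar> * indicator ({0..t} \<times> \<Omega>) z)"
      unfolding lborel_prod by (intro integrable_mult_right integrable_real_indicator) auto
    show "(\<lambda>z. indicator ({0..t} \<times> \<Omega>) z *\<^sub>R case_prod f z) \<in> borel_measurable (lborel \<Otimes>\<^sub>M lborel)"
      unfolding lborel_prod
      using borel_measurable_continuous_on_indicator[OF S continuous_on_subset[OF assms(1) sub]] by simp
    show "AE z in lborel \<Otimes>\<^sub>M lborel. norm (indicator ({0..t} \<times> \<Omega>) z *\<^sub>R case_prod f z)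
        \<le> norm (\<bar>B\<bar> * indicator ({0..t} \<times> \<Omega>) z)"
      using B' by (intro AE_I2) (auto simp: indicator_def)
  qed
qed

text \<open>The weight \<open>exp (- \<nu> s)\<close> is put under the integral, so that Fubini's theorem replaces both
  differentiation under the integral and Gronwall's inequality.\<close>

lemma integral_growth:
  fixes e :: "real \<Rightarrow> 'a \<Rightarrow> real"
  assumes G: "{0..\<tau>} \<times> closure \<Omega> \<subseteq> G" "Ck_on 1 G (case_prod e)"
    and t: "0 < t" "t < \<tau>" and \<nu>: "\<nu> \<ge> 0"
    and S: "integrable lborel (\<lambda>s. indicator {0..t} s * S s)" "\<And>s. S s \<ge> 0"
    and D: "\<And>s. 0 < s \<Longrightarrow> s \<le> t \<Longrightarrow> (LINT x|lborel. indicator \<Omega> x * (dt e s x - \<nu> * e s x)) \<le> S s"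
  shows "(LINT x|lborel. indicator \<Omega> x * e t x)
    \<le> exp (\<nu> * t) * ((LINT x|lborel. indicator \<Omega> x * e 0 x) + (LINT s|lborel. indicator {0..t} s * S s))"
proof -
  define F where "F s x = exp (- (\<nu> * s)) * (dt e s x - \<nu> * e s x)" for s x
  let ?Q = "{0..\<tau>} \<times> closure \<Omega>"
  have dt_eq: "dt e s x = Df (case_prod e) (s, x) (1, 0)" if "(s, x) \<in> ?Q" for s x
    using dt_slice[OF Ck_on_1D(1)[OF G(2)]] that G(1) by blast
  have "continuous_on ?Q (\<lambda>z. exp (- (\<nu> * fst z)) * (Df (case_prod e) z (1, 0) - \<nu> * case_prod e z))"
    by (intro continuous_intros continuous_on_subset[OF Ck_on_1D(3)[OF G(2)] G(1)]
        continuous_on_subset[OF Ck_on_1D(4)[OF G(2)] G(1)])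
  then have cF: "continuous_on ?Q (case_prod F)"
    by (rule continuous_on_eq) (auto simp: F_def dt_eq)
  have ce: "continuous_on (closure \<Omega>) (e s)" if "0 \<le> s" "s \<le> \<tau>" for s
    by (rule continuous_on_subset[OF Ck_on_1D(4)[OF Ck_on_1_slice[OF G(2)], of s]]) (use G(1) that in auto)
  have ftc: "(LINT s|lborel. indicator {0..t} s * F s x) = exp (- (\<nu> * t)) * e t x - e 0 x" if x: "x \<in> \<Omega>" for x
  proof -
    have "(LINT s|lborel. indicator {0..t} s *\<^sub>R F s x) = exp (- (\<nu> * t)) * e t x - exp (- (\<nu> * 0)) * e 0 x"
    proof (rule integral_FTC_atLeastAtMost)
      show "0 \<le> t" using t by simp
      have "continuous_on {0..t} (\<lambda>s. case_prod F (s, x))"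
        by (rule continuous_on_compose2[OF cF]) (use t x dom_subset in \<open>auto intro!: continuous_intros\<close>)
      then show "continuous_on {0..t} (\<lambda>s. F s x)" by simp
      fix s assume s: "0 \<le> s" "s \<le> t"
      then have "(s, x) \<in> G" using t x G(1) dom_subset by auto
      then have "((\<lambda>s. e s x) has_real_derivative dt e s x) (at s)"
        using has_vector_derivative_slice[OF Ck_on_1D(1)[OF G(2)]] by (simp add: has_real_derivative_iff_has_vector_derivative)
      then have "((\<lambda>s. exp (- (\<nu> * s)) * e s x) has_real_derivative F s x) (at s)"
        by (auto intro!: derivative_eq_intros simp: F_def algebra_simps)
      then show "((\<lambda>s. exp (- (\<nu> * s)) * e s x) has_vector_derivative F s x) (at s within {0..t})"
        by (simp add: has_real_derivative_iff_has_vector_derivative has_vector_derivative_at_within)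
    qed
    then show ?thesis by simp
  qed
  have int: "integrable (lborel \<Otimes>\<^sub>M lborel) (\<lambda>(s, x). indicator {0..t} s * (indicator \<Omega> x * F s x))"
    by (rule integrable_cylinder[OF cF]) (use t in simp)
  have "exp (- (\<nu> * t)) * (LINT x|lborel. indicator \<Omega> x * e t x) - (LINT x|lborel. indicator \<Omega> x * e 0 x)
    = (LINT x|lborel. exp (- (\<nu> * t)) * (indicator \<Omega> x * e t x)) - (LINT x|lborel. indicator \<Omega> x * e 0 x)"
    by simp
  also have "\<dots> = (LINT x|lborel. exp (- (\<nu> * t)) * (indicator \<Omega> x * e t x) - indicator \<Omega> x * e 0 x)"
    by (intro Bochner_Integration.integral_diff[symmetric] integrable_mult_right integrable_dom ce) (use t in auto)
  also have "\<dots> = (LINT x|lborel. LINT s|lborel. indicator {0..t} s * (indicator \<Omega> x * F s x))"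
  proof (rule Bochner_Integration.integral_cong[OF refl])
    fix x
    have "(LINT s|lborel. indicator {0..t} s * (indicator \<Omega> x * F s x))
        = indicator \<Omega> x * (LINT s|lborel. indicator {0..t} s * F s x)"
      by (simp add: mult.left_commute)
    then show "exp (- (\<nu> * t)) * (indicator \<Omega> x * e t x) - indicator \<Omega> x * e 0 x
        = (LINT s|lborel. indicator {0..t} s * (indicator \<Omega> x * F s x))"
      using ftc[of x] by (cases "x \<in> \<Omega>") auto
  qed
  also have "\<dots> = (LINT s|lborel. LINT x|lborel. indicator {0..t} s * (indicator \<Omega> x * F s x))"
    by (rule lborel_pair.Fubini_integral[OF int])
  also have "\<dots> \<le> (LINT s|lborel. indicator {0..t} s * S s)"
  proof (rule integral_mono_AE[OF _ S(1)])
    show "integrable lborel (\<lambda>s. LINT x|lborel. indicator {0..t} s * (indicator \<Omega> x * F s x))"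
      using lborel_pair.integrable_fst'[OF int] by simp
    \<comment> \<open>The differential inequality is available for positive times only; the initial
      time is a null set.\<close>
    have "AE s in lborel. s \<noteq> (0::real)" by (rule AE_lborel_singleton)
    then show "AE s in lborel. (LINT x|lborel. indicator {0..t} s * (indicator \<Omega> x * F s x)) \<le> indicator {0..t} s * S s"
    proof eventually_elim
      case (elim s)
      show ?case
      proof (cases "s \<in> {0..t}")
        case True
        have "(LINT x|lborel. indicator {0..t} s * (indicator \<Omega> x * F s x))
          = exp (- (\<nu> * s)) * (LINT x|lborel. indicator \<Omega> x * (dt e s x - \<nu> * e s x))"
          using True by (simp add: F_def mult.left_commute[of "indicator _ _"])
        also have "\<dots> \<le> exp (- (\<nu> * s)) * S s" using D[of s] True elim by (intro mult_left_mono) auto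
        \<comment> \<open>The weight is at most 1 for nonnegative times, and the source is
          nonnegative.\<close>
        also have "\<dots> \<le> 1 * S s" using \<nu> True S(2) by (intro mult_right_mono) auto
        finally show ?thesis using True by simp
      qed simp
    qed
  qed
  finally have "exp (- (\<nu> * t)) * (LINT x|lborel. indicator \<Omega> x * e t x)
    \<le> (LINT x|lborel. indicator \<Omega> x * e 0 x) + (LINT s|lborel. indicator {0..t} s * S s)" by simp
  then have "exp (\<nu> * t) * (exp (- (\<nu> * t)) * (LINT x|lborel. indicator \<Omega> x * e t x))
    \<le> exp (\<nu> * t) * ((LINT x|lborel. indicator \<Omega> x * e 0 x) + (LINT s|lborel. indicator {0..t} s * S s))"
    by (intro mult_left_mono) auto
  then show ?thesis by (simp add: mult.assoc[symmetric] exp_add[symmetric])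
qed

end

text \<open>The background flow is represented by the numbers \<open>r\<^sub>0\<close>,
  \<open>r\<^sub>1\<close>, \<open>c\<^sub>1\<close>, \<open>M\<^sub>1\<close>,
  \<open>M\<^sub>2\<close>, so that the constants derived below visibly do not depend on
  \<open>w\<close>. The differential equations and the impedance condition are available for
  \<open>0 < t < \<tau>\<close>, the bounds and tangentiality also at the end points.\<close>

locale galbrun_problem = lipschitz_boundary \<Omega> \<sigma> n + galbrun_fields G u w \<rho> c "1 / \<tau>\<^sub>0\<^sup>2"
  for \<Omega> :: "'a::euclidean_space set" and \<sigma> :: "'a measure" and n :: "'a \<Rightarrow> 'a"
    and G :: "(real \<times> 'a) set" and u w :: "real \<Rightarrow> 'a \<Rightarrow> 'a" and \<rho> c :: "real \<Rightarrow> 'a \<Rightarrow> real"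
    and \<tau>\<^sub>0 :: real +
  fixes Y :: "'a \<Rightarrow> real" and a \<tau> :: real and p :: "real \<Rightarrow> 'a \<Rightarrow> real" and \<phi> :: "real \<Rightarrow> 'a \<Rightarrow> 'a"
    and g :: "real \<Rightarrow> 'a \<Rightarrow> real" and r\<^sub>0 r\<^sub>1 c\<^sub>1 M\<^sub>1 M\<^sub>2 :: real
  assumes Q: "{0..\<tau>} \<times> closure \<Omega> \<subseteq> G" and pos: "\<tau>\<^sub>0 > 0" "a > 0" "r\<^sub>0 > 0" "r\<^sub>1 \<ge> 0" "c\<^sub>1 \<ge> 0" "M\<^sub>1 \<ge> 0" "M\<^sub>2 \<ge> 0"
    and Y: "\<And>x. x \<in> frontier \<Omega> \<Longrightarrow> Y x \<ge> a" and Y_bounded: "\<exists>B. \<forall>x\<in>frontier \<Omega>. norm (Y x) \<le> B"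
    and rho_bounds: "\<And>t x. t \<in> {0..\<tau>} \<Longrightarrow> x \<in> closure \<Omega> \<Longrightarrow> r\<^sub>0 \<le> \<rho> t x \<and> \<rho> t x \<le> r\<^sub>1"
    and c_bound: "\<And>t x. t \<in> {0..\<tau>} \<Longrightarrow> x \<in> closure \<Omega> \<Longrightarrow> c t x \<le> c\<^sub>1"
    and u_bound: "\<And>t. t \<in> {0..\<tau>} \<Longrightarrow> AE x in lborel. x \<in> \<Omega> \<longrightarrow> (\<forall>h. norm (Df (u t) x h) \<le> M\<^sub>1 * norm h)"
    and c_rate: "\<And>t. t \<in> {0..\<tau>} \<Longrightarrow> AE x in lborel. x \<in> \<Omega> \<longrightarrow> \<bar>material u c t x / c t x\<bar> \<le> M\<^sub>2"
    and continuity: "\<And>t x. t \<in> {0<..<\<tau>} \<Longrightarrow> x \<in> \<Omega> \<Longrightarrow> material u \<rho> t x + \<rho> t x * divg (u t) x = 0"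
    and pressure: "\<And>t x. t \<in> {0<..<\<tau>} \<Longrightarrow> x \<in> \<Omega> \<Longrightarrow> p t differentiable (at x)"
      "\<And>t x b. t \<in> {0<..<\<tau>} \<Longrightarrow> x \<in> \<Omega> \<Longrightarrow> Df (p t) x b = (c t x)\<^sup>2 * Df (\<rho> t) x b"
    and galbrun: "\<And>t x. t \<in> {0<..<\<tau>} \<Longrightarrow> x \<in> \<Omega> \<Longrightarrow>
      \<rho> t x *\<^sub>R material u v t x - grad (\<lambda>y. (c t y)\<^sup>2 * m t y) x
        + \<rho> t x *\<^sub>R Df (u t) x (v t x) + m t x *\<^sub>R ((1 / \<rho> t x) *\<^sub>R grad (p t) x) = \<rho> t x *\<^sub>R \<phi> t x"
    and tangential: "\<And>t. t \<in> {0..\<tau>} \<Longrightarrow> AE x in \<sigma>. n x \<bullet> u t x = 0"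
    and impedance: "\<And>t. t \<in> {0<..<\<tau>} \<Longrightarrow> AE x in \<sigma>. - (Y x * \<pi> t x) - n x \<bullet> v t x = g t x"
    and phi_cont: "continuous_on ({0..\<tau>} \<times> closure \<Omega>) (case_prod \<phi>)"
    and g_meas: "(\<lambda>(t, x). g t x) \<in> borel_measurable (restrict_space lborel {0<..<\<tau>} \<Otimes>\<^sub>M \<sigma>)"
    and g_int: "integrable (restrict_space lborel {0<..<\<tau>} \<Otimes>\<^sub>M \<sigma>) (\<lambda>(t, x). (g t x)\<^sup>2)"
begin

lemma closure_slice: "t \<in> {0..\<tau>} \<Longrightarrow> closure \<Omega> \<subseteq> {x. (t, x) \<in> G}"
  using Q by auto

lemma continuous_dom:
  assumes "Ck_on 1 G (case_prod f)" "t \<in> {0..\<tau>}" shows "continuous_on (closure \<Omega>) (f t)"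
  using continuous_on_subset[OF continuous_slice[OF Ck_on_1D(4)[OF assms(1)]] closure_slice[OF assms(2)]] .

lemma phi_cont_slice: "t \<in> {0..\<tau>} \<Longrightarrow> continuous_on (closure \<Omega>) (\<phi> t)"
  using continuous_on_subset[OF continuous_slice[OF phi_cont, of t]] by auto

lemma g_measurable: "t \<in> {0<..<\<tau>} \<Longrightarrow> g t \<in> borel_measurable \<sigma>"
  using measurable_compose[OF measurable_Pair1'[of t "restrict_space lborel {0<..<\<tau>}" \<sigma>] g_meas]
  by (simp add: space_restrict_space)

definition flux where "flux t x = energy t x *\<^sub>R u t x - ((c t x)\<^sup>2 * m t x) *\<^sub>R v t x"

lemma flux1: "Ck_on 1 G (case_prod flux)"
proof -
  have "Ck_on 1 G (\<lambda>z. case_prod energy z *\<^sub>R case_prod u z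
      - (case_prod c z * case_prod c z * case_prod m z) *\<^sub>R case_prod v z)"
    by (intro Ck_on_1_diff Ck_on_1_scaleR Ck_on_1_mult energy1 u1 c1 m1 v1)
  then show ?thesis by (simp only: flux_def case_prod_beta' power2_eq_square)
qed

text \<open>Integrability over the space-time boundary yields this only for almost every time. At a
  fixed time the boundary condition bounds \<open>g t\<close> by the bounded values of
  \<open>Y\<close>, \<open>\<pi>\<close> and \<open>v\<close>, and the surface measure is
  finite.\<close>

lemma g_square_integrable:
  assumes "t \<in> {0<..<\<tau>}" shows "integrable \<sigma> (\<lambda>x. (g t x)\<^sup>2)"
proof -
  interpret finite_measure \<sigma> by (rule finite_measure_surf)
  note t = assms
  have [measurable]: "g t \<in> borel_measurable \<sigma>" by (rule g_measurable[OF t])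
  have tt: "t \<in> {0..\<tau>}" using t by auto
  obtain B1 where B1: "B1 \<ge> 0" "\<forall>x\<in>closure \<Omega>. norm (\<pi> t x) \<le> B1"
    using continuous_bounded_dom[OF continuous_dom[OF pi1 tt]] by blast
  obtain B2 where B2: "B2 \<ge> 0" "\<forall>x\<in>closure \<Omega>. norm (v t x) \<le> B2"
    using continuous_bounded_dom[OF continuous_dom[OF v1 tt]] by blast
  obtain B3 where B3: "\<forall>x\<in>frontier \<Omega>. norm (Y x) \<le> B3"
    using Y_bounded by blast
  show ?thesis
  proof (rule integrable_const_bound[where B="(B3 * B1 + B2)\<^sup>2"])
    show "AE x in \<sigma>. norm ((g t x)\<^sup>2) \<le> (B3 * B1 + B2)\<^sup>2"
      using impedance[OF t] norm_normal AE_frontier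
    proof eventually_elim
      case (elim x)
      have x: "x \<in> closure \<Omega>" using elim(3) frontier_subset by auto
      have "\<bar>n x \<bullet> v t x\<bar> \<le> B2"
        using Cauchy_Schwarz_ineq2[of "n x" "v t x"] elim(2) B2(2) x by force
      moreover have "\<bar>Y x * \<pi> t x\<bar> \<le> B3 * B1"
        unfolding abs_mult using B3 B1 elim(3) x by (intro mult_mono) auto
      ultimately have "\<bar>g t x\<bar> \<le> B3 * B1 + B2" using elim(1) by linarith
      then show ?case by (simp add: abs_le_square_iff[symmetric])
    qed
  qed measurable
qed

lemma boundary_dissipation:
  assumes "t \<in> {0<..<\<tau>}"
  shows "(LINT x|lborel. indicator \<Omega> x * divg (flux t) x) \<ge> - (r\<^sub>1 * c\<^sub>1 / (4 * a)) * (L2_norm \<sigma> (g t))\<^sup>2"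
proof -
  have t: "t \<in> {0..\<tau>}" using assms by auto
  obtain n' where n': "n' \<in> borel_measurable borel" "AE x in \<sigma>. n' x = n x" using normal_borel by blast
  let ?K = "r\<^sub>1 * c\<^sub>1 / (4 * a)"
  have "(LINT x|lborel. indicator \<Omega> x * divg (flux t) x) = (LINT x|\<sigma>. indicator (frontier \<Omega>) x * (flux t x \<bullet> n' x))"
    by (rule divergence_theorem[OF n' open_slice[OF open_G] closure_slice[OF t] Ck_on_1_slice[OF flux1]])
  also have "\<dots> \<ge> (LINT x|\<sigma>. - ?K * (g t x)\<^sup>2)"
  proof (rule integral_mono_AE)
    show "integrable \<sigma> (\<lambda>x. - ?K * (g t x)\<^sup>2)"
      by (intro integrable_mult_right g_square_integrable assms)
    show "integrable \<sigma> (\<lambda>x. indicator (frontier \<Omega>) x * (flux t x \<bullet> n' x))"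
      by (rule integrable_frontier[OF continuous_dom[OF flux1 t] n'])
    show "AE x in \<sigma>. - ?K * (g t x)\<^sup>2 \<le> indicator (frontier \<Omega>) x * (flux t x \<bullet> n' x)"
      using n'(2) tangential[OF t] impedance[OF assms] AE_frontier
    proof eventually_elim
      case (elim x)
      have xc: "x \<in> closure \<Omega>" using elim(4) frontier_subset by auto
      then have xG: "(t, x) \<in> G" using Q t by auto
      have r: "0 < \<rho> t x" "\<rho> t x \<le> r\<^sub>1" and c: "0 < c t x" "c t x \<le> c\<^sub>1"
        using rho_pos[OF xG] c_pos[OF xG] rho_bounds[OF t xc] c_bound[OF t xc] by auto
      have Yx: "Y x \<ge> a" "Y x > 0" using Y[OF elim(4)] pos by auto
      have un: "u t x \<bullet> n x = 0" using elim(2) by (simp add: inner_commute)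
      have vn: "v t x \<bullet> n x = - g t x - Y x * \<pi> t x" using elim(3) by (simp add: inner_commute)
      have "flux t x \<bullet> n' x = - ((c t x)\<^sup>2 * m t x) * (v t x \<bullet> n x)"
        using elim(1) un by (simp add: flux_def inner_diff_left)
      also have "(c t x)\<^sup>2 * m t x = \<rho> t x * c t x * \<pi> t x"
        using r by (simp add: \<pi>_def power2_eq_square)
      also have "- (\<rho> t x * c t x * \<pi> t x) * (v t x \<bullet> n x)
          = \<rho> t x * c t x * (\<pi> t x * g t x + Y x * (\<pi> t x)\<^sup>2)"
        unfolding vn by (simp add: algebra_simps power2_eq_square)
      finally have fl: "flux t x \<bullet> n' x = \<rho> t x * c t x * (\<pi> t x * g t x + Y x * (\<pi> t x)\<^sup>2)" .
      \<comment> \<open>Completing the square: expanded and divided by \<open>4 a\<close>, this is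
        the inequality below. Afterwards \<open>a\<close> is enlarged to \<open>Y x\<close>.\<close>
      have "0 \<le> (2 * a * \<pi> t x + g t x)\<^sup>2" by simp
      then have "- ((g t x)\<^sup>2 / (4 * a)) \<le> \<pi> t x * g t x + a * (\<pi> t x)\<^sup>2"
        using pos(2) by (simp add: field_simps power2_eq_square)
      also have "\<dots> \<le> \<pi> t x * g t x + Y x * (\<pi> t x)\<^sup>2"
        using Yx by (intro add_left_mono mult_right_mono) auto
      finally have "\<rho> t x * c t x * - ((g t x)\<^sup>2 / (4 * a)) \<le> flux t x \<bullet> n' x"
        unfolding fl using r c by (intro mult_left_mono) auto
      moreover have "\<rho> t x * c t x * ((g t x)\<^sup>2 / (4 * a)) \<le> r\<^sub>1 * c\<^sub>1 * ((g t x)\<^sup>2 / (4 * a))"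
        using r c pos by (intro mult_right_mono mult_mono) auto
      ultimately show ?case using elim(4) by simp
    qed
  qed
  finally show ?thesis by (simp add: L2_norm_squared)
qed

text \<open>Twice a common bound for the coefficients of \<open>\<pi>\<^sup>2\<close>,
  \<open>|v|\<^sup>2\<close> and \<open>|w|\<^sup>2 / \<tau>\<^sub>0\<^sup>2\<close> in the energy
  production. The bounds \<open>M\<^sub>1\<close> and \<open>M\<^sub>2\<close> come from
  \<open>\<nabla>u\<close> and \<open>D\<^sub>0 c / c\<close>, the term
  \<open>1 / \<tau>\<^sub>0\<close> from Young's inequality for
  \<open>v \<bullet> \<delta>\<phi>\<close> with weight \<open>\<tau>\<^sub>0\<close>, and
  \<open>1 + 1 / \<tau>\<^sub>0\<^sup>2\<close> from splitting the product of \<open>w\<close> and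
  \<open>v\<close>.\<close>

definition rate where "rate = 2 * (M\<^sub>1 + M\<^sub>2) + 1 + 1 / \<tau>\<^sub>0 + 1 / \<tau>\<^sub>0\<^sup>2"

lemma production_bound:
  assumes t: "t \<in> {0<..<\<tau>}" and x: "x \<in> \<Omega>"
    and u: "\<And>h. norm (Df (u t) x h) \<le> M\<^sub>1 * norm h" and c: "\<bar>material u c t x / c t x\<bar> \<le> M\<^sub>2"
  shows "dt energy t x + divg (flux t) x \<le> rate * energy t x + r\<^sub>1 * \<tau>\<^sub>0 / 2 * (norm (\<phi> t x))\<^sup>2"
proof -
  have tt: "t \<in> {0..\<tau>}" and xc: "x \<in> closure \<Omega>" using t x dom_subset by auto
  have xG: "(t, x) \<in> G" using Q tt xc by auto
  have r: "0 < \<rho> t x" "\<rho> t x \<le> r\<^sub>1" using rho_pos[OF xG] rho_bounds[OF tt xc] by auto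
  let ?P = "\<pi> t x" and ?V = "norm (v t x)" and ?W = "norm (w t x)" and ?F = "norm (\<phi> t x)" and ?k = "1 / \<tau>\<^sub>0\<^sup>2"
  have k: "?k > 0" using pos(1) by simp
  \<comment> \<open>The balance differentiates the continuity equation and thus needs it on an open
    set of space-time.\<close>
  have H: "open ({0<..<\<tau>} \<times> \<Omega>)" "{0<..<\<tau>} \<times> \<Omega> \<subseteq> G" "(t, x) \<in> {0<..<\<tau>} \<times> \<Omega>"
    using Q dom_subset t x by (auto intro!: open_Times open_dom)
  have eq: "dt energy t x + divg (flux t) x = \<rho> t x * (?P\<^sup>2 * (material u c t x / c t x)
      - v t x \<bullet> Df (u t) x (v t x) + v t x \<bullet> \<phi> t x + ?k * (w t x \<bullet> (v t x + Df (u t) x (w t x))))"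
    unfolding flux_def[abs_def]
  proof (rule energy_balance[where p=p, OF H])
    show "material u \<rho> s y + \<rho> s y * divg (u s) y = 0" if "(s, y) \<in> {0<..<\<tau>} \<times> \<Omega>" for s y
      using that by (intro continuity) auto
  qed (rule pressure[OF t x] galbrun[OF t x])+
  have 1: "?P\<^sup>2 * (material u c t x / c t x) \<le> M\<^sub>2 * ?P\<^sup>2"
    unfolding mult.commute[of M\<^sub>2] by (intro mult_left_mono order_trans[OF abs_ge_self c]) simp
  have Du: "\<bar>h \<bullet> Df (u t) x h\<bar> \<le> M\<^sub>1 * (norm h)\<^sup>2" for h
  proof -
    have "\<bar>h \<bullet> Df (u t) x h\<bar> \<le> norm h * norm (Df (u t) x h)" by (rule Cauchy_Schwarz_ineq2)
    also have "\<dots> \<le> norm h * (M\<^sub>1 * norm h)" by (intro mult_left_mono u) simp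
    finally show ?thesis by (simp add: power2_eq_square mult.left_commute)
  qed
  have 2: "- (v t x \<bullet> Df (u t) x (v t x)) \<le> M\<^sub>1 * ?V\<^sup>2" using Du[of "v t x"] by linarith
  have 3: "v t x \<bullet> \<phi> t x \<le> 1 / \<tau>\<^sub>0 / 2 * ?V\<^sup>2 + \<tau>\<^sub>0 / 2 * ?F\<^sup>2"
  proof -
    have "v t x \<bullet> \<phi> t x \<le> ?V * ?F" by (rule norm_cauchy_schwarz)
    also have "0 \<le> (?V - \<tau>\<^sub>0 * ?F)\<^sup>2" by simp
    then have "?V * ?F \<le> 1 / \<tau>\<^sub>0 / 2 * ?V\<^sup>2 + \<tau>\<^sub>0 / 2 * ?F\<^sup>2"
      using pos(1) by (simp add: field_simps power2_eq_square)
    finally show ?thesis .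
  qed
  have 4: "w t x \<bullet> (v t x + Df (u t) x (w t x)) \<le> ?W\<^sup>2 / 2 + ?V\<^sup>2 / 2 + M\<^sub>1 * ?W\<^sup>2"
  proof -
    have "w t x \<bullet> v t x \<le> ?W * ?V" by (rule norm_cauchy_schwarz)
    also have "0 \<le> (?W - ?V)\<^sup>2" by simp
    then have "?W * ?V \<le> ?W\<^sup>2 / 2 + ?V\<^sup>2 / 2" by (simp add: field_simps power2_eq_square)
    finally show ?thesis using Du[of "w t x"] by (simp add: inner_add_right)
  qed
  have 5: "?k * (w t x \<bullet> (v t x + Df (u t) x (w t x))) \<le> ?k * (?W\<^sup>2 / 2 + ?V\<^sup>2 / 2 + M\<^sub>1 * ?W\<^sup>2)"
    using 4 k by (intro mult_left_mono) auto
  have tau: "1 / \<tau>\<^sub>0 > 0" using pos(1) by simp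
  have "?P\<^sup>2 * (material u c t x / c t x) - v t x \<bullet> Df (u t) x (v t x) + v t x \<bullet> \<phi> t x
      + ?k * (w t x \<bullet> (v t x + Df (u t) x (w t x)))
    \<le> M\<^sub>2 * ?P\<^sup>2 + (M\<^sub>1 + 1 / \<tau>\<^sub>0 / 2 + ?k / 2) * ?V\<^sup>2 + (1 / 2 + M\<^sub>1) * (?k * ?W\<^sup>2) + \<tau>\<^sub>0 / 2 * ?F\<^sup>2"
  proof -
    have "M\<^sub>1 * V + (i / 2 * V + F) + K * (W / 2 + V / 2 + M\<^sub>1 * W)
        = (M\<^sub>1 + i / 2 + K / 2) * V + (1 / 2 + M\<^sub>1) * (K * W) + F" for V i F K W :: real
      by (simp add: field_simps)
    from this[of "?V\<^sup>2" "1 / \<tau>\<^sub>0" "\<tau>\<^sub>0 / 2 * ?F\<^sup>2" ?k "?W\<^sup>2"] show ?thesis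
      using 1 2 3 5 by linarith
  qed
  also have "\<dots> \<le> rate / 2 * ?P\<^sup>2 + rate / 2 * ?V\<^sup>2 + rate / 2 * (?k * ?W\<^sup>2) + \<tau>\<^sub>0 / 2 * ?F\<^sup>2"
    using pos k tau by (intro add_mono mult_right_mono order_refl) (auto simp: rate_def field_simps)
  also have "\<dots> = rate / 2 * (?P\<^sup>2 + ?V\<^sup>2 + ?k * ?W\<^sup>2) + \<tau>\<^sub>0 / 2 * ?F\<^sup>2" by (simp add: algebra_simps)
  finally have "dt energy t x + divg (flux t) x \<le> \<rho> t x * (rate / 2 * (?P\<^sup>2 + ?V\<^sup>2 + ?k * ?W\<^sup>2) + \<tau>\<^sub>0 / 2 * ?F\<^sup>2)"
    unfolding eq using r by (intro mult_left_mono) auto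
  also have "\<dots> = rate * energy t x + \<rho> t x * (\<tau>\<^sub>0 / 2 * ?F\<^sup>2)" by (simp add: energy_def algebra_simps)
  also have "\<rho> t x * (\<tau>\<^sub>0 / 2 * ?F\<^sup>2) \<le> r\<^sub>1 * (\<tau>\<^sub>0 / 2 * ?F\<^sup>2)" using r pos(1) by (intro mult_right_mono) auto
  finally show ?thesis by simp
qed

definition source where
  "source s = \<tau>\<^sub>0 * (L2_norm (lebesgue_on \<Omega>) (\<phi> s))\<^sup>2 + c\<^sub>1 / a * (L2_norm \<sigma> (g s))\<^sup>2"

lemma source_nonneg: "source s \<ge> 0"
  using pos by (simp add: source_def)

text \<open>The production bound is integrated over the domain. It holds only almost everywhere
  because the bounds on the flow do; the divergence becomes the boundary term that the impedance
  condition controls.\<close>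

lemma energy_rate:
  assumes t: "t \<in> {0<..<\<tau>}"
  shows "(LINT x|lborel. indicator \<Omega> x * (dt energy t x - rate * energy t x)) \<le> r\<^sub>1 * source t"
proof -
  have tt: "t \<in> {0..\<tau>}" using t by auto
  note ce = continuous_dom[OF energy1 tt]
  have cd: "continuous_on (closure \<Omega>) (\<lambda>x. dt energy t x)"
  proof (rule continuous_on_eq)
    show "continuous_on (closure \<Omega>) (\<lambda>x. Df (case_prod energy) (t, x) (1, 0))"
      by (rule continuous_on_compose2[OF Ck_on_1D(3)[OF energy1]])
        (use closure_slice[OF tt] in \<open>auto intro!: continuous_intros\<close>)
    show "Df (case_prod energy) (t, x) (1, 0) = dt energy t x" if "x \<in> closure \<Omega>" for x
      using dt_slice[OF Ck_on_1D(1)[OF energy1]] closure_slice[OF tt] that by auto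
  qed
  have cdiv: "continuous_on (closure \<Omega>) (divg (flux t))"
    unfolding divg_def[abs_def]
    by (intro continuous_intros continuous_on_subset[OF Ck_on_1D(3)[OF Ck_on_1_slice[OF flux1]] closure_slice[OF tt]])
  have cphi: "continuous_on (closure \<Omega>) (\<lambda>x. r\<^sub>1 * \<tau>\<^sub>0 / 2 * (norm (\<phi> t x))\<^sup>2)"
    by (intro continuous_intros phi_cont_slice tt)
  have "(LINT x|lborel. indicator \<Omega> x * (dt energy t x - rate * energy t x))
    \<le> (LINT x|lborel. indicator \<Omega> x * (r\<^sub>1 * \<tau>\<^sub>0 / 2 * (norm (\<phi> t x))\<^sup>2) - indicator \<Omega> x * divg (flux t) x)"
  proof (rule integral_mono_AE)
    show "integrable lborel (\<lambda>x. indicator \<Omega> x * (dt energy t x - rate * energy t x))"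
      by (intro integrable_dom continuous_intros cd ce)
    show "integrable lborel (\<lambda>x. indicator \<Omega> x * (r\<^sub>1 * \<tau>\<^sub>0 / 2 * (norm (\<phi> t x))\<^sup>2) - indicator \<Omega> x * divg (flux t) x)"
      by (intro Bochner_Integration.integrable_diff integrable_dom cphi cdiv)
    show "AE x in lborel. indicator \<Omega> x * (dt energy t x - rate * energy t x)
      \<le> indicator \<Omega> x * (r\<^sub>1 * \<tau>\<^sub>0 / 2 * (norm (\<phi> t x))\<^sup>2) - indicator \<Omega> x * divg (flux t) x"
      using u_bound[OF tt] c_rate[OF tt]
    proof eventually_elim
      case (elim x)
      then show ?case using production_bound[OF t, of x] by (cases "x \<in> \<Omega>") auto
    qed
  qed
  also have "\<dots> = (LINT x|lborel. indicator \<Omega> x * (r\<^sub>1 * \<tau>\<^sub>0 / 2 * (norm (\<phi> t x))\<^sup>2))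
      - (LINT x|lborel. indicator \<Omega> x * divg (flux t) x)"
    by (intro Bochner_Integration.integral_diff integrable_dom cphi cdiv)
  also have "(LINT x|lborel. indicator \<Omega> x * (r\<^sub>1 * \<tau>\<^sub>0 / 2 * (norm (\<phi> t x))\<^sup>2))
      = r\<^sub>1 * \<tau>\<^sub>0 / 2 * (L2_norm (lebesgue_on \<Omega>) (\<phi> t))\<^sup>2"
    unfolding L2_norm_dom[OF continuous_on_subset[OF phi_cont_slice[OF tt] dom_subset]]
    by (simp add: mult.left_commute[of "indicator _ _"])
  also have "\<dots> - (LINT x|lborel. indicator \<Omega> x * divg (flux t) x)
      \<le> r\<^sub>1 * \<tau>\<^sub>0 / 2 * (L2_norm (lebesgue_on \<Omega>) (\<phi> t))\<^sup>2 + r\<^sub>1 * c\<^sub>1 / (4 * a) * (L2_norm \<sigma> (g t))\<^sup>2"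
    using boundary_dissipation[OF t] by simp
  \<comment> \<open>The factors 1/2 and 1/4 from the two uses of Young's inequality are given away
    to match the source term.\<close>
  also have "\<dots> \<le> r\<^sub>1 * source t"
  proof -
    have "r\<^sub>1 * \<tau>\<^sub>0 / 2 * (L2_norm (lebesgue_on \<Omega>) (\<phi> t))\<^sup>2 \<le> r\<^sub>1 * \<tau>\<^sub>0 * (L2_norm (lebesgue_on \<Omega>) (\<phi> t))\<^sup>2"
      using pos by (intro mult_right_mono) auto
    moreover have "r\<^sub>1 * c\<^sub>1 / (4 * a) * (L2_norm \<sigma> (g t))\<^sup>2 \<le> r\<^sub>1 * (c\<^sub>1 / a) * (L2_norm \<sigma> (g t))\<^sup>2"
      using pos by (intro mult_right_mono) (auto simp: field_simps)
    ultimately have "r\<^sub>1 * \<tau>\<^sub>0 / 2 * (L2_norm (lebesgue_on \<Omega>) (\<phi> t))\<^sup>2 + r\<^sub>1 * c\<^sub>1 / (4 * a) * (L2_norm \<sigma> (g t))\<^sup>2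
        \<le> r\<^sub>1 * \<tau>\<^sub>0 * (L2_norm (lebesgue_on \<Omega>) (\<phi> t))\<^sup>2 + r\<^sub>1 * (c\<^sub>1 / a) * (L2_norm \<sigma> (g t))\<^sup>2"
      by (rule add_mono)
    then show ?thesis by (simp add: source_def algebra_simps)
  qed
  finally show ?thesis .
qed

lemma source_integrable:
  assumes "t < \<tau>" shows "integrable lborel (\<lambda>s. indicator {0..t} s * source s)"
proof -
  interpret S: finite_measure \<sigma> by (rule finite_measure_surf)
  interpret R: finite_measure "restrict_space lborel {0<..<\<tau>}"
    using emeasure_bounded_finite[of "{0<..<\<tau>}"]
    by (intro finite_measureI) (simp add: space_restrict_space emeasure_restrict_space less_top)
  interpret P: pair_sigma_finite "restrict_space lborel {0<..<\<tau>}" \<sigma> ..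
  have "integrable (lborel \<Otimes>\<^sub>M lborel) (\<lambda>(s, x). indicator {0..t} s * (indicator \<Omega> x * (norm (\<phi> s x))\<^sup>2))"
  proof (rule integrable_cylinder)
    have "continuous_on ({0..\<tau>} \<times> closure \<Omega>) (\<lambda>z. (norm (case_prod \<phi> z))\<^sup>2)"
      by (intro continuous_intros phi_cont)
    then show "continuous_on ({0..\<tau>} \<times> closure \<Omega>) (\<lambda>(s, x). (norm (\<phi> s x))\<^sup>2)"
      by (simp add: case_prod_beta')
  qed (use assms in simp)
  from lborel_pair.integrable_fst'[OF this]
  have i0: "integrable lborel (\<lambda>s. indicator {0..t} s * (LINT x|lborel. indicator \<Omega> x * (norm (\<phi> s x))\<^sup>2))"
    by simp
  have i1: "integrable lborel (\<lambda>s. indicator {0..t} s * (L2_norm (lebesgue_on \<Omega>) (\<phi> s))\<^sup>2)"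
  proof (rule Bochner_Integration.integrable_cong[THEN iffD1, OF refl _ i0])
    fix s
    show "indicator {0..t} s * (LINT x|lborel. indicator \<Omega> x * (norm (\<phi> s x))\<^sup>2)
        = indicator {0..t} s * (L2_norm (lebesgue_on \<Omega>) (\<phi> s))\<^sup>2"
    proof (cases "s \<in> {0..t}")
      case True
      then have "s \<in> {0..\<tau>}" using assms by auto
      then show ?thesis
        using L2_norm_dom[OF continuous_on_subset[OF phi_cont_slice dom_subset]] by simp
    qed simp
  qed
  have "integrable (restrict_space lborel {0<..<\<tau>}) (\<lambda>s. LINT x|\<sigma>. (g s x)\<^sup>2)"
    using P.integrable_fst'[OF g_int] by simp
  then have "integrable lborel (\<lambda>s. indicator {0<..<\<tau>} s *\<^sub>R (L2_norm \<sigma> (g s))\<^sup>2)"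
    by (subst (asm) integrable_restrict_space) (auto simp: L2_norm_squared)
  then have "integrable lborel (\<lambda>s. indicator {..t} s *\<^sub>R (indicator {0<..<\<tau>} s *\<^sub>R (L2_norm \<sigma> (g s))\<^sup>2))"
    by (rule integrable_mult_indicator[rotated]) simp
  \<comment> \<open>Square integrability of \<open>g\<close> is given on the open time interval. The
    value at time zero is added on a null set in order to reach the closed interval of the
    claim.\<close>
  then have "integrable lborel (\<lambda>s. indicator {..t} s *\<^sub>R (indicator {0<..<\<tau>} s *\<^sub>R (L2_norm \<sigma> (g s))\<^sup>2)
      + indicator {0..t} 0 * (L2_norm \<sigma> (g 0))\<^sup>2 * indicator {0} s)"
    by (intro Bochner_Integration.integrable_add integrable_mult_right integrable_real_indicator) auto
  then have i2: "integrable lborel (\<lambda>s. indicator {0..t} s * (L2_norm \<sigma> (g s))\<^sup>2)"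
    by (rule Bochner_Integration.integrable_cong[THEN iffD1, OF refl, rotated])
      (use assms in \<open>auto simp: indicator_def\<close>)
  have "integrable lborel (\<lambda>s. \<tau>\<^sub>0 * (indicator {0..t} s * (L2_norm (lebesgue_on \<Omega>) (\<phi> s))\<^sup>2)
      + c\<^sub>1 / a * (indicator {0..t} s * (L2_norm \<sigma> (g s))\<^sup>2))"
    by (intro Bochner_Integration.integrable_add integrable_mult_right i1 i2)
  then show ?thesis by (simp add: source_def algebra_simps)
qed

definition total where
  "total t = (L2_norm (lebesgue_on \<Omega>) (w t))\<^sup>2 / \<tau>\<^sub>0\<^sup>2 + (L2_norm (lebesgue_on \<Omega>) (\<pi> t))\<^sup>2
    + (L2_norm (lebesgue_on \<Omega>) (v t))\<^sup>2"

lemma total_eq: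
  assumes t: "t \<in> {0..\<tau>}"
  shows "total t = (LINT x|lborel. indicator \<Omega> x * (2 * specific_energy t x))"
proof -
  note cont = continuous_dom[OF w1 t] continuous_dom[OF pi1 t] continuous_dom[OF v1 t]
  note L = cont[THEN continuous_on_subset[OF _ dom_subset], THEN L2_norm_dom]
  have i: "integrable lborel (\<lambda>x. indicator \<Omega> x * (norm (w t x))\<^sup>2)"
    "integrable lborel (\<lambda>x. indicator \<Omega> x * (norm (\<pi> t x))\<^sup>2)"
    "integrable lborel (\<lambda>x. indicator \<Omega> x * (norm (v t x))\<^sup>2)"
    by (intro integrable_dom continuous_intros cont)+
  have "(LINT x|lborel. indicator \<Omega> x * (2 * specific_energy t x))
    = (LINT x|lborel. (indicator \<Omega> x * (norm (w t x))\<^sup>2) * (1 / \<tau>\<^sub>0\<^sup>2) + indicator \<Omega> x * (norm (\<pi> t x))\<^sup>2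
        + indicator \<Omega> x * (norm (v t x))\<^sup>2)"
    by (intro Bochner_Integration.integral_cong refl) (simp add: specific_energy_def algebra_simps)
  also have "\<dots> = (LINT x|lborel. indicator \<Omega> x * (norm (w t x))\<^sup>2) * (1 / \<tau>\<^sub>0\<^sup>2)
      + (LINT x|lborel. indicator \<Omega> x * (norm (\<pi> t x))\<^sup>2) + (LINT x|lborel. indicator \<Omega> x * (norm (v t x))\<^sup>2)"
    using i by (subst Bochner_Integration.integral_add; simp)+
  also have "\<dots> = total t" unfolding total_def L by simp
  finally show ?thesis ..
qed

text \<open>The density bounds make the weighted energy equivalent to the squared norms in the
  claim. Their ratio is the origin of \<open>r\<^sub>1 / r\<^sub>0\<close> in the final
  constant.\<close>

lemma energy_total:
  assumes t: "t \<in> {0..\<tau>}"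
  shows "r\<^sub>0 / 2 * total t \<le> (LINT x|lborel. indicator \<Omega> x * energy t x)"
    "(LINT x|lborel. indicator \<Omega> x * energy t x) \<le> r\<^sub>1 / 2 * total t"
proof -
  have d: "specific_energy t x \<ge> 0" for x using pos(1) by (simp add: specific_energy_def)
  have c: "continuous_on (closure \<Omega>) (\<lambda>x. K * (2 * specific_energy t x))" for K
    by (intro continuous_intros continuous_dom[OF specific_energy1 t])
  have T: "K * total t = (LINT x|lborel. indicator \<Omega> x * (K * (2 * specific_energy t x)))" for K
    unfolding total_eq[OF t] by (simp add: mult.left_commute[of "indicator _ _" K])
  have "\<And>x. x \<in> \<Omega> \<Longrightarrow> r\<^sub>0 \<le> \<rho> t x \<and> \<rho> t x \<le> r\<^sub>1" using rho_bounds[OF t] dom_subset by auto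
  then have le: "indicator \<Omega> x * (r\<^sub>0 / 2 * (2 * specific_energy t x)) \<le> indicator \<Omega> x * energy t x"
    "indicator \<Omega> x * energy t x \<le> indicator \<Omega> x * (r\<^sub>1 / 2 * (2 * specific_energy t x))" for x
    using d[of x] by (auto simp: energy_eq indicator_def mult_right_mono)
  show "r\<^sub>0 / 2 * total t \<le> (LINT x|lborel. indicator \<Omega> x * energy t x)"
    unfolding T by (intro integral_mono integrable_dom c continuous_dom[OF energy1 t] le(1))
  show "(LINT x|lborel. indicator \<Omega> x * energy t x) \<le> r\<^sub>1 / 2 * total t"
    unfolding T by (intro integral_mono integrable_dom c continuous_dom[OF energy1 t] le(2))
qed

lemma total_estimate:
  assumes t: "t \<in> {0<..<\<tau>}"
  shows "total t \<le> 2 * r\<^sub>1 / r\<^sub>0 * exp (rate * t) * (total 0 + (LINT s:{0..t}|lborel. source s))"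
proof -
  let ?E = "\<lambda>t. LINT x|lborel. indicator \<Omega> x * energy t x"
  let ?S = "LINT s|lborel. indicator {0..t} s * source s"
  have S0: "?S \<ge> 0" by (intro Bochner_Integration.integral_nonneg) (simp add: source_nonneg)
  have t0: "t \<in> {0..\<tau>}" "0 \<in> {0..\<tau>}" using t by auto
  have T0: "total 0 \<ge> 0" by (simp add: total_def)
  have "rate \<ge> 0" using pos by (simp add: rate_def)
  then have "?E t \<le> exp (rate * t) * (?E 0 + (LINT s|lborel. indicator {0..t} s * (r\<^sub>1 * source s)))"
  proof (rule integral_growth[OF Q energy1, rotated 2])
    show "integrable lborel (\<lambda>s. indicator {0..t} s * (r\<^sub>1 * source s))"
      using integrable_mult_right[OF source_integrable[of t], of r\<^sub>1] t by (simp add: mult.left_commute)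
    show "r\<^sub>1 * source s \<ge> 0" for s using pos source_nonneg by simp
    show "(LINT x|lborel. indicator \<Omega> x * (dt energy s x - rate * energy s x)) \<le> r\<^sub>1 * source s"
      if "0 < s" "s \<le> t" for s using energy_rate[of s] that t by simp
  qed (use t in auto)
  also have "(LINT s|lborel. indicator {0..t} s * (r\<^sub>1 * source s)) = r\<^sub>1 * ?S"
    by (simp add: mult.left_commute[of "indicator _ _"])
  \<comment> \<open>Giving away the factor 1/2 in the initial energy lets initial data and source
    share the factor \<open>r\<^sub>1\<close>; division by \<open>r\<^sub>0 / 2\<close> then leads
    to \<open>2 * r\<^sub>1 / r\<^sub>0\<close>.\<close>
  also have "exp (rate * t) * (?E 0 + r\<^sub>1 * ?S) \<le> exp (rate * t) * (r\<^sub>1 * (total 0 + ?S))"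
  proof (intro mult_left_mono)
    have "?E 0 \<le> r\<^sub>1 / 2 * total 0" by (rule energy_total(2)[OF t0(2)])
    also have "\<dots> \<le> r\<^sub>1 * total 0" using pos T0 by (intro mult_right_mono) auto
    finally show "?E 0 + r\<^sub>1 * ?S \<le> r\<^sub>1 * (total 0 + ?S)" by (simp add: distrib_left)
  qed simp
  finally have "r\<^sub>0 / 2 * total t \<le> exp (rate * t) * (r\<^sub>1 * (total 0 + ?S))"
    using energy_total(1)[OF t0(1)] by linarith
  then have "total t \<le> 2 / r\<^sub>0 * (exp (rate * t) * (r\<^sub>1 * (total 0 + ?S)))"
    using pos(3) by (simp add: field_simps)
  then show ?thesis by (simp add: set_lebesgue_integral_def mult_ac)
qed

end

section \<open>From the stated hypotheses to the a priori estimate\<close>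

lemma Ck_up_toE:
  assumes "Ck_up_to k K f"
  obtains U where "open U" "K \<subseteq> U" "Ck_on k U f"
  using assms unfolding Ck_up_to_def by blast

lemma Ck_up_to_0: "Ck_up_to 0 K f \<Longrightarrow> continuous_on K f"
  unfolding Ck_up_to_def by (auto intro: continuous_on_subset)

lemma L2_norm_cong:
  assumes "\<And>x. x \<in> space M \<Longrightarrow> f x = g x" shows "L2_norm M f = L2_norm M g"
  unfolding L2_norm_def by (intro arg_cong[where f=sqrt] Bochner_Integration.integral_cong) (auto simp: assms)

lemma divg_cong:
  assumes "open S" "x \<in> S" "\<And>x. x \<in> S \<Longrightarrow> f x = g x" shows "divg f x = divg g x"
  using Df_cong[OF assms] by (simp add: divg_def)

lemma Lie_cong:
  assumes "open S" "x \<in> S" "\<And>x. x \<in> S \<Longrightarrow> f x = g x" shows "Lie u f x = Lie u g x"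
  using Df_cong[OF assms] assms(2,3) by (simp add: Lie_def)

text \<open>The hypothesis \<open>c > 0\<close> excludes the junk value of the square root of a negative number.\<close>

lemma pressure_gradient:
  fixes p \<rho> :: "'a::euclidean_space \<Rightarrow> real"
  assumes "open S" "x \<in> S" "\<And>y. y \<in> S \<Longrightarrow> p y = eos (\<rho> y)"
    and "\<rho> differentiable (at x)" "eos differentiable (at (\<rho> x))"
    and c: "c = sqrt (deriv eos (\<rho> x))" "c > 0"
  shows "p differentiable (at x)" "Df p x b = c\<^sup>2 * Df \<rho> x b"
proof -
  have "deriv eos (\<rho> x) > 0" using c by simp
  then have c2: "deriv eos (\<rho> x) = c\<^sup>2" using c(1) by simp
  have "(eos has_real_derivative c\<^sup>2) (at (\<rho> x))"
    using assms(5) unfolding c2[symmetric]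
    by (metis DERIV_deriv_iff_real_differentiable)
  from has_derivative_compose[OF has_derivative_Df[OF assms(4)] this[unfolded has_field_derivative_def]]
  have "((\<lambda>y. eos (\<rho> y)) has_derivative (\<lambda>b. c\<^sup>2 * Df \<rho> x b)) (at x)" .
  then have d: "(p has_derivative (\<lambda>b. c\<^sup>2 * Df \<rho> x b)) (at x)"
    by (rule has_derivative_transform_within_open[OF _ assms(1,2)]) (simp add: assms(3))
  show "p differentiable (at x)" "Df p x b = c\<^sup>2 * Df \<rho> x b"
    using Df_eqI[OF d] d by (auto simp: differentiable_def)
qed

theorem theorem8:
  fixes \<Omega> :: "'a::euclidean_space set"
    and \<sigma> :: "'a measure" and n :: "'a \<Rightarrow> 'a"
    and Y :: "'a \<Rightarrow> real" and a \<tau>\<^sub>0 \<tau> :: real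
    and eos :: "real \<Rightarrow> real"
    and u\<^sub>0 \<phi>\<^sub>0 :: "real \<Rightarrow> 'a \<Rightarrow> 'a" and p\<^sub>0 \<rho>\<^sub>0 c\<^sub>0 :: "real \<Rightarrow> 'a \<Rightarrow> real"
  assumes "lipschitz_domain \<Omega>"
    and "is_surface_measure \<Omega> \<sigma>"
    and "AE x in \<sigma>. is_outward_unit_normal \<Omega> x (n x)"
    and "\<exists>L. L-lipschitz_on (frontier \<Omega>) Y"
    and "a > 0" and "\<forall>x\<in>frontier \<Omega>. Y x \<ge> a"
    and "\<tau>\<^sub>0 > 0" and "\<tau> > 0"
    and "background_flow \<Omega> \<tau> eos u\<^sub>0 p\<^sub>0 \<rho>\<^sub>0 \<phi>\<^sub>0 c\<^sub>0"
    and "\<forall>t\<in>{0..\<tau>}. AE x in \<sigma>. n x \<bullet> u\<^sub>0 t x = 0"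
  shows "\<exists>C>0. \<exists>\<nu>>0. \<forall>w w\<^sub>I z\<^sub>I \<delta>\<phi> g.
    galbrun_regular \<Omega> \<sigma> \<tau> w w\<^sub>I z\<^sub>I \<delta>\<phi> g \<longrightarrow>
    galbrun_solution \<Omega> \<sigma> n Y \<tau> u\<^sub>0 p\<^sub>0 \<rho>\<^sub>0 c\<^sub>0 w w\<^sub>I z\<^sub>I \<delta>\<phi> g \<longrightarrow>
    (\<forall>t\<in>{0<..<\<tau>}.
       (L2_norm (lebesgue_on \<Omega>) (w t))\<^sup>2 / \<tau>\<^sub>0\<^sup>2
       + (L2_norm (lebesgue_on \<Omega>) (\<lambda>x. c\<^sub>0 t x / \<rho>\<^sub>0 t x * divg (\<lambda>y. \<rho>\<^sub>0 t y *\<^sub>R w t y) x))\<^sup>2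
       + (L2_norm (lebesgue_on \<Omega>) (dt_Lie u\<^sub>0 w t))\<^sup>2
       \<le> C * exp (\<nu> * t) *
         ((L2_norm (lebesgue_on \<Omega>) w\<^sub>I)\<^sup>2 / \<tau>\<^sub>0\<^sup>2
          + (L2_norm (lebesgue_on \<Omega>) (\<lambda>x. c\<^sub>0 0 x / \<rho>\<^sub>0 0 x * divg (\<lambda>y. \<rho>\<^sub>0 0 y *\<^sub>R w\<^sub>I y) x))\<^sup>2
          + (L2_norm (lebesgue_on \<Omega>) (\<lambda>x. z\<^sub>I x + Lie (u\<^sub>0 0) w\<^sub>I x))\<^sup>2
          + (LINT s:{0..t}|lborel.
               \<tau>\<^sub>0 * (L2_norm (lebesgue_on \<Omega>) (\<delta>\<phi> s))\<^sup>2
               + (SUP (r, x)\<in>{0..\<tau>} \<times> closure \<Omega>. c\<^sub>0 r x) / a * (L2_norm \<sigma> (g s))\<^sup>2)))"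
proof (cases "\<Omega> = {}")
  case True
  \<comment> \<open>For an empty domain the infima and suprema over the cylinder carry no
    information. The frontier is empty too, so all norms in the claim vanish and any positive
    constants will do.\<close>
  have "AE x in \<sigma>. x \<in> frontier \<Omega>"
    using lipschitz_boundary.AE_frontier[OF lipschitz_boundary.intro] assms(1-3) by blast
  then have "AE x in \<sigma>. False" using True by simp
  then have "AE x in \<sigma>. (f x :: real)\<^sup>2 = 0" for f by auto
  then have 1: "L2_norm \<sigma> (f :: 'a \<Rightarrow> real) = 0" for f
    unfolding L2_norm_def by (simp add: integral_eq_zero_AE)
  have 2: "L2_norm (lebesgue_on \<Omega>) f = 0" for f :: "'a \<Rightarrow> 'b::real_normed_vector"
    unfolding L2_norm_def True by (subst integral_restrict_space) auto
  show ?thesis by (intro exI[of _ 1] conjI allI impI ballI) (auto simp: 1 2)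
next
  case False
  interpret lb: lipschitz_boundary \<Omega> \<sigma> n using assms(1-3) by unfold_locales
  let ?Q = "{0..\<tau>} \<times> closure \<Omega>"
  have Qne: "?Q \<noteq> {}" using False \<open>\<tau> > 0\<close> by auto
  have Qc: "compact ?Q" by (intro compact_Times compact_Icc lb.compact_closure_dom)
  note flow = assms(9)[unfolded background_flow_def Let_def]
  have f: "Ck_up_to 2 ?Q (case_prod u\<^sub>0)" "Ck_up_to 2 ?Q (case_prod \<rho>\<^sub>0)" "Ck_up_to 1 ?Q (case_prod c\<^sub>0)"
    "Ck_up_to 1 (case_prod \<rho>\<^sub>0 ` ?Q) eos"
    using flow by blast+
  have euler: "\<And>t x. t \<in> {0<..<\<tau>} \<Longrightarrow> x \<in> \<Omega> \<Longrightarrow> material u\<^sub>0 \<rho>\<^sub>0 t x + \<rho>\<^sub>0 t x * divg (u\<^sub>0 t) x = 0"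
    using flow by blast
  have state: "p\<^sub>0 t x = eos (\<rho>\<^sub>0 t x)" "c\<^sub>0 t x = sqrt (deriv eos (\<rho>\<^sub>0 t x))" if "(t, x) \<in> ?Q" for t x
    using flow that by blast+
  have infs: "0 < (INF (t, x)\<in>?Q. \<rho>\<^sub>0 t x)" "bdd_above ((\<lambda>(t, x). \<rho>\<^sub>0 t x) ` ?Q)"
    "0 < (INF (t, x)\<in>?Q. c\<^sub>0 t x)" "bdd_above ((\<lambda>(t, x). c\<^sub>0 t x) ` ?Q)"
    using flow by - (elim conjE, assumption)+
  obtain M where M: "\<forall>t\<in>{0..\<tau>}. AE x in lebesgue_on \<Omega>. onorm (Df (u\<^sub>0 t) x) \<le> M" using flow by blast
  obtain M' where M': "\<forall>t\<in>{0..\<tau>}. AE x in lebesgue_on \<Omega>. \<bar>material u\<^sub>0 c\<^sub>0 t x / c\<^sub>0 t x\<bar> \<le> M'" using flow by blast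
  obtain Gu where Gu: "open Gu" "?Q \<subseteq> Gu" "Ck_on 2 Gu (case_prod u\<^sub>0)" using Ck_up_toE[OF f(1)] by metis
  obtain Gr where Gr: "open Gr" "?Q \<subseteq> Gr" "Ck_on 2 Gr (case_prod \<rho>\<^sub>0)" using Ck_up_toE[OF f(2)] by metis
  obtain Gc where Gc: "open Gc" "?Q \<subseteq> Gc" "Ck_on 1 Gc (case_prod c\<^sub>0)" using Ck_up_toE[OF f(3)] by metis
  obtain Ge where Ge: "case_prod \<rho>\<^sub>0 ` ?Q \<subseteq> Ge" "Ck_on 1 Ge eos" using Ck_up_toE[OF f(4)] by metis
  have cr: "continuous_on Gr (case_prod \<rho>\<^sub>0)" and cc: "continuous_on Gc (case_prod c\<^sub>0)"
    using Ck_on_1D(4)[OF Ck_on_2D(1)[OF Gr(3)]] Ck_on_1D(4)[OF Gc(3)] .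
  define r\<^sub>0 where "r\<^sub>0 = (INF (t, x)\<in>?Q. \<rho>\<^sub>0 t x)"
  define r\<^sub>1 where "r\<^sub>1 = (SUP (t, x)\<in>?Q. \<rho>\<^sub>0 t x)"
  define c\<^sub>1 where "c\<^sub>1 = (SUP (t, x)\<in>?Q. c\<^sub>0 t x)"
  \<comment> \<open>A real infimum is a lower bound only if the set is bounded below. For both
    fields this follows from continuity on the compact cylinder.\<close>
  have bdd: "bdd_below (case_prod \<rho>\<^sub>0 ` ?Q)" "bdd_below (case_prod c\<^sub>0 ` ?Q)"
    using compact_continuous_image[OF continuous_on_subset[OF cr Gr(2)] Qc]
      compact_continuous_image[OF continuous_on_subset[OF cc Gc(2)] Qc]
    by (auto intro!: bounded_imp_bdd_below compact_imp_bounded)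
  have r: "r\<^sub>0 \<le> \<rho>\<^sub>0 t x" "\<rho>\<^sub>0 t x \<le> r\<^sub>1" and c: "0 < c\<^sub>0 t x" "c\<^sub>0 t x \<le> c\<^sub>1" if q: "(t, x) \<in> ?Q" for t x
  proof -
    show "r\<^sub>0 \<le> \<rho>\<^sub>0 t x" using cINF_lower[OF bdd(1) q] by (simp add: r\<^sub>0_def)
    show "\<rho>\<^sub>0 t x \<le> r\<^sub>1" using cSUP_upper[OF q infs(2)] by (simp add: r\<^sub>1_def)
    show "0 < c\<^sub>0 t x" using cINF_lower[OF bdd(2) q] infs(3) by simp
    show "c\<^sub>0 t x \<le> c\<^sub>1" using cSUP_upper[OF q infs(4)] by (simp add: c\<^sub>1_def)
  qed
  have r0: "r\<^sub>0 > 0" using infs(1) by (simp add: r\<^sub>0_def)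
  obtain t0 x0 where q0: "(t0, x0) \<in> ?Q" using Qne by (metis ex_in_conv surj_pair)
  have r1: "r\<^sub>1 > 0" and c1: "c\<^sub>1 > 0" using r[OF q0] c[OF q0] r0 by linarith+
  define M\<^sub>1 where "M\<^sub>1 = max M 0"
  define M\<^sub>2 where "M\<^sub>2 = max M' 0"
  \<comment> \<open>The value of \<open>rate\<close> for these bounds, written out because the
    constants must be fixed before \<open>w\<close> and hence before the locale is
    interpreted.\<close>
  define \<nu> where "\<nu> = 2 * (M\<^sub>1 + M\<^sub>2) + 1 + 1 / \<tau>\<^sub>0 + 1 / \<tau>\<^sub>0\<^sup>2"
  have "\<nu> > 0" using \<open>\<tau>\<^sub>0 > 0\<close> by (simp add: \<nu>_def M\<^sub>1_def M\<^sub>2_def add_nonneg_pos add_pos_nonneg)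
  have "2 * r\<^sub>1 / r\<^sub>0 > 0" using r0 r1 by simp
  show ?thesis
  proof (rule exI[of _ "2 * r\<^sub>1 / r\<^sub>0"], rule conjI[OF \<open>2 * r\<^sub>1 / r\<^sub>0 > 0\<close>], rule exI[of _ \<nu>],
      rule conjI[OF \<open>\<nu> > 0\<close>], intro allI impI ballI)
    fix w w\<^sub>I z\<^sub>I \<delta>\<phi> g t
    assume reg: "galbrun_regular \<Omega> \<sigma> \<tau> w w\<^sub>I z\<^sub>I \<delta>\<phi> g"
      and sol: "galbrun_solution \<Omega> \<sigma> n Y \<tau> u\<^sub>0 p\<^sub>0 \<rho>\<^sub>0 c\<^sub>0 w w\<^sub>I z\<^sub>I \<delta>\<phi> g" and t: "t \<in> {0<..<\<tau>}"
    have "Ck_up_to 2 ?Q (case_prod w)" and phi: "Ck_up_to 0 ?Q (case_prod \<delta>\<phi>)"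
      and g: "(\<lambda>(t, x). g t x) \<in> borel_measurable (restrict_space lborel {0<..<\<tau>} \<Otimes>\<^sub>M \<sigma>)"
        "integrable (restrict_space lborel {0<..<\<tau>} \<Otimes>\<^sub>M \<sigma>) (\<lambda>(t, x). (g t x)\<^sup>2)"
      using reg unfolding galbrun_regular_def by blast+
    then obtain Gw where Gw: "open Gw" "?Q \<subseteq> Gw" "Ck_on 2 Gw (case_prod w)" using Ck_up_toE by metis
    \<comment> \<open>Density and sound speed are positive on the closed cylinder, hence by
      continuity on a neighbourhood. This set depends on \<open>w\<close>, but the constants above
      do not.\<close>
    define G where "G = Gu \<inter> Gw \<inter> (Gr \<inter> case_prod \<rho>\<^sub>0 -` {0<..}) \<inter> (Gc \<inter> case_prod c\<^sub>0 -` {0<..})"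
    have oG: "open G"
      unfolding G_def by (intro open_Int continuous_open_preimage Gu Gw Gr Gc cr cc open_greaterThan)
    have QG: "?Q \<subseteq> G"
    proof
      fix z assume z: "z \<in> ?Q"
      obtain s x where sx: "z = (s, x)" by (cases z)
      have "0 < \<rho>\<^sub>0 s x" "0 < c\<^sub>0 s x" using r(1)[of s x] c(1)[of s x] r0 z sx by auto
      moreover have "z \<in> Gu" "z \<in> Gw" "z \<in> Gr" "z \<in> Gc" using z Gu(2) Gw(2) Gr(2) Gc(2) by blast+
      ultimately show "z \<in> G" by (simp add: G_def sx)
    qed
    interpret F: galbrun_fields G u\<^sub>0 w \<rho>\<^sub>0 c\<^sub>0 "1 / \<tau>\<^sub>0\<^sup>2"
    proof (unfold_locales, rule oG)
      show "Ck_on 2 G (case_prod u\<^sub>0)" "Ck_on 2 G (case_prod w)" "Ck_on 2 G (case_prod \<rho>\<^sub>0)"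
        "Ck_on 1 G (case_prod c\<^sub>0)"
        by (rule Ck_on_subset[OF Gu(3)] Ck_on_subset[OF Gw(3)] Ck_on_subset[OF Gr(3)]
            Ck_on_subset[OF Gc(3)], simp add: G_def subset_iff)+
    qed (auto simp: G_def)
    have v_eq: "(\<lambda>t x. material u\<^sub>0 w t x - Df (u\<^sub>0 t) x (w t x)) = F.v"
      by (simp add: fun_eq_iff material_def dt_Lie_def Lie_def)
    have m_eq: "(\<lambda>t x. divg (\<lambda>y. \<rho>\<^sub>0 t y *\<^sub>R w t y) x) = F.m" by (simp add: fun_eq_iff F.m_def)
    interpret P: galbrun_problem \<Omega> \<sigma> n G u\<^sub>0 w \<rho>\<^sub>0 c\<^sub>0 \<tau>\<^sub>0 Y a \<tau> p\<^sub>0 \<delta>\<phi> g r\<^sub>0 r\<^sub>1 c\<^sub>1 M\<^sub>1 M\<^sub>2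
    proof unfold_locales
      show "?Q \<subseteq> G" by (rule QG)
      show "0 < \<tau>\<^sub>0" "0 < a" "0 < r\<^sub>0" "0 \<le> r\<^sub>1" "0 \<le> c\<^sub>1" "0 \<le> M\<^sub>1" "0 \<le> M\<^sub>2"
        using assms(5,7) r0 r1 c1 by (auto simp: M\<^sub>1_def M\<^sub>2_def)
      show "a \<le> Y x" if "x \<in> frontier \<Omega>" for x using assms(6) that by blast
      obtain L where "L-lipschitz_on (frontier \<Omega>) Y" using assms(4) by blast
      then have "bounded (Y ` frontier \<Omega>)"
        using lipschitz_on_continuous_on lb.compact_frontier_dom
        by (intro compact_imp_bounded compact_continuous_image)
      then show "\<exists>B. \<forall>x\<in>frontier \<Omega>. norm (Y x) \<le> B" unfolding bounded_iff by blast
      show "r\<^sub>0 \<le> \<rho>\<^sub>0 s x \<and> \<rho>\<^sub>0 s x \<le> r\<^sub>1" "c\<^sub>0 s x \<le> c\<^sub>1" if "s \<in> {0..\<tau>}" "x \<in> closure \<Omega>" for s x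
        using r[of s x] c[of s x] that by auto
      show "AE x in lborel. x \<in> \<Omega> \<longrightarrow> (\<forall>h. norm (Df (u\<^sub>0 s) x h) \<le> M\<^sub>1 * norm h)" if s: "s \<in> {0..\<tau>}" for s
      proof -
        have "AE x in lborel. x \<in> \<Omega> \<longrightarrow> onorm (Df (u\<^sub>0 s) x) \<le> M"
          using M s unfolding lb.AE_lebesgue_on_dom by blast
        then show ?thesis
        proof eventually_elim
          case (elim x)
          show ?case
          proof (intro impI allI)
            fix h assume x: "x \<in> \<Omega>"
            then have "(s, x) \<in> G" using QG s lb.dom_subset by auto
            then have "bounded_linear (Df (u\<^sub>0 s) x)"
              using has_derivative_bounded_linear[OF has_derivative_Df[OF differentiable_slice[OF F.u_diff]]] by blast
            then have "norm (Df (u\<^sub>0 s) x h) \<le> onorm (Df (u\<^sub>0 s) x) * norm h" by (rule onorm)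
            also have "\<dots> \<le> M\<^sub>1 * norm h" using elim x by (intro mult_right_mono) (auto simp: M\<^sub>1_def)
            finally show "norm (Df (u\<^sub>0 s) x h) \<le> M\<^sub>1 * norm h" .
          qed
        qed
      qed
      show "AE x in lborel. x \<in> \<Omega> \<longrightarrow> \<bar>material u\<^sub>0 c\<^sub>0 s x / c\<^sub>0 s x\<bar> \<le> M\<^sub>2" if s: "s \<in> {0..\<tau>}" for s
      proof -
        have "AE x in lborel. x \<in> \<Omega> \<longrightarrow> \<bar>material u\<^sub>0 c\<^sub>0 s x / c\<^sub>0 s x\<bar> \<le> M'"
          using M' s unfolding lb.AE_lebesgue_on_dom by blast
        then show ?thesis by eventually_elim (auto simp: M\<^sub>2_def)
      qed
      show "material u\<^sub>0 \<rho>\<^sub>0 s x + \<rho>\<^sub>0 s x * divg (u\<^sub>0 s) x = 0" if "s \<in> {0<..<\<tau>}" "x \<in> \<Omega>" for s x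
        by (rule euler[OF that])
      \<comment> \<open>At a fixed time the equation of state holds throughout the open set
        \<open>\<Omega>\<close>, so it can be differentiated in space; \<open>eos\<close> is
        differentiable near the values of the density.\<close>
      have pg: "p\<^sub>0 s differentiable (at x) \<and> Df (p\<^sub>0 s) x b = (c\<^sub>0 s x)\<^sup>2 * Df (\<rho>\<^sub>0 s) x b"
        if s: "s \<in> {0<..<\<tau>}" and x: "x \<in> \<Omega>" for s x b
      proof -
        have q: "(s, y) \<in> ?Q" if "y \<in> \<Omega>" for y using s that lb.dom_subset by auto
        have d: "\<rho>\<^sub>0 s differentiable (at x)" using differentiable_slice[OF F.rho_diff] q[OF x] QG by blast
        have "\<rho>\<^sub>0 s x \<in> Ge" using Ge(1) q[OF x] by force
        then have e: "eos differentiable (at (\<rho>\<^sub>0 s x))" by (rule Ck_on_1D(1)[OF Ge(2)])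
        show ?thesis
          using pressure_gradient[OF lb.open_dom x state(1)[OF q] d e state(2)[OF q[OF x]] c(1)[OF q[OF x]]] by blast
      qed
      show "p\<^sub>0 s differentiable (at x)" "Df (p\<^sub>0 s) x b = (c\<^sub>0 s x)\<^sup>2 * Df (\<rho>\<^sub>0 s) x b"
        if "s \<in> {0<..<\<tau>}" "x \<in> \<Omega>" for s x b
        using pg[OF that] by blast+
      show "\<rho>\<^sub>0 s x *\<^sub>R material u\<^sub>0 F.v s x - grad (\<lambda>y. (c\<^sub>0 s y)\<^sup>2 * F.m s y) x
        + \<rho>\<^sub>0 s x *\<^sub>R Df (u\<^sub>0 s) x (F.v s x) + F.m s x *\<^sub>R ((1 / \<rho>\<^sub>0 s x) *\<^sub>R grad (p\<^sub>0 s) x) = \<rho>\<^sub>0 s x *\<^sub>R \<delta>\<phi> s x"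
        if "s \<in> {0<..<\<tau>}" "x \<in> \<Omega>" for s x
        using sol[unfolded galbrun_solution_def Let_def] that
        unfolding v_eq fun_cong[OF fun_cong[OF v_eq]] m_eq F.m_def by blast
      show "AE x in \<sigma>. n x \<bullet> u\<^sub>0 s x = 0" if "s \<in> {0..\<tau>}" for s using assms(10) that by blast
      show "AE x in \<sigma>. - (Y x * F.\<pi> s x) - n x \<bullet> F.v s x = g s x" if s: "s \<in> {0<..<\<tau>}" for s
      proof -
        have "AE x in \<sigma>. - (Y x * c\<^sub>0 s x / \<rho>\<^sub>0 s x * divg (\<lambda>y. \<rho>\<^sub>0 s y *\<^sub>R w s y) x) - n x \<bullet> F.v s x = g s x"
          using sol[unfolded galbrun_solution_def Let_def] s by blast
        then show ?thesis by eventually_elim (simp add: F.\<pi>_def F.m_def)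
      qed
      show "continuous_on ?Q (case_prod \<delta>\<phi>)" by (rule Ck_up_to_0[OF phi])
    qed (rule g)+
    have init: "w 0 x = w\<^sub>I x" "dt w 0 x = z\<^sub>I x" if "x \<in> \<Omega>" for x
      using sol that unfolding galbrun_solution_def Let_def by blast+
    have i1: "L2_norm (lebesgue_on \<Omega>) (w 0) = L2_norm (lebesgue_on \<Omega>) w\<^sub>I"
      by (rule L2_norm_cong) (simp add: init)
    \<comment> \<open>The functions \<open>w 0\<close> and \<open>w\<^sub>I\<close> agree on the
      open set \<open>\<Omega>\<close>, hence so do their spatial derivatives at its points.\<close>
    have i2: "L2_norm (lebesgue_on \<Omega>) (F.\<pi> 0)
        = L2_norm (lebesgue_on \<Omega>) (\<lambda>x. c\<^sub>0 0 x / \<rho>\<^sub>0 0 x * divg (\<lambda>y. \<rho>\<^sub>0 0 y *\<^sub>R w\<^sub>I y) x)"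
    proof (rule L2_norm_cong)
      fix x assume "x \<in> space (lebesgue_on \<Omega>)"
      then have x: "x \<in> \<Omega>" by simp
      have "divg (\<lambda>y. \<rho>\<^sub>0 0 y *\<^sub>R w 0 y) x = divg (\<lambda>y. \<rho>\<^sub>0 0 y *\<^sub>R w\<^sub>I y) x"
        by (rule divg_cong[OF lb.open_dom x]) (simp add: init)
      then show "F.\<pi> 0 x = c\<^sub>0 0 x / \<rho>\<^sub>0 0 x * divg (\<lambda>y. \<rho>\<^sub>0 0 y *\<^sub>R w\<^sub>I y) x"
        by (simp add: F.\<pi>_def F.m_def)
    qed
    have i3: "L2_norm (lebesgue_on \<Omega>) (dt_Lie u\<^sub>0 w 0)
        = L2_norm (lebesgue_on \<Omega>) (\<lambda>x. z\<^sub>I x + Lie (u\<^sub>0 0) w\<^sub>I x)"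
    proof (rule L2_norm_cong)
      fix x assume "x \<in> space (lebesgue_on \<Omega>)"
      then have x: "x \<in> \<Omega>" by simp
      have "Lie (u\<^sub>0 0) (w 0) x = Lie (u\<^sub>0 0) w\<^sub>I x"
        by (rule Lie_cong[OF lb.open_dom x]) (simp add: init)
      then show "dt_Lie u\<^sub>0 w 0 x = z\<^sub>I x + Lie (u\<^sub>0 0) w\<^sub>I x" by (simp add: dt_Lie_def init[OF x])
    qed
    have pi_eq: "F.\<pi> t = (\<lambda>x. c\<^sub>0 t x / \<rho>\<^sub>0 t x * divg (\<lambda>y. \<rho>\<^sub>0 t y *\<^sub>R w t y) x)"
      by (simp add: fun_eq_iff F.\<pi>_def F.m_def)
    have rate: "P.rate = \<nu>" by (simp add: P.rate_def \<nu>_def)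
    show "(L2_norm (lebesgue_on \<Omega>) (w t))\<^sup>2 / \<tau>\<^sub>0\<^sup>2
       + (L2_norm (lebesgue_on \<Omega>) (\<lambda>x. c\<^sub>0 t x / \<rho>\<^sub>0 t x * divg (\<lambda>y. \<rho>\<^sub>0 t y *\<^sub>R w t y) x))\<^sup>2
       + (L2_norm (lebesgue_on \<Omega>) (dt_Lie u\<^sub>0 w t))\<^sup>2
       \<le> 2 * r\<^sub>1 / r\<^sub>0 * exp (\<nu> * t) *
         ((L2_norm (lebesgue_on \<Omega>) w\<^sub>I)\<^sup>2 / \<tau>\<^sub>0\<^sup>2
          + (L2_norm (lebesgue_on \<Omega>) (\<lambda>x. c\<^sub>0 0 x / \<rho>\<^sub>0 0 x * divg (\<lambda>y. \<rho>\<^sub>0 0 y *\<^sub>R w\<^sub>I y) x))\<^sup>2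
          + (L2_norm (lebesgue_on \<Omega>) (\<lambda>x. z\<^sub>I x + Lie (u\<^sub>0 0) w\<^sub>I x))\<^sup>2
          + (LINT s:{0..t}|lborel.
               \<tau>\<^sub>0 * (L2_norm (lebesgue_on \<Omega>) (\<delta>\<phi> s))\<^sup>2
               + (SUP (r, x)\<in>?Q. c\<^sub>0 r x) / a * (L2_norm \<sigma> (g s))\<^sup>2))"
      using P.total_estimate[OF t] 
      unfolding P.total_def P.source_def[abs_def] i1 i2 i3 pi_eq rate unfolding c\<^sub>1_def .
  qed
qed

end
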